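(* Let $\mathfrak{H}$ be a complex Hilbert space of finite dimension $d$, $\Gamma$ a symmetric $N$-particle state on $\mathfrak{H}^{\otimes N}$ and $1\le k\le N$. For a quantum measurement $\mathcal{E}=(M_\mu,e_\mu)_\mu$ on $\mathfrak{H}^{\otimes(N-k)}$ set $p_\mu=\mathrm{tr}[(\mathbb{1}^{\otimes k}\otimes M_\mu)\Gamma]$ and, for $p_\mu>0$, $\Gamma_\mu^{(k)}=p_\mu^{-1}\mathrm{tr}_{k+1\to N}[(\mathbb{1}^{\otimes k}\otimes M_\mu)\Gamma]$ (a state on $\mathfrak{H}^{\otimes k}$), with one-particle reduced state $\Gamma_\mu^{(1)}$. Writing $\mathbf{L}_k=\Lambda_1\otimes\cdots\otimes\Lambda_k$, we have $$\inf_{\mathcal{E}\in\mathcal{M}(\mathfrak{H}^{\otimes(N-k)})}\ \sup_{\Lambda_1,\dots,\Lambda_k\in\mathcal{M}(\mathfrak{H})}\ \sum_{\mu:\,p_\mu>0}p_\mu\,\mathcal{H}\Big(\mathbf{L}_k\Gamma_\mu^{(k)},\ \mathbf{L}_k\big(\Gamma_\mu^{(1)}\big)^{\otimes k}\Big)\le\frac{(k-1)^2\log d}{N-k+1}.$$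
   Context: $\mathcal{H}(\Gamma,\Gamma')=\mathrm{tr}[\Gamma(\log\Gamma-\log\Gamma')]$ is the quantum relative entropy. A symmetric $N$-particle state is a density matrix $\Gamma$ on $\mathfrak{H}^{\otimes N}$ commuting with all permutation unitaries $U_\sigma$. A quantum measurement $\Lambda\in\mathcal{M}(\mathcal{K})$ on a finite-dimensional Hilbert space $\mathcal{K}$ is a family $(M_j,e_j)_{j}$ indexed by an orthonormal basis $(e_j)$ of $\mathcal{K}$ with $M_j\ge0$, $\sum_jM_j=\mathbb{1}$, acting by $\Lambda(\rho)=\sum_j\mathrm{tr}[M_j\rho]|e_j\rangle\langle e_j|$; tensor products of measurements use tensor products of the $M_j$'s and of the $e_j$'s. $\mathrm{tr}_{k+1\to N}$ is the partial trace over the last $N-k$ factors. *)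

theory Defs
  imports "HOL-Analysis.Analysis" "Jordan_Normal_Form.Schur_Decomposition"
begin

text \<open>Model: the one-particle space is \<complex>^d; \<complex>^(d^N) models the N-fold tensor power,
  with the index convention that the FIRST tensor factor is the most significant digit:
  index i of \<complex>^(n1*n2) = \<complex>^n1 \<otimes> \<complex>^n2 corresponds to (i div n2, i mod n2).\<close>

definition mtrace :: "complex mat \<Rightarrow> complex" where
  "mtrace A = (\<Sum>i<dim_row A. A $$ (i, i))"

definition ktensor :: "complex mat \<Rightarrow> complex mat \<Rightarrow> complex mat" where
  "ktensor A B = mat (dim_row A * dim_row B) (dim_col A * dim_col B)
     (\<lambda>(i, j). A $$ (i div dim_row B, j div dim_col B) * B $$ (i mod dim_row B, j mod dim_col B))"

definition vtensor :: "complex vec \<Rightarrow> complex vec \<Rightarrow> complex vec" where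
  "vtensor v w = vec (dim_vec v * dim_vec w) (\<lambda>i. v $ (i div dim_vec w) * w $ (i mod dim_vec w))"

fun tensor_pow :: "complex mat \<Rightarrow> nat \<Rightarrow> complex mat" where
  "tensor_pow A 0 = 1\<^sub>m 1"
| "tensor_pow A (Suc k) = ktensor (tensor_pow A k) A"

definition ptrace2 :: "nat \<Rightarrow> nat \<Rightarrow> complex mat \<Rightarrow> complex mat" where
  "ptrace2 n1 n2 A = mat n1 n1 (\<lambda>(i, j). \<Sum>l<n2. A $$ (i * n2 + l, j * n2 + l))"

definition psd :: "nat \<Rightarrow> complex mat \<Rightarrow> bool" where
  "psd n A \<longleftrightarrow> A \<in> carrier_mat n n \<and> mat_adjoint A = A \<and>
     (\<forall>v \<in> carrier_vec n. 0 \<le> Re ((A *\<^sub>v v) \<bullet>c v))"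

definition density :: "nat \<Rightarrow> complex mat \<Rightarrow> bool" where
  "density n A \<longleftrightarrow> psd n A \<and> mtrace A = 1"

definition digit :: "nat \<Rightarrow> nat \<Rightarrow> nat \<Rightarrow> nat \<Rightarrow> nat" where
  "digit d N i m = (i div d ^ (N - 1 - m)) mod d"

text \<open>permutation unitary U_\<sigma> on (\<complex>^d)^{\<otimes>N}: U_\<sigma>(x_1\<otimes>..\<otimes>x_N) = x_{\<sigma> 1}\<otimes>..\<otimes>x_{\<sigma> N}\<close>
definition perm_op :: "nat \<Rightarrow> nat \<Rightarrow> (nat \<Rightarrow> nat) \<Rightarrow> complex mat" where
  "perm_op d N \<sigma> = mat (d ^ N) (d ^ N)
     (\<lambda>(i, j). if (\<forall>m<N. digit d N i m = digit d N j (\<sigma> m)) then 1 else 0)"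

definition symmetric_state :: "nat \<Rightarrow> nat \<Rightarrow> complex mat \<Rightarrow> bool" where
  "symmetric_state d N \<Gamma> \<longleftrightarrow> density (d ^ N) \<Gamma> \<and>
     (\<forall>\<sigma>. \<sigma> permutes {..<N} \<longrightarrow> perm_op d N \<sigma> * \<Gamma> = \<Gamma> * perm_op d N \<sigma>)"

text \<open>A quantum measurement on \<complex>^n: POVM (M_j)_{j<n} together with an orthonormal basis (e_j)_{j<n}.\<close>
type_synonym measurement = "(nat \<Rightarrow> complex mat) \<times> (nat \<Rightarrow> complex vec)"

definition is_measurement :: "nat \<Rightarrow> measurement \<Rightarrow> bool" where
  "is_measurement n E \<longleftrightarrow>
     (\<forall>j<n. psd n (fst E j)) \<and>
     (\<forall>a<n. \<forall>b<n. (\<Sum>j<n. fst E j $$ (a, b)) = (if a = b then 1 else 0)) \<and>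
     (\<forall>j<n. snd E j \<in> carrier_vec n) \<and>
     (\<forall>j<n. \<forall>l<n. snd E j \<bullet>c snd E l = (if j = l then 1 else 0))"

definition apply_meas :: "nat \<Rightarrow> measurement \<Rightarrow> complex mat \<Rightarrow> complex mat" where
  "apply_meas n E \<rho> = mat n n (\<lambda>(a, b). \<Sum>j<n. mtrace (fst E j * \<rho>) * (snd E j $ a * cnj (snd E j $ b)))"

definition meas_tensor :: "nat \<Rightarrow> measurement \<Rightarrow> measurement \<Rightarrow> measurement" where
  "meas_tensor n2 E F =
     ((\<lambda>J. ktensor (fst E (J div n2)) (fst F (J mod n2))),
      (\<lambda>J. vtensor (snd E (J div n2)) (snd F (J mod n2))))"

fun meas_tensor_list :: "nat \<Rightarrow> (nat \<Rightarrow> measurement) \<Rightarrow> nat \<Rightarrow> measurement" where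
  "meas_tensor_list d \<Lambda> 0 = ((\<lambda>_. 1\<^sub>m 1), (\<lambda>_. unit_vec 1 0))"
| "meas_tensor_list d \<Lambda> (Suc k) = meas_tensor d (meas_tensor_list d \<Lambda> k) (\<Lambda> k)"

text \<open>Matrix logarithm of a Hermitian matrix via the spectral decomposition
  (the value assigned to ln of a zero eigenvalue is irrelevant in the uses below).\<close>
definition mat_log :: "complex mat \<Rightarrow> complex mat" where
  "mat_log A = (SOME L. \<exists>U (ev :: nat \<Rightarrow> real).
      U \<in> carrier_mat (dim_row A) (dim_row A) \<and> U * mat_adjoint U = 1\<^sub>m (dim_row A) \<and>
      A = U * mat_diag (dim_row A) (\<lambda>i. complex_of_real (ev i)) * mat_adjoint U \<and>
      L = U * mat_diag (dim_row A) (\<lambda>i. complex_of_real (ln (ev i))) * mat_adjoint U)"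

text \<open>Quantum relative entropy H(\<rho>,\<sigma>) = tr[\<rho>(log \<rho> - log \<sigma>)], with value +\<infinity>
  unless supp \<rho> \<subseteq> supp \<sigma> (i.e. ker \<sigma> \<subseteq> ker \<rho>).\<close>
definition qrel_entropy :: "complex mat \<Rightarrow> complex mat \<Rightarrow> ereal" where
  "qrel_entropy \<rho> \<sigma> =
     (if (\<forall>v \<in> carrier_vec (dim_row \<sigma>). \<sigma> *\<^sub>v v = 0\<^sub>v (dim_row \<sigma>) \<longrightarrow> \<rho> *\<^sub>v v = 0\<^sub>v (dim_row \<rho>))
      then ereal (Re (mtrace (\<rho> * (mat_log \<rho> - mat_log \<sigma>))))
      else \<infinity>)"

definition outcome_prob :: "nat \<Rightarrow> nat \<Rightarrow> complex mat \<Rightarrow> measurement \<Rightarrow> nat \<Rightarrow> real" where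
  "outcome_prob d k \<Gamma> E \<mu> = Re (mtrace (ktensor (1\<^sub>m (d ^ k)) (fst E \<mu>) * \<Gamma>))"

definition cond_state :: "nat \<Rightarrow> nat \<Rightarrow> nat \<Rightarrow> complex mat \<Rightarrow> measurement \<Rightarrow> nat \<Rightarrow> complex mat" where
  "cond_state d N k \<Gamma> E \<mu> =
     complex_of_real (1 / outcome_prob d k \<Gamma> E \<mu>) \<cdot>\<^sub>m
       ptrace2 (d ^ k) (d ^ (N - k)) (ktensor (1\<^sub>m (d ^ k)) (fst E \<mu>) * \<Gamma>)"

definition one_particle :: "nat \<Rightarrow> nat \<Rightarrow> complex mat \<Rightarrow> complex mat" where
  "one_particle d k \<gamma> = ptrace2 d (d ^ (k - 1)) \<gamma>"

end

(*
  Conditioning. Let S be the entropy of the first k - 1 particles. As long as some one-particle measurement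
  on a further particle extracts more than the average information S / (number of further particles) about
  the first k - 1 ones, apply it to the last particle and continue with each post-measurement state.
  The entropy of the first k - 1 particles is at most (k - 1) log d and decreases by the information
  extracted, so the conditional states finally reached satisfy, on average over the outcomes, that every measurement
  of particle k reveals at most (k - 1) log d / (N - k + 1) about the particles before it. No fixed choice of the
  local measurements enters the construction, which gives the infimum outside of the supremum.

  The relative entropy of a measured state to the product of its marginals is a sum of k - 1 mutual
  informations, and by symmetry and Holevo's bound each is at most the information just estimated.

  Holevo's bound reduces to the monotonicity of the relative entropy under measurements. With
  spectral decompositions (a, u) and (b, w) of the two states, their relative entropy is the classical one of the weights
  a_i |<u_i, w_j>|^2 and b_j |<u_i, w_j>|^2. By the integral representation of the logarithm it suffices to
  compare resolvents, which is an arithmetic-geometric mean inequality for each parameter s > 0.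
*)
theory Submission
  imports Defs "HOL-Real_Asymp.Real_Asymp"
begin

section \<open>Spectral decomposition of positive semidefinite matrices\<close>

text \<open>The averaging over the remaining particles must survive an adaptive protocol, so the
  induction carries a bound \<open>g j\<close> on \<open>chi\<close> for every outcome j together
  with one budget, \<open>(m + 1) * sum g <= ent\<close>. A measurement that extracts more than the
  fraction 1/(m+2) of the entropy s leaves less than s (m+1)/(m+2), and the budget for m particles
  turns this into the total s/(m+2). Nothing is normalised on the way: entropies and informations
  are homogeneous, \<open>g j\<close> contains the probability of j, averages are plain sums, and
  outcomes of probability zero contribute zero. The bound on \<open>chi\<close> leaves the first k -
  1 particles unmeasured. One number therefore serves for all k - 1 mutual informations, since
  reading only i of these particles is still a measurement on all of them, with identities in the
  other slots. This is the origin of the square: one factor k - 1 counts mutual informations, the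
  other comes from the entropy of k - 1 particles. A measurement in dimension n has exactly n
  outcomes. Composition respects this, since d^m * d = d^(m+1), and stopping early is padded with
  zero operators.\<close>

definition trp :: "nat \<Rightarrow> complex mat \<Rightarrow> complex mat \<Rightarrow> complex" where
  "trp n A B = (\<Sum>i<n. \<Sum>j<n. A $$ (i, j) * B $$ (j, i))"

text \<open>\<open>v s i\<close> is component i of vector s. Vectors are functions, so linear
  combinations carry no carrier conditions. The second clause is the resolution of the
  identity.\<close>

definition orthonormal_basis :: "nat \<Rightarrow> (nat \<Rightarrow> nat \<Rightarrow> complex) \<Rightarrow> bool" where
  "orthonormal_basis n v \<longleftrightarrow>
     (\<forall>s<n. \<forall>t<n. (\<Sum>i<n. v s i * cnj (v t i)) = (if s = t then 1 else 0)) \<and>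
     (\<forall>i<n. \<forall>j<n. (\<Sum>s<n. v s i * cnj (v s j)) = (if i = j then 1 else 0))"

definition spectral :: "nat \<Rightarrow> complex mat \<Rightarrow> (nat \<Rightarrow> real) \<Rightarrow> (nat \<Rightarrow> nat \<Rightarrow> complex) \<Rightarrow> bool" where
  "spectral n A a v \<longleftrightarrow> orthonormal_basis n v \<and> (\<forall>s<n. 0 \<le> a s) \<and>
     (\<forall>i<n. \<forall>j<n. A $$ (i, j) = (\<Sum>s<n. complex_of_real (a s) * (v s i * cnj (v s j))))"

lemma mat_adjoint_index:
  assumes "A \<in> carrier_mat n m" "i < m" "j < n"
  shows "mat_adjoint A $$ (i, j) = cnj (A $$ (j, i))"
  using assms unfolding mat_adjoint_def mat_of_rows_def by simp

lemma mat_adjoint_carrier: "A \<in> carrier_mat n m \<Longrightarrow> mat_adjoint A \<in> carrier_mat m n"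
  unfolding mat_adjoint_def by (auto simp: mat_of_rows_def)

lemma quadratic_form_index:
  assumes "A \<in> carrier_mat n n" "v \<in> carrier_vec n"
  shows "(A *\<^sub>v v) \<bullet>c v = (\<Sum>i<n. \<Sum>j<n. cnj (v $ i) * A $$ (i, j) * v $ j)"
  using assms
  by (auto simp: scalar_prod_def sum_distrib_right atLeast0LessThan sum_distrib_left mult.commute mult.left_commute intro!: sum.cong)

lemma psd_iff:
  "psd n A \<longleftrightarrow> A \<in> carrier_mat n n \<and> (\<forall>i<n. \<forall>j<n. A $$ (j, i) = cnj (A $$ (i, j))) \<and>
     (\<forall>f. 0 \<le> Re (\<Sum>i<n. \<Sum>j<n. cnj (f i) * A $$ (i, j) * f j))"
proof -
  have 1: "mat_adjoint A = A \<longleftrightarrow> (\<forall>i<n. \<forall>j<n. A $$ (j, i) = cnj (A $$ (i, j)))"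
    if A: "A \<in> carrier_mat n n"
  proof
    assume "mat_adjoint A = A"
    then show "\<forall>i<n. \<forall>j<n. A $$ (j, i) = cnj (A $$ (i, j))"
      using mat_adjoint_index[OF A] by metis
  next
    assume "\<forall>i<n. \<forall>j<n. A $$ (j, i) = cnj (A $$ (i, j))"
    then have h: "cnj (A $$ (j, i)) = A $$ (i, j)" if "i < n" "j < n" for i j
      using that by metis
    show "mat_adjoint A = A"
      using mat_adjoint_carrier[OF A] A by (intro eq_matI) (simp_all add: mat_adjoint_index[OF A] h)
  qed
  have 2: "(\<forall>v \<in> carrier_vec n. 0 \<le> Re ((A *\<^sub>v v) \<bullet>c v)) \<longleftrightarrow>
     (\<forall>f. 0 \<le> Re (\<Sum>i<n. \<Sum>j<n. cnj (f i) * A $$ (i, j) * f j))" if A: "A \<in> carrier_mat n n"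
  proof
    assume l: "\<forall>v \<in> carrier_vec n. 0 \<le> Re ((A *\<^sub>v v) \<bullet>c v)"
    show "\<forall>f. 0 \<le> Re (\<Sum>i<n. \<Sum>j<n. cnj (f i) * A $$ (i, j) * f j)"
    proof
      fix f
      show "0 \<le> Re (\<Sum>i<n. \<Sum>j<n. cnj (f i) * A $$ (i, j) * f j)"
        using l[rule_format, of "vec n f"] quadratic_form_index[OF A, of "vec n f"] by simp
    qed
  next
    assume r: "\<forall>f. 0 \<le> Re (\<Sum>i<n. \<Sum>j<n. cnj (f i) * A $$ (i, j) * f j)"
    show "\<forall>v \<in> carrier_vec n. 0 \<le> Re ((A *\<^sub>v v) \<bullet>c v)"
      using quadratic_form_index[OF A] r by auto
  qed
  show ?thesis unfolding psd_def using 1 2 by auto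
qed

lemma psdD:
  assumes "psd n A"
  shows "A \<in> carrier_mat n n" "\<And>i j. i < n \<Longrightarrow> j < n \<Longrightarrow> A $$ (j, i) = cnj (A $$ (i, j))"
    "0 \<le> Re (\<Sum>i<n. \<Sum>j<n. cnj (f i) * A $$ (i, j) * f j)"
  using assms unfolding psd_iff by blast+

text \<open>Each s contributes a squared modulus to the quadratic form. With the converse
  \<open>psd_gram\<close>, positivity of tensor products and of reduced operators becomes a
  rearrangement of sums.\<close>

lemma psd_of_gram:
  assumes A: "A \<in> carrier_mat n n" and S: "finite S"
    and eq: "\<And>i j. i < n \<Longrightarrow> j < n \<Longrightarrow> A $$ (i, j) = (\<Sum>s\<in>S. z s i * cnj (z s j))"
  shows "psd n A"
  unfolding psd_iff
proof (intro conjI allI impI)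
  fix f
  have "(\<Sum>i<n. \<Sum>j<n. cnj (f i) * A $$ (i, j) * f j)
      = (\<Sum>i<n. \<Sum>j<n. \<Sum>s\<in>S. cnj (f i) * (z s i * cnj (z s j)) * f j)"
    by (intro sum.cong refl) (simp add: eq sum_distrib_left sum_distrib_right)
  also have "\<dots> = (\<Sum>i<n. \<Sum>s\<in>S. \<Sum>j<n. cnj (f i) * (z s i * cnj (z s j)) * f j)"
    by (intro sum.cong refl sum.swap)
  also have "\<dots> = (\<Sum>s\<in>S. \<Sum>i<n. \<Sum>j<n. cnj (f i) * (z s i * cnj (z s j)) * f j)"
    by (rule sum.swap)
  also have "\<dots> = (\<Sum>s\<in>S. (\<Sum>i<n. cnj (f i) * z s i) * cnj (\<Sum>j<n. cnj (f j) * z s j))"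
    unfolding cnj_sum sum_product by (simp add: mult_ac)
  also have "\<dots> = (\<Sum>s\<in>S. of_real ((cmod (\<Sum>i<n. cnj (f i) * z s i))\<^sup>2))"
    by (simp only: complex_norm_square)
  finally show "0 \<le> Re (\<Sum>i<n. \<Sum>j<n. cnj (f i) * A $$ (i, j) * f j)"
    by (simp add: sum_nonneg)
qed (use A eq in \<open>auto simp: mult.commute\<close>)

lemma mtrace_mult:
  assumes "A \<in> carrier_mat n n" "B \<in> carrier_mat n n"
  shows "mtrace (A * B) = trp n A B"
  using assms unfolding mtrace_def trp_def by (auto simp: scalar_prod_def atLeast0LessThan intro!: sum.cong)

lemma trp_commute: "trp n A B = trp n B A"
  unfolding trp_def by (subst sum.swap) (simp add: mult.commute)

lemma mtrace_similar:
  assumes "similar_mat_wit A B P Q" "A \<in> carrier_mat n n"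
  shows "mtrace A = mtrace B"
proof -
  have c: "B \<in> carrier_mat n n" "P \<in> carrier_mat n n" "Q \<in> carrier_mat n n" "Q * P = 1\<^sub>m n" "A = P * B * Q"
    using assms unfolding similar_mat_wit_def Let_def by auto
  have "mtrace A = mtrace ((P * B) * Q)" using c by simp
  also have "\<dots> = mtrace (Q * (P * B))"
  proof -
    have "P * B \<in> carrier_mat n n" using c by auto
    with c(3) show ?thesis by (simp add: mtrace_mult[of _ n] trp_commute[of n Q])
  qed
  also have "Q * (P * B) = (Q * P) * B" using assoc_mult_mat[OF c(3,2,1)] by simp
  also have "\<dots> = 1\<^sub>m n * B" by (simp only: c(4))
  also have "\<dots> = B" using c(1) by simp
  finally show ?thesis .
qed

text \<open>In a Schur triangular form the diagonal consists of roots of the characteristic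
  polynomial, and similarity preserves the trace.\<close>

lemma mtrace_all_eigenvalues:
  fixes A :: "complex mat"
  assumes A: "A \<in> carrier_mat n n" and ev: "\<And>e. eigenvalue A e \<Longrightarrow> e = K"
  shows "mtrace A = of_nat n * K"
proof -
  obtain as where as: "char_poly A = (\<Prod>a\<leftarrow>as. [:- a, 1:])" and len: "length as = degree (char_poly A)"
    using fundamental_theorem_algebra_factorized[of "char_poly A"] degree_monic_char_poly[OF A]
    by (metis smult_1_left)
  obtain B where B: "similar_mat A B" "upper_triangular B" "diag_mat B = as"
  proof -
    obtain B P Q where s: "schur_decomposition A as = (B, P, Q)" by (cases "schur_decomposition A as") auto
    from schur_decomposition[OF A as s] that show ?thesis by (auto simp: similar_mat_def)
  qed
  have K: "x = K" if "x \<in> set as" for x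
  proof -
    have "poly (char_poly A) x = 0" using that unfolding as by (induction as) auto
    then show ?thesis using ev eigenvalue_root_char_poly[OF A] by auto
  qed
  obtain P Q where w: "similar_mat_wit A B P Q" using B(1) by (auto simp: similar_mat_def)
  have Bc: "B \<in> carrier_mat n n" using w A unfolding similar_mat_wit_def Let_def by auto
  have "B $$ (i, i) \<in> set as" if "i < n" for i
    using B(3) Bc that unfolding diag_mat_def by auto
  then have "\<And>i. i < n \<Longrightarrow> B $$ (i, i) = K" using K by simp
  then show ?thesis using mtrace_similar[OF w A] Bc by (simp add: mtrace_def)
qed

lemma psd_quadratic_real:
  assumes "psd n A"
  shows "Im (\<Sum>i<n. \<Sum>j<n. cnj (f i) * A $$ (i, j) * f j) = 0"
proof -
  let ?q = "\<Sum>i<n. \<Sum>j<n. cnj (f i) * A $$ (i, j) * f j"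
  have "cnj ?q = (\<Sum>i<n. \<Sum>j<n. f i * A $$ (j, i) * cnj (f j))"
    unfolding cnj_sum by (intro sum.cong refl) (simp add: psdD(2)[OF assms, symmetric])
  also have "\<dots> = ?q"
    by (subst sum.swap) (simp add: mult_ac)
  finally have "Im (cnj ?q) = Im ?q" by (rule arg_cong)
  then show ?thesis using cnj.sel(2)[of ?q] by linarith
qed

text \<open>With \<open>P\<close> the projection onto the span of \<open>v\<close>, every eigenvector of
  \<open>A (1 - P) + K P\<close> whose eigenvalue differs from \<open>K\<close> is an eigenvector of \<open>A\<close> orthogonal to \<open>v\<close>.
  If neither \<open>K = 0\<close> nor \<open>K = 1\<close> admitted one, comparing the two traces would give \<open>c = n\<close>.\<close>
lemma psd_eigenvector_extension:
  assumes A: "psd n A" and c: "c < n"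
    and on: "\<And>s t. s < c \<Longrightarrow> t < c \<Longrightarrow> (\<Sum>i<n. v s i * cnj (v t i)) = (if s = t then 1 else 0)"
    and ev: "\<And>s i. s < c \<Longrightarrow> i < n \<Longrightarrow> (\<Sum>j<n. A $$ (i, j) * v s j) = of_real (a s) * v s i"
  shows "\<exists>\<mu> w. (\<Sum>i<n. w i * cnj (w i)) = 1 \<and> (\<forall>s<c. (\<Sum>i<n. w i * cnj (v s i)) = 0) \<and>
     (\<forall>i<n. (\<Sum>j<n. A $$ (i, j) * w j) = of_real \<mu> * w i) \<and> 0 \<le> \<mu>"
proof -
  define B where "B K = mat n n (\<lambda>(i, j). A $$ (i, j) +
      (\<Sum>s<c. complex_of_real (K - a s) * (v s i * cnj (v s j))))" for K :: real
  have Bc: "B K \<in> carrier_mat n n" for K by (simp add: B_def)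
  have Bh: "B K $$ (j, i) = cnj (B K $$ (i, j))" if "i < n" "j < n" for K i j
    using that by (simp add: B_def psdD(2)[OF A that] mult.commute)
  have Bapp: "(\<Sum>j<n. B K $$ (i, j) * w j) = (\<Sum>j<n. A $$ (i, j) * w j) +
      (\<Sum>s<c. complex_of_real (K - a s) * v s i * (\<Sum>j<n. w j * cnj (v s j)))" if "i < n" for K i w
  proof -
    have "(\<Sum>j<n. B K $$ (i, j) * w j) = (\<Sum>j<n. A $$ (i, j) * w j + 
        (\<Sum>s<c. complex_of_real (K - a s) * (v s i * cnj (v s j)) * w j))"
      using that by (intro sum.cong) (simp_all add: B_def ring_distribs sum_distrib_right)
    also have "\<dots> = (\<Sum>j<n. A $$ (i, j) * w j) + (\<Sum>s<c. \<Sum>j<n. complex_of_real (K - a s) * (v s i * cnj (v s j)) * w j)"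
      by (simp only: sum.distrib sum.swap[of _ "{..<n}" "{..<c}"])
    finally show ?thesis by (simp add: sum_distrib_left mult_ac)
  qed
  have Bv: "(\<Sum>j<n. B K $$ (i, j) * v s j) = of_real K * v s i" if "i < n" "s < c" for K i s
  proof -
    have "(\<Sum>t<c. complex_of_real (K - a t) * v t i * (\<Sum>j<n. v s j * cnj (v t j)))
       = (\<Sum>t<c. if t = s then complex_of_real (K - a s) * v s i else 0)"
      using that by (intro sum.cong) (auto simp: on)
    also have "\<dots> = complex_of_real (K - a s) * v s i" using that by simp
    finally show ?thesis using that by (simp add: Bapp ev ring_distribs)
  qed
  have Btr: "mtrace (B K) = mtrace A + (\<Sum>s<c. complex_of_real (K - a s))" for K
  proof -
    have "mtrace (B K) = mtrace A + (\<Sum>i<n. \<Sum>s<c. complex_of_real (K - a s) * (v s i * cnj (v s i)))"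
      using psdD(1)[OF A] by (simp add: mtrace_def B_def sum.distrib)
    also have "(\<Sum>i<n. \<Sum>s<c. complex_of_real (K - a s) * (v s i * cnj (v s i)))
        = (\<Sum>s<c. complex_of_real (K - a s) * (\<Sum>i<n. v s i * cnj (v s i)))"
      by (subst sum.swap) (simp add: sum_distrib_left)
    finally show ?thesis by (simp add: on)
  qed
  have "\<exists>K e. eigenvalue (B K) e \<and> e \<noteq> of_real K"
  proof (rule ccontr)
    assume "\<not> ?thesis"
    then have "\<And>K. mtrace (B K) = of_nat n * of_real K"
      by (intro mtrace_all_eigenvalues[OF Bc]) blast
    from this[of 0] this[of 1] have "(\<Sum>s<c. complex_of_real (1 - a s)) - (\<Sum>s<c. complex_of_real (0 - a s)) = of_nat n"
      unfolding Btr by simp (metis add_diff_cancel_left diff_zero)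
    then have "(of_nat c :: complex) = of_nat n" by (simp add: sum_subtractf[symmetric])
    then show False using c by simp
  qed
  then obtain K e where e: "eigenvalue (B K) e" "e \<noteq> of_real K" by blast
  then obtain u where u: "u \<in> carrier_vec n" "u \<noteq> 0\<^sub>v n" "B K *\<^sub>v u = e \<cdot>\<^sub>v u"
    using Bc[of K] unfolding eigenvalue_def eigenvector_def by auto
  have Bu: "(\<Sum>j<n. B K $$ (i, j) * u $ j) = e * u $ i" if "i < n" for i
  proof -
    have "(B K *\<^sub>v u) $ i = (\<Sum>j<n. B K $$ (i, j) * u $ j)"
      using that u(1) Bc[of K] by (simp add: scalar_prod_def atLeast0LessThan)
    then show ?thesis using u that by simp
  qed
  \<comment> \<open>Eigenvectors of the Hermitian matrix \<open>B K\<close> for different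
    eigenvalues are orthogonal. Only K has to be real for this; e is recognised as real further
    down. Orthogonality then removes the correction term of \<open>B K\<close>, so u is an
    eigenvector of A itself.\<close>
  have orth: "(\<Sum>i<n. u $ i * cnj (v s i)) = 0" if s: "s < c" for s
  proof -
    have "e * (\<Sum>i<n. u $ i * cnj (v s i)) = (\<Sum>i<n. \<Sum>j<n. B K $$ (i, j) * u $ j * cnj (v s i))"
      by (simp add: sum_distrib_left sum_distrib_right[symmetric] Bu mult.assoc[symmetric])
    also have "\<dots> = (\<Sum>j<n. \<Sum>i<n. B K $$ (i, j) * u $ j * cnj (v s i))" by (rule sum.swap)
    also have "\<dots> = (\<Sum>j<n. u $ j * cnj (\<Sum>i<n. B K $$ (j, i) * v s i))"
      unfolding cnj_sum sum_distrib_left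
    proof (intro sum.cong refl)
      fix j i assume "j \<in> {..<n}" "i \<in> {..<n}"
      then show "B K $$ (i, j) * u $ j * cnj (v s i) = u $ j * cnj (B K $$ (j, i) * v s i)"
        by (simp add: Bh[of j i])
    qed
    also have "\<dots> = (\<Sum>j<n. u $ j * cnj (of_real K * v s j))"
      using s by (intro sum.cong refl) (simp only: Bv lessThan_iff)
    also have "\<dots> = of_real K * (\<Sum>i<n. u $ i * cnj (v s i))"
      by (simp add: sum_distrib_left mult_ac)
    finally show ?thesis using e(2) by simp
  qed
  have Au: "(\<Sum>j<n. A $$ (i, j) * u $ j) = e * u $ i" if "i < n" for i
    using Bapp[OF that, of K "\<lambda>j. u $ j"] Bu[OF that] orth by simp
  define r where "r = (\<Sum>i<n. (cmod (u $ i))\<^sup>2)"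
  have "0 < r"
  proof -
    obtain i where "i < n" "u $ i \<noteq> 0" using u(1,2) by (metis carrier_vecD eq_vecI index_zero_vec)
    then show ?thesis unfolding r_def by (intro sum_pos2[of _ i]) auto
  qed
  define w where "w i = u $ i / of_real (sqrt r)" for i
  have sq: "complex_of_real (sqrt r) * complex_of_real (sqrt r) = of_real r"
    using \<open>0 < r\<close> by (metis of_real_mult real_sqrt_mult_self abs_of_pos)
  have "(\<Sum>i<n. w i * cnj (w i)) = (\<Sum>i<n. u $ i * cnj (u $ i)) / of_real r"
    by (simp add: w_def sum_divide_distrib sq)
  also have "(\<Sum>i<n. u $ i * cnj (u $ i)) = of_real r"
    unfolding r_def of_real_sum by (intro sum.cong refl) (simp only: complex_norm_square)
  finally have w1: "(\<Sum>i<n. w i * cnj (w i)) = 1" using \<open>0 < r\<close> by simp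
  have w2: "\<forall>s<c. (\<Sum>i<n. w i * cnj (v s i)) = 0"
    using orth by (simp add: w_def sum_divide_distrib[symmetric])
  have w3: "(\<Sum>j<n. A $$ (i, j) * w j) = e * w i" if "i < n" for i
    using Au[OF that] by (simp add: w_def sum_divide_distrib[symmetric])
  have "(\<Sum>i<n. \<Sum>j<n. cnj (w i) * A $$ (i, j) * w j) = (\<Sum>i<n. cnj (w i) * (e * w i))"
    by (intro sum.cong refl) (simp add: w3[symmetric] sum_distrib_left mult.assoc)
  also have "\<dots> = e * (\<Sum>i<n. w i * cnj (w i))" by (simp add: sum_distrib_left mult_ac)
  finally have e': "(\<Sum>i<n. \<Sum>j<n. cnj (w i) * A $$ (i, j) * w j) = e" using w1 by simp
  have "Im e = 0" "0 \<le> Re e"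
    using psd_quadratic_real[OF A, of w] psdD(3)[OF A, of w] unfolding e' by auto
  then have "e = of_real (Re e)" by (simp add: complex_eq_iff)
  then have "(\<Sum>j<n. A $$ (i, j) * w j) = of_real (Re e) * w i" if "i < n" for i using w3[OF that] by simp
  then show ?thesis using w1 w2 \<open>0 \<le> Re e\<close> by (intro exI[of _ "Re e"] exI[of _ w]) simp
qed

lemma psd_partial_eigenbasis:
  assumes A: "psd n A" and "c \<le> n"
  shows "\<exists>a v. (\<forall>s<c. \<forall>t<c. (\<Sum>i<n. v s i * cnj (v t i)) = (if s = t then 1 else 0)) \<and>
    (\<forall>s<c. \<forall>i<n. (\<Sum>j<n. A $$ (i, j) * v s j) = of_real (a s) * v s i) \<and> (\<forall>s<c. 0 \<le> (a s :: real))"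
  using assms(2)
proof (induction c)
  case (Suc c)
  from Suc.IH[OF Suc_leD[OF Suc.prems]] obtain a v where 
    on: "\<And>s t. s < c \<Longrightarrow> t < c \<Longrightarrow> (\<Sum>i<n. v s i * cnj (v t i)) = (if s = t then 1 else 0)" and
    ev: "\<And>s i. s < c \<Longrightarrow> i < n \<Longrightarrow> (\<Sum>j<n. A $$ (i, j) * v s j) = of_real (a s) * v s i" and
    pos: "\<And>s. s < c \<Longrightarrow> 0 \<le> (a s :: real)" by blast
  from psd_eigenvector_extension[of n A c v a, OF A _ on ev] Suc.prems obtain \<mu> w where w:
    "(\<Sum>i<n. w i * cnj (w i)) = 1" "\<And>s. s < c \<Longrightarrow> (\<Sum>i<n. w i * cnj (v s i)) = 0"
    "\<And>i. i < n \<Longrightarrow> (\<Sum>j<n. A $$ (i, j) * w j) = of_real \<mu> * w i" "0 \<le> \<mu>"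
    by auto
  have w': "(\<Sum>i<n. v s i * cnj (w i)) = 0" if "s < c" for s
  proof -
    have "(\<Sum>i<n. v s i * cnj (w i)) = cnj (\<Sum>i<n. w i * cnj (v s i))" by (simp add: mult.commute)
    then show ?thesis using w(2)[OF that] by simp
  qed
  show ?case
    by (intro exI[of _ "a(c := \<mu>)"] exI[of _ "v(c := w)"])
      (auto simp: less_Suc_eq w w' on ev pos)
qed simp

text \<open>Completeness is automatic for n orthonormal vectors in dimension n, because a one-sided
  inverse of a square matrix is two-sided.\<close>

lemma orthonormal_basisI:
  assumes on: "\<And>s t. s < n \<Longrightarrow> t < n \<Longrightarrow> (\<Sum>i<n. v s i * cnj (v t i)) = (if s = t then 1 else 0)"
  shows "orthonormal_basis n v"
proof -
  define V where "V = mat n n (\<lambda>(s, i). v s i)"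
  define W where "W = mat n n (\<lambda>(i, t). cnj (v t i))"
  have c: "V \<in> carrier_mat n n" "W \<in> carrier_mat n n" by (auto simp: V_def W_def)
  have "V * W = 1\<^sub>m n"
    by (rule eq_matI) (auto simp: V_def W_def scalar_prod_def atLeast0LessThan on)
  then have WV: "W * V = 1\<^sub>m n" using mat_mult_left_right_inverse[OF c] by simp
  have "(\<Sum>s<n. v s i * cnj (v s j)) = (if i = j then 1 else 0)" if ij: "i < n" "j < n" for i j
  proof -
    have "(W * V) $$ (j, i) = (\<Sum>s<n. v s i * cnj (v s j))"
      using ij by (simp add: V_def W_def scalar_prod_def atLeast0LessThan mult.commute)
    moreover have "(W * V) $$ (j, i) = (if i = j then 1 else 0)" using WV ij by simp
    ultimately show ?thesis by (simp only:)
  qed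
  then show ?thesis using on unfolding orthonormal_basis_def by blast
qed

lemma spectral_exists:
  assumes A: "psd n A"
  shows "\<exists>a v. spectral n A a v"
proof -
  obtain a v where 
    on: "\<And>s t. s < n \<Longrightarrow> t < n \<Longrightarrow> (\<Sum>i<n. v s i * cnj (v t i)) = (if s = t then 1 else 0)" and
    ev: "\<And>s i. s < n \<Longrightarrow> i < n \<Longrightarrow> (\<Sum>j<n. A $$ (i, j) * v s j) = of_real (a s) * v s i" and
    pos: "\<And>s. s < n \<Longrightarrow> 0 \<le> (a s :: real)" 
    using psd_partial_eigenbasis[OF A order_refl] by blast
  have ob: "orthonormal_basis n v" by (rule orthonormal_basisI) (rule on)
  have "A $$ (i, j) = (\<Sum>s<n. of_real (a s) * (v s i * cnj (v s j)))" if ij: "i < n" "j < n" for i j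
  proof -
    have "A $$ (i, j) = (\<Sum>l<n. if l = j then A $$ (i, l) else 0)"
      using ij by simp
    also have "\<dots> = (\<Sum>l<n. A $$ (i, l) * (\<Sum>s<n. v s l * cnj (v s j)))"
      using ob ij unfolding orthonormal_basis_def by (intro sum.cong refl) auto
    also have "\<dots> = (\<Sum>l<n. \<Sum>s<n. A $$ (i, l) * v s l * cnj (v s j))"
      by (simp add: sum_distrib_left mult.assoc)
    also have "\<dots> = (\<Sum>s<n. \<Sum>l<n. A $$ (i, l) * v s l * cnj (v s j))"
      by (rule sum.swap)
    also have "\<dots> = (\<Sum>s<n. of_real (a s) * (v s i * cnj (v s j)))"
      using ij by (simp add: sum_distrib_right[symmetric] ev mult.assoc[symmetric])
    finally show ?thesis .
  qed
  then show ?thesis using ob pos unfolding spectral_def by blast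
qed

section \<open>Holevo's bound\<close>

text \<open>The integral representation of the logarithm in differentiated form: shifting all
  arguments by s, the difference of the two sides has a nonpositive derivative by \<open>le\<close>,
  and it tends to 0 as s grows, because equal masses allow \<open>ln s\<close> to be subtracted on
  both sides. Its value at s = 0 is therefore nonnegative.\<close>

lemma ln_sum_le_of_resolvent_le:
  fixes w r :: "'a \<Rightarrow> real" and v t :: "'b \<Rightarrow> real"
  assumes r: "\<And>i. i \<in> I \<Longrightarrow> 0 < r i" and t: "\<And>j. j \<in> J \<Longrightarrow> 0 < t j"
    and mass: "sum w I = sum v J"
    and le: "\<And>s. 0 < s \<Longrightarrow> (\<Sum>j\<in>J. v j / (t j + s)) \<le> (\<Sum>i\<in>I. w i / (r i + s))"
  shows "(\<Sum>i\<in>I. w i * ln (r i)) \<le> (\<Sum>j\<in>J. v j * ln (t j))"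
proof -
  define g where "g s = (\<Sum>j\<in>J. v j * ln (t j + s)) - (\<Sum>i\<in>I. w i * ln (r i + s))" for s
  define g' where "g' s = (\<Sum>j\<in>J. v j / (t j + s)) - (\<Sum>i\<in>I. w i / (r i + s))" for s
  have der: "DERIV g s :> g' s" if "0 \<le> s" for s
    unfolding g_def[abs_def] g'_def
    by (auto intro!: derivative_eq_intros sum.cong add_pos_nonneg[OF r that] add_pos_nonneg[OF t that]
        simp: divide_inverse mult.commute)
  have dec: "g s \<le> g 0" if s: "0 < s" for s
  proof -
    obtain z where z: "0 < z" "g s - g 0 = (s - 0) * g' z"
      using MVT2[OF s, of g g'] der by auto
    have "g' z \<le> 0" using le[OF z(1)] by (simp add: g'_def)
    then show ?thesis using z(2) s by (metis diff_zero less_eq_real_def mult_nonneg_nonpos diff_le_0_iff_le)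
  qed
  have lim: "((\<lambda>s. ln (c + s) - ln s) \<longlongrightarrow> 0) at_top" if "0 < c" for c :: real
    using that by real_asymp
  have "((\<lambda>s. (\<Sum>j\<in>J. v j * (ln (t j + s) - ln s)) - (\<Sum>i\<in>I. w i * (ln (r i + s) - ln s)))
      \<longlongrightarrow> (\<Sum>j\<in>J. v j * 0) - (\<Sum>i\<in>I. w i * 0)) at_top"
    by (intro tendsto_intros lim r t)
  moreover have "(\<Sum>j\<in>J. v j * (ln (t j + s) - ln s)) - (\<Sum>i\<in>I. w i * (ln (r i + s) - ln s)) = g s" for s
    by (simp add: g_def ring_distribs sum_subtractf sum_distrib_right[symmetric] mass)
  ultimately have "(g \<longlongrightarrow> 0) at_top" by simp
  then have "0 \<le> g 0"
    by (rule tendsto_upperbound) (auto intro!: eventually_mono[OF eventually_gt_at_top[of 0]] dec)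
  then show ?thesis by (simp add: g_def)
qed

section \<open>Inner products, POVMs and monotonicity of the relative entropy under
  measurements\<close>

definition ip :: "nat \<Rightarrow> (nat \<Rightarrow> complex) \<Rightarrow> (nat \<Rightarrow> complex) \<Rightarrow> complex" where
  "ip n x y = (\<Sum>i<n. cnj (x i) * y i)"

definition app :: "nat \<Rightarrow> complex mat \<Rightarrow> (nat \<Rightarrow> complex) \<Rightarrow> nat \<Rightarrow> complex" where
  "app n A x i = (\<Sum>j<n. A $$ (i, j) * x j)"

lemma ip_commute: "ip n y x = cnj (ip n x y)"
  by (simp add: ip_def mult.commute)

lemma ip_app: "ip n x (app n A y) = (\<Sum>i<n. \<Sum>j<n. cnj (x i) * A $$ (i, j) * y j)"
  by (simp add: ip_def app_def sum_distrib_left mult.assoc)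

lemma ip_diff_right: "ip n x (\<lambda>i. y i - z i) = ip n x y - ip n x z"
  by (simp add: ip_def ring_distribs sum_subtractf)

lemma ip_scale_right: "ip n x (\<lambda>i. c * y i) = c * ip n x y"
  by (simp add: ip_def sum_distrib_left mult_ac)

lemma ip_diff_left: "ip n (\<lambda>i. y i - z i) x = ip n y x - ip n z x"
  by (simp add: ip_def ring_distribs sum_subtractf)

lemma ip_scale_left: "ip n (\<lambda>i. c * y i) x = cnj c * ip n y x"
  by (simp add: ip_def sum_distrib_left mult_ac)

lemma ip_sum_right: "ip n x (\<lambda>i. \<Sum>s\<in>S. y s i) = (\<Sum>s\<in>S. ip n x (y s))"
  unfolding ip_def sum_distrib_left by (rule sum.swap)

lemma app_diff: "app n A (\<lambda>i. x i - y i) = (\<lambda>i. app n A x i - app n A y i)"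
  by (simp add: app_def ring_distribs sum_subtractf fun_eq_iff)

lemma app_scale: "app n A (\<lambda>i. c * x i) = (\<lambda>i. c * app n A x i)"
  by (simp add: app_def sum_distrib_left mult_ac fun_eq_iff)

lemma ip_app_hermitian:
  assumes "psd n A"
  shows "ip n x (app n A y) = cnj (ip n y (app n A x))"
proof -
  have "cnj (ip n y (app n A x)) = (\<Sum>i<n. \<Sum>j<n. y i * A $$ (j, i) * cnj (x j))"
    unfolding ip_app cnj_sum by (intro sum.cong refl) (simp add: psdD(2)[OF assms, symmetric])
  also have "\<dots> = ip n x (app n A y)"
    unfolding ip_app by (subst sum.swap) (simp add: mult_ac)
  finally show ?thesis by simp
qed

lemma psd_ip_nonneg: "psd n A \<Longrightarrow> 0 \<le> Re (ip n x (app n A x))"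
  unfolding ip_app by (rule psdD(3))

lemma ip_resolution:
  assumes "orthonormal_basis n w"
  shows "ip n x y = (\<Sum>j<n. ip n x (w j) * ip n (w j) y)"
proof -
  have "(\<Sum>j<n. ip n x (w j) * ip n (w j) y) = (\<Sum>j<n. \<Sum>i<n. \<Sum>l<n. cnj (x i) * (w j i * cnj (w j l)) * y l)"
    unfolding ip_def sum_product by (simp add: mult_ac)
  also have "\<dots> = (\<Sum>i<n. \<Sum>j<n. \<Sum>l<n. cnj (x i) * (w j i * cnj (w j l)) * y l)"
    by (rule sum.swap)
  also have "\<dots> = (\<Sum>i<n. \<Sum>l<n. \<Sum>j<n. cnj (x i) * (w j i * cnj (w j l)) * y l)"
    by (intro sum.cong refl sum.swap)
  also have "\<dots> = (\<Sum>i<n. \<Sum>l<n. cnj (x i) * (\<Sum>j<n. w j i * cnj (w j l)) * y l)"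
    by (simp add: sum_distrib_left sum_distrib_right)
  also have "\<dots> = (\<Sum>i<n. \<Sum>l<n. if l = i then cnj (x i) * y i else 0)"
    using assms unfolding orthonormal_basis_def by (intro sum.cong refl) auto
  also have "\<dots> = ip n x y" by (simp add: ip_def)
  finally show ?thesis by simp
qed

lemma parseval:
  assumes "orthonormal_basis n w"
  shows "(\<Sum>j<n. (cmod (ip n (w j) x))\<^sup>2) = Re (ip n x x)"
proof -
  have "ip n x x = (\<Sum>j<n. of_real ((cmod (ip n (w j) x))\<^sup>2))"
    unfolding ip_resolution[OF assms, of x x]
    by (intro sum.cong refl) (simp only: complex_norm_square ip_commute[of n x] mult.commute)
  then show ?thesis by simp
qed

lemma trp_spectral:
  assumes "spectral n S b w"
  shows "trp n A S = (\<Sum>s<n. of_real (b s) * ip n (w s) (app n A (w s)))"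
proof -
  have "trp n A S = (\<Sum>i<n. \<Sum>j<n. \<Sum>s<n. of_real (b s) * (cnj (w s i) * A $$ (i, j) * w s j))"
    using assms unfolding trp_def spectral_def
    by (intro sum.cong refl) (simp add: sum_distrib_left mult_ac)
  also have "\<dots> = (\<Sum>i<n. \<Sum>s<n. \<Sum>j<n. of_real (b s) * (cnj (w s i) * A $$ (i, j) * w s j))"
    by (intro sum.cong refl sum.swap)
  also have "\<dots> = (\<Sum>s<n. \<Sum>i<n. \<Sum>j<n. of_real (b s) * (cnj (w s i) * A $$ (i, j) * w s j))"
    by (rule sum.swap)
  finally show ?thesis by (simp add: ip_app sum_distrib_left)
qed

lemma Re_trp_nonneg:
  assumes "psd n A" "psd n B"
  shows "0 \<le> Re (trp n A B)"
proof -
  obtain b w where s: "spectral n B b w" using spectral_exists[OF assms(2)] by blast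
  then show ?thesis unfolding trp_spectral[OF s]
    using psd_ip_nonneg[OF assms(1)] by (auto simp: spectral_def intro!: sum_nonneg)
qed

lemma Im_trp:
  assumes "psd n A" "psd n B"
  shows "Im (trp n A B) = 0"
proof -
  obtain b w where s: "spectral n B b w" using spectral_exists[OF assms(2)] by blast
  show ?thesis unfolding trp_spectral[OF s]
    using psd_quadratic_real[OF assms(1)] by (simp add: ip_app del: Im_sum) (simp add: Im_sum)
qed

text \<open>Unlike in \<open>is_measurement\<close>, the outcome set is arbitrary: reading i out of
  a particles gives d^i outcomes on a space of dimension d^a.\<close>

definition povm :: "nat \<Rightarrow> 'a set \<Rightarrow> ('a \<Rightarrow> complex mat) \<Rightarrow> bool" where
  "povm n Y M \<longleftrightarrow> finite Y \<and> (\<forall>y\<in>Y. psd n (M y)) \<and>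
     (\<forall>i<n. \<forall>j<n. (\<Sum>y\<in>Y. M y $$ (i, j)) = (if i = j then 1 else 0))"

lemma povm_sum_ip:
  assumes "povm n Y M"
  shows "(\<Sum>y\<in>Y. ip n x (app n (M y) z)) = ip n x z"
proof -
  have "(\<Sum>y\<in>Y. ip n x (app n (M y) z)) = (\<Sum>y\<in>Y. \<Sum>i<n. \<Sum>j<n. cnj (x i) * M y $$ (i, j) * z j)"
    by (simp add: ip_app)
  also have "\<dots> = (\<Sum>i<n. \<Sum>y\<in>Y. \<Sum>j<n. cnj (x i) * M y $$ (i, j) * z j)"
    by (rule sum.swap)
  also have "\<dots> = (\<Sum>i<n. \<Sum>j<n. \<Sum>y\<in>Y. cnj (x i) * M y $$ (i, j) * z j)"
    by (intro sum.cong refl sum.swap)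
  also have "\<dots> = (\<Sum>i<n. \<Sum>j<n. cnj (x i) * (\<Sum>y\<in>Y. M y $$ (i, j)) * z j)"
    by (simp add: sum_distrib_left sum_distrib_right)
  also have "\<dots> = (\<Sum>i<n. \<Sum>j<n. if j = i then cnj (x i) * z i else 0)"
    using assms unfolding povm_def by (intro sum.cong refl) auto
  also have "\<dots> = ip n x z" by (simp add: ip_def)
  finally show ?thesis .
qed

lemma povm_sum_trp:
  assumes "povm n Y M"
  shows "(\<Sum>y\<in>Y. trp n (M y) R) = (\<Sum>i<n. R $$ (i, i))"
proof -
  have "(\<Sum>y\<in>Y. trp n (M y) R) = (\<Sum>y\<in>Y. \<Sum>i<n. \<Sum>j<n. M y $$ (i, j) * R $$ (j, i))"
    by (simp add: trp_def)
  also have "\<dots> = (\<Sum>i<n. \<Sum>y\<in>Y. \<Sum>j<n. M y $$ (i, j) * R $$ (j, i))"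
    by (rule sum.swap)
  also have "\<dots> = (\<Sum>i<n. \<Sum>j<n. \<Sum>y\<in>Y. M y $$ (i, j) * R $$ (j, i))"
    by (intro sum.cong refl sum.swap)
  also have "\<dots> = (\<Sum>i<n. \<Sum>j<n. (\<Sum>y\<in>Y. M y $$ (i, j)) * R $$ (j, i))"
    by (simp add: sum_distrib_left sum_distrib_right)
  also have "\<dots> = (\<Sum>i<n. \<Sum>j<n. if j = i then R $$ (i, i) else 0)"
    using assms unfolding povm_def by (intro sum.cong refl) auto
  finally show ?thesis by simp
qed

text \<open>The operator inequality \<open>(\<Sum>y. f y M\<^sub>y)\<^sup>2 \<le> \<Sum>y. (f y)\<^sup>2 M\<^sub>y\<close>, from the positivity of
  \<open>\<Sum>y. (f y - X) M\<^sub>y (f y - X)\<close> with \<open>X = \<Sum>y. f y M\<^sub>y\<close>.\<close>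
lemma kadison:
  assumes M: "povm n Y M"
  shows "Re (ip n (\<lambda>i. \<Sum>y\<in>Y. of_real (f y) * app n (M y) x i) (\<lambda>i. \<Sum>y\<in>Y. of_real (f y) * app n (M y) x i))
      \<le> (\<Sum>y\<in>Y. (f y)\<^sup>2 * Re (ip n x (app n (M y) x)))"
proof -
  define z where "z = (\<lambda>i. \<Sum>y\<in>Y. complex_of_real (f y) * app n (M y) x i)"
  have psd: "psd n (M y)" if "y \<in> Y" for y using M that unfolding povm_def by blast
  have ex: "Re (ip n (\<lambda>i. of_real (f y) * x i - z i) (app n (M y) (\<lambda>i. of_real (f y) * x i - z i)))
      = (f y)\<^sup>2 * Re (ip n x (app n (M y) x)) - 2 * (f y * Re (ip n z (app n (M y) x))) + Re (ip n z (app n (M y) z))"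
    if "y \<in> Y" for y
  proof -
    have "Re (ip n x (app n (M y) z)) = Re (ip n z (app n (M y) x))"
      by (subst ip_app_hermitian[OF psd[OF that]]) simp
    then show ?thesis
      unfolding app_diff app_scale ip_diff_right ip_diff_left ip_scale_right ip_scale_left
      by (simp add: power2_eq_square algebra_simps)
  qed
  have s1: "(\<Sum>y\<in>Y. Re (ip n z (app n (M y) z))) = Re (ip n z z)"
    using povm_sum_ip[OF M, of z z] by (simp flip: Re_sum)
  have "ip n z z = (\<Sum>y\<in>Y. of_real (f y) * ip n z (app n (M y) x))"
    by (subst (2) z_def) (simp add: ip_sum_right ip_scale_right)
  then have s2: "(\<Sum>y\<in>Y. f y * Re (ip n z (app n (M y) x))) = Re (ip n z z)" by simp
  have "0 \<le> (\<Sum>y\<in>Y. Re (ip n (\<lambda>i. of_real (f y) * x i - z i) (app n (M y) (\<lambda>i. of_real (f y) * x i - z i))))"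
    by (intro sum_nonneg psd_ip_nonneg psd)
  also have "\<dots> = (\<Sum>y\<in>Y. (f y)\<^sup>2 * Re (ip n x (app n (M y) x))) - 2 * Re (ip n z z) + Re (ip n z z)"
    by (simp add: ex sum.distrib sum_subtractf s1 sum_distrib_left[symmetric] s2)
  finally show ?thesis unfolding z_def by simp
qed

text \<open>Expand the square (a |y| - c |x|)^2 / c. For c = 0 the quotient is 0 by convention, so
  the last hypothesis has to make the left side vanish as well.\<close>

lemma amgm_complex:
  fixes a c :: real and x y :: complex
  assumes "0 \<le> a" "0 \<le> c" "c = 0 \<Longrightarrow> a = 0"
  shows "2 * (a * Re (x * y)) \<le> a\<^sup>2 * (cmod y)\<^sup>2 / c + (cmod x)\<^sup>2 * c"
proof (cases "c = 0")
  case False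
  have "0 \<le> (a * cmod y - c * cmod x)\<^sup>2 / c" using assms by simp
  also have "\<dots> = a\<^sup>2 * (cmod y)\<^sup>2 / c + (cmod x)\<^sup>2 * c - 2 * (a * (cmod x * cmod y))"
    using False by (simp add: field_simps power2_eq_square)
  finally have "2 * (a * (cmod x * cmod y)) \<le> a\<^sup>2 * (cmod y)\<^sup>2 / c + (cmod x)\<^sup>2 * c" by simp
  moreover have "a * Re (x * y) \<le> a * (cmod x * cmod y)"
    using assms(1) complex_Re_le_cmod[of "x * y"] by (intro mult_left_mono) (auto simp: norm_mult)
  ultimately show ?thesis by linarith
qed (use assms in simp)

text \<open>Both sides are \<open>\<langle>1, (\<Delta> + s)\<^bsup>-1\<^esup> 1\<rangle>\<close>, for the relative modular operator \<open>\<Delta>\<close> of the measured and of the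
  original pair. The proof tests the right one with \<open>X = \<Sum>y. f y M\<^sub>y\<close>, where \<open>f = p / (q + s p)\<close> is
  the optimal test function on the left.\<close>
lemma measured_resolvent_le:
  assumes R: "spectral n R a u" and S: "spectral n S b w" and M: "povm n Y M" and s: "0 < (s::real)"
    and p: "\<And>y. y \<in> Y \<Longrightarrow> p y = Re (trp n (M y) R)" and q: "\<And>y. y \<in> Y \<Longrightarrow> q y = Re (trp n (M y) S)"
  shows "(\<Sum>y\<in>Y. (p y)\<^sup>2 / (q y + s * p y)) \<le> (\<Sum>i<n. \<Sum>j<n. (a i)\<^sup>2 * (cmod (ip n (w j) (u i)))\<^sup>2 / (b j + s * a i))"
proof -
  have psd: "psd n (M y)" if "y \<in> Y" for y using M that unfolding povm_def by blast
  have a: "0 \<le> a i" and b: "0 \<le> b i" if "i < n" for i using R S that unfolding spectral_def by auto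
  have ou: "orthonormal_basis n u" and ow: "orthonormal_basis n w" using R S unfolding spectral_def by auto
  have p': "p y = (\<Sum>i<n. a i * Re (ip n (u i) (app n (M y) (u i))))" if "y \<in> Y" for y
    using that by (simp add: p trp_spectral[OF R])
  have q': "q y = (\<Sum>j<n. b j * Re (ip n (w j) (app n (M y) (w j))))" if "y \<in> Y" for y
    using that by (simp add: q trp_spectral[OF S])
  have p0: "0 \<le> p y" and q0: "0 \<le> q y" if "y \<in> Y" for y
    using that psd_ip_nonneg[OF psd[OF that]] a b by (auto simp: p' q' intro!: sum_nonneg)
  define f where "f y = p y / (q y + s * p y)" for y
  define X where "X x = (\<lambda>i. \<Sum>y\<in>Y. complex_of_real (f y) * app n (M y) x i)" for x
  have ipX: "ip n z (X x) = (\<Sum>y\<in>Y. of_real (f y) * ip n z (app n (M y) x))" for x z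
    by (simp add: X_def ip_sum_right ip_scale_right)
  have Xh: "ip n z (X x) = cnj (ip n x (X z))" for x z
    unfolding ipX cnj_sum by (intro sum.cong refl) (simp add: ip_app_hermitian[OF psd, of _ z x])
  have kad: "Re (ip n (X x) (X x)) \<le> (\<Sum>y\<in>Y. (f y)\<^sup>2 * Re (ip n x (app n (M y) x)))" for x
    unfolding X_def by (rule kadison[OF M])
  have 1: "(\<Sum>y\<in>Y. f y * p y) = (\<Sum>i<n. \<Sum>j<n. a i * Re (ip n (X (u i)) (w j) * ip n (w j) (u i)))"
  proof -
    have "(\<Sum>y\<in>Y. f y * p y) = (\<Sum>y\<in>Y. \<Sum>i<n. a i * (f y * Re (ip n (u i) (app n (M y) (u i)))))"
      by (simp add: p' sum_distrib_left mult_ac)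
    also have "\<dots> = (\<Sum>i<n. \<Sum>y\<in>Y. a i * (f y * Re (ip n (u i) (app n (M y) (u i)))))" by (rule sum.swap)
    also have "\<dots> = (\<Sum>i<n. a i * Re (ip n (u i) (X (u i))))" by (simp add: ipX sum_distrib_left)
    also have "\<dots> = (\<Sum>i<n. a i * Re (ip n (X (u i)) (u i)))"
      by (subst ip_commute) simp
    also have "\<dots> = (\<Sum>i<n. a i * Re (\<Sum>j<n. ip n (X (u i)) (w j) * ip n (w j) (u i)))"
      by (simp only: ip_resolution[OF ow, of "X (u _)" "u _"])
    finally show ?thesis by (simp only: Re_sum sum_distrib_left)
  qed
  have c: "(cmod (ip n (X (u i)) (w j)))\<^sup>2 = (cmod (ip n (u i) (X (w j))))\<^sup>2" for i j
    by (subst ip_commute) (simp add: Xh[of "w j" "u i"])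
  \<comment> \<open>X is Hermitian and can be moved onto \<open>w j\<close>. Parseval in the basis u
    then leaves the squared norm of \<open>X (w j)\<close>, which \<open>kadison\<close> bounds by a
    second moment of f. The next estimate is the same with Parseval in w and no move.\<close>
  have 2: "(\<Sum>i<n. \<Sum>j<n. (cmod (ip n (X (u i)) (w j)))\<^sup>2 * b j) \<le> (\<Sum>y\<in>Y. (f y)\<^sup>2 * q y)"
  proof -
    have "(\<Sum>i<n. \<Sum>j<n. (cmod (ip n (X (u i)) (w j)))\<^sup>2 * b j) = (\<Sum>j<n. b j * (\<Sum>i<n. (cmod (ip n (u i) (X (w j))))\<^sup>2))"
      by (subst sum.swap) (simp add: c sum_distrib_left mult.commute)
    also have "\<dots> = (\<Sum>j<n. b j * Re (ip n (X (w j)) (X (w j))))" by (simp only: parseval[OF ou])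
    also have "\<dots> \<le> (\<Sum>j<n. b j * (\<Sum>y\<in>Y. (f y)\<^sup>2 * Re (ip n (w j) (app n (M y) (w j)))))"
      by (intro sum_mono mult_left_mono kad b) auto
    also have "\<dots> = (\<Sum>j<n. \<Sum>y\<in>Y. (f y)\<^sup>2 * (b j * Re (ip n (w j) (app n (M y) (w j)))))"
      by (simp add: sum_distrib_left mult_ac)
    also have "\<dots> = (\<Sum>y\<in>Y. \<Sum>j<n. (f y)\<^sup>2 * (b j * Re (ip n (w j) (app n (M y) (w j)))))" by (rule sum.swap)
    also have "\<dots> = (\<Sum>y\<in>Y. (f y)\<^sup>2 * q y)" by (simp add: q' sum_distrib_left)
    finally show ?thesis .
  qed
  have 3: "(\<Sum>i<n. \<Sum>j<n. (cmod (ip n (X (u i)) (w j)))\<^sup>2 * a i) \<le> (\<Sum>y\<in>Y. (f y)\<^sup>2 * p y)"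
  proof -
    have "(\<Sum>i<n. \<Sum>j<n. (cmod (ip n (X (u i)) (w j)))\<^sup>2 * a i) = (\<Sum>i<n. a i * (\<Sum>j<n. (cmod (ip n (w j) (X (u i))))\<^sup>2))"
      by (subst ip_commute) (simp add: sum_distrib_left mult.commute)
    also have "\<dots> = (\<Sum>i<n. a i * Re (ip n (X (u i)) (X (u i))))" by (simp only: parseval[OF ow])
    also have "\<dots> \<le> (\<Sum>i<n. a i * (\<Sum>y\<in>Y. (f y)\<^sup>2 * Re (ip n (u i) (app n (M y) (u i)))))"
      by (intro sum_mono mult_left_mono kad a) auto
    also have "\<dots> = (\<Sum>i<n. \<Sum>y\<in>Y. (f y)\<^sup>2 * (a i * Re (ip n (u i) (app n (M y) (u i)))))"
      by (simp add: sum_distrib_left mult_ac)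
    also have "\<dots> = (\<Sum>y\<in>Y. \<Sum>i<n. (f y)\<^sup>2 * (a i * Re (ip n (u i) (app n (M y) (u i)))))" by (rule sum.swap)
    also have "\<dots> = (\<Sum>y\<in>Y. (f y)\<^sup>2 * p y)" by (simp add: p' sum_distrib_left)
    finally show ?thesis .
  qed
  have "2 * (\<Sum>y\<in>Y. f y * p y) = (\<Sum>i<n. \<Sum>j<n. 2 * (a i * Re (ip n (X (u i)) (w j) * ip n (w j) (u i))))"
    by (simp only: 1 sum_distrib_left)
  also have "\<dots> \<le> (\<Sum>i<n. \<Sum>j<n. (a i)\<^sup>2 * (cmod (ip n (w j) (u i)))\<^sup>2 / (b j + s * a i)
      + (cmod (ip n (X (u i)) (w j)))\<^sup>2 * (b j + s * a i))"
  proof (intro sum_mono amgm_complex)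
    fix i j assume "i \<in> {..<n}" "j \<in> {..<n}"
    then have "0 \<le> a i" "0 \<le> b j" using a b by auto
    then show "0 \<le> a i" "0 \<le> b j + s * a i" "b j + s * a i = 0 \<Longrightarrow> a i = 0"
      using s by (auto simp: add_nonneg_eq_0_iff)
  qed
  also have "\<dots> = (\<Sum>i<n. \<Sum>j<n. (a i)\<^sup>2 * (cmod (ip n (w j) (u i)))\<^sup>2 / (b j + s * a i))
      + (\<Sum>i<n. \<Sum>j<n. (cmod (ip n (X (u i)) (w j)))\<^sup>2 * b j) + s * (\<Sum>i<n. \<Sum>j<n. (cmod (ip n (X (u i)) (w j)))\<^sup>2 * a i)"
    by (simp add: sum.distrib sum_distrib_left ring_distribs mult_ac)
  also have "\<dots> \<le> (\<Sum>i<n. \<Sum>j<n. (a i)\<^sup>2 * (cmod (ip n (w j) (u i)))\<^sup>2 / (b j + s * a i))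
      + (\<Sum>y\<in>Y. (f y)\<^sup>2 * q y) + s * (\<Sum>y\<in>Y. (f y)\<^sup>2 * p y)"
    using s by (intro add_mono order_refl 2 3 mult_left_mono) auto
  also have "\<dots> = (\<Sum>i<n. \<Sum>j<n. (a i)\<^sup>2 * (cmod (ip n (w j) (u i)))\<^sup>2 / (b j + s * a i))
      + (\<Sum>y\<in>Y. (f y)\<^sup>2 * (q y + s * p y))"
    by (simp add: sum.distrib sum_distrib_left ring_distribs mult_ac)
  finally have "(\<Sum>y\<in>Y. 2 * (f y * p y) - (f y)\<^sup>2 * (q y + s * p y)) \<le>
      (\<Sum>i<n. \<Sum>j<n. (a i)\<^sup>2 * (cmod (ip n (w j) (u i)))\<^sup>2 / (b j + s * a i))"
    by (simp add: sum_subtractf sum_distrib_left)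
  \<comment> \<open>The maximum of the parabola 2 f x - f^2 c in f, attained at f = x / c; for c = 0
    both sides are 0 by the convention for division.\<close>
  moreover have "2 * (x / c * x) - (x / c)\<^sup>2 * c = x\<^sup>2 / c" for x c :: real
    by (cases "c = 0") (simp_all add: field_simps power2_eq_square)
  then have "2 * (f y * p y) - (f y)\<^sup>2 * (q y + s * p y) = (p y)\<^sup>2 / (q y + s * p y)" for y
    unfolding f_def .
  ultimately show ?thesis by simp
qed

text \<open>The right side is tr R (log R - log S) written with the two eigenbases.
  \<open>ln_sum_le_of_resolvent_le\<close> is applied to the ratios b_j / a_i with weights a_i
  |<w_j, u_i>|^2 and to the ratios q / p with weights p; both weights add up to tr R. The support
  conditions make the ratios positive once terms of weight zero are dropped.\<close>

lemma measured_relative_entropy_le: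
  assumes R: "spectral n R a u" and S: "spectral n S b w" and M: "povm n Y M"
    and p: "\<And>y. y \<in> Y \<Longrightarrow> p y = Re (trp n (M y) R)" and q: "\<And>y. y \<in> Y \<Longrightarrow> q y = Re (trp n (M y) S)"
    and dom: "\<And>i j. i < n \<Longrightarrow> j < n \<Longrightarrow> b j = 0 \<Longrightarrow> a i * (cmod (ip n (w j) (u i)))\<^sup>2 = 0"
    and dom': "\<And>y. y \<in> Y \<Longrightarrow> q y = 0 \<Longrightarrow> p y = 0"
  shows "(\<Sum>y\<in>Y. p y * ln (p y / q y)) \<le> (\<Sum>i<n. \<Sum>j<n. a i * (cmod (ip n (w j) (u i)))\<^sup>2 * (ln (a i) - ln (b j)))"
proof -
  have psd: "psd n (M y)" if "y \<in> Y" for y using M that unfolding povm_def by blast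
  have finY: "finite Y" using M unfolding povm_def by blast
  have a: "0 \<le> a i" and b: "0 \<le> b i" if "i < n" for i using R S that unfolding spectral_def by auto
  have ou: "orthonormal_basis n u" and ow: "orthonormal_basis n w" using R S unfolding spectral_def by auto
  have p': "p y = (\<Sum>i<n. a i * Re (ip n (u i) (app n (M y) (u i))))" if "y \<in> Y" for y
    using that by (simp add: p trp_spectral[OF R])
  have q': "q y = (\<Sum>j<n. b j * Re (ip n (w j) (app n (M y) (w j))))" if "y \<in> Y" for y
    using that by (simp add: q trp_spectral[OF S])
  have p0: "0 \<le> p y" and q0: "0 \<le> q y" if "y \<in> Y" for y
    using that psd_ip_nonneg[OF psd[OF that]] a b by (auto simp: p' q' intro!: sum_nonneg)
  have uu: "Re (ip n (u i) (u i)) = 1" if "i < n" for i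
    using ou that unfolding orthonormal_basis_def ip_def by (simp add: mult.commute del: Re_sum)
  define c where "c = (\<lambda>(i, j). a i * (cmod (ip n (w j) (u i)))\<^sup>2)"
  define r where "r = (\<lambda>(i, j). b j / a i)"
  define I where "I = {k \<in> {..<n} \<times> {..<n}. c k \<noteq> 0}"
  define J where "J = {y \<in> Y. p y \<noteq> 0}"
  have fin: "finite ({..<n} \<times> {..<n})" by simp
  have r0: "0 < r k" if "k \<in> I" for k
  proof -
    obtain i j where k: "k = (i, j)" "i < n" "j < n" using \<open>k \<in> I\<close> by (auto simp: I_def)
    then have "a i \<noteq> 0" "b j \<noteq> 0" using \<open>k \<in> I\<close> dom by (auto simp: I_def c_def)
    then show ?thesis using a[OF k(2)] b[OF k(3)] by (simp add: r_def k)
  qed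
  have t0: "0 < q y / p y" if "y \<in> J" for y
    using that p0[of y] q0[of y] dom'[of y] unfolding J_def by (auto simp: less_le)
  have sumI: "(\<Sum>k\<in>I. c k * g k) = (\<Sum>i<n. \<Sum>j<n. c (i, j) * g (i, j))" for g
  proof -
    have "(\<Sum>k\<in>I. c k * g k) = (\<Sum>k\<in>{..<n}\<times>{..<n}. c k * g k)"
      unfolding I_def by (intro sum.mono_neutral_left fin) auto
    then show ?thesis by (simp add: sum.cartesian_product case_prod_unfold)
  qed
  have sumJ: "(\<Sum>y\<in>J. p y * g y) = (\<Sum>y\<in>Y. p y * g y)" for g
    unfolding J_def by (intro sum.mono_neutral_left finY) auto
  have massI: "sum c I = (\<Sum>i<n. a i)"
  proof -
    have "sum c I = (\<Sum>i<n. a i * (\<Sum>j<n. (cmod (ip n (w j) (u i)))\<^sup>2))"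
      using sumI[of "\<lambda>_. 1"] by (simp add: c_def sum_distrib_left)
    then show ?thesis by (simp add: parseval[OF ow] uu)
  qed
  have massJ: "sum p J = (\<Sum>i<n. a i)"
  proof -
    have "sum p J = (\<Sum>y\<in>Y. \<Sum>i<n. a i * Re (ip n (u i) (app n (M y) (u i))))"
      using sumJ[of "\<lambda>_. 1"] by (simp add: p')
    also have "\<dots> = (\<Sum>i<n. a i * Re (\<Sum>y\<in>Y. ip n (u i) (app n (M y) (u i))))"
      by (subst sum.swap) (simp add: sum_distrib_left)
    also have "\<dots> = (\<Sum>i<n. a i)" by (simp add: povm_sum_ip[OF M] uu del: Re_sum)
    finally show ?thesis .
  qed
  have "(\<Sum>k\<in>I. c k * ln (r k)) \<le> (\<Sum>y\<in>J. p y * ln (q y / p y))"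
  proof (rule ln_sum_le_of_resolvent_le)
    fix s :: real assume s: "0 < s"
    have "(\<Sum>y\<in>J. p y / (q y / p y + s)) = (\<Sum>y\<in>Y. p y * (1 / (q y / p y + s)))"
      using sumJ[of "\<lambda>y. 1 / (q y / p y + s)"] by simp
    also have "\<dots> = (\<Sum>y\<in>Y. (p y)\<^sup>2 / (q y + s * p y))"
    proof (intro sum.cong refl)
      fix y
      show "p y * (1 / (q y / p y + s)) = (p y)\<^sup>2 / (q y + s * p y)"
      proof (cases "p y = 0")
        case False
        then have "q y / p y + s = (q y + s * p y) / p y" by (simp add: field_simps)
        then show ?thesis by (simp add: power2_eq_square)
      qed simp
    qed
    also have "\<dots> \<le> (\<Sum>i<n. \<Sum>j<n. (a i)\<^sup>2 * (cmod (ip n (w j) (u i)))\<^sup>2 / (b j + s * a i))"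
      by (rule measured_resolvent_le[OF R S M s p q])
    also have "\<dots> = (\<Sum>i<n. \<Sum>j<n. c (i, j) * (1 / (r (i, j) + s)))"
    proof (intro sum.cong refl)
      fix i j
      show "(a i)\<^sup>2 * (cmod (ip n (w j) (u i)))\<^sup>2 / (b j + s * a i) = c (i, j) * (1 / (r (i, j) + s))"
      proof (cases "a i = 0")
        case False
        then have "b j / a i + s = (b j + s * a i) / a i" by (simp add: field_simps)
        then show ?thesis by (simp add: c_def r_def power2_eq_square)
      qed (simp add: c_def)
    qed
    also have "\<dots> = (\<Sum>k\<in>I. c k / (r k + s))" using sumI[of "\<lambda>k. 1 / (r k + s)"] by simp
    finally show "(\<Sum>y\<in>J. p y / (q y / p y + s)) \<le> (\<Sum>k\<in>I. c k / (r k + s))" .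
  qed (use r0 t0 massI massJ in auto)
  also have "(\<Sum>y\<in>J. p y * ln (q y / p y)) = - (\<Sum>y\<in>Y. p y * ln (p y / q y))"
    unfolding sumJ sum_negf[symmetric]
  proof (intro sum.cong refl)
    fix y assume "y \<in> Y"
    then show "p y * ln (q y / p y) = - (p y * ln (p y / q y))"
      using p0[of y] q0[of y] dom'[of y] by (cases "p y = 0") (auto simp: ln_div less_le algebra_simps)
  qed
  finally have "(\<Sum>y\<in>Y. p y * ln (p y / q y)) \<le> (\<Sum>k\<in>I. c k * - ln (r k))" by (simp add: sum_negf)
  also have "\<dots> = (\<Sum>i<n. \<Sum>j<n. a i * (cmod (ip n (w j) (u i)))\<^sup>2 * (ln (a i) - ln (b j)))"
    unfolding sumI
  proof (intro sum.cong refl)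
    fix i j assume ij: "i \<in> {..<n}" "j \<in> {..<n}"
    show "c (i, j) * - ln (r (i, j)) = a i * (cmod (ip n (w j) (u i)))\<^sup>2 * (ln (a i) - ln (b j))"
    proof (cases "c (i, j) = 0")
      case False
      then have "0 < a i" "0 < b j" using ij a[of i] b[of j] dom[of i j] by (auto simp: c_def less_le)
      then show ?thesis by (simp add: c_def r_def ln_div)
    qed (auto simp: c_def)
  qed
  finally show ?thesis .
qed

section \<open>Entropy of unnormalised states and Holevo's bound\<close>

definition spec_vals :: "nat \<Rightarrow> complex mat \<Rightarrow> nat \<Rightarrow> real" where
  "spec_vals n A = fst (SOME p. spectral n A (fst p) (snd p))"

text \<open>Projects the same chosen pair as \<open>spec_vals\<close>, so values and vectors belong
  to one decomposition.\<close>

definition spec_vecs :: "nat \<Rightarrow> complex mat \<Rightarrow> nat \<Rightarrow> nat \<Rightarrow> complex" where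
  "spec_vecs n A = snd (SOME p. spectral n A (fst p) (snd p))"

lemma spectral_spec:
  assumes "psd n A"
  shows "spectral n A (spec_vals n A) (spec_vecs n A)"
proof -
  from spectral_exists[OF assms] have "\<exists>p. spectral n A (fst p) (snd p)" by auto
  from someI_ex[OF this] show ?thesis unfolding spec_vals_def spec_vecs_def .
qed

text \<open>Entropies of unnormalised states are extended homogeneously: \<open>ent n (t \<rho>) = t ent n \<rho>\<close>.\<close>
definition tlog :: "real \<Rightarrow> real" where
  "tlog t = t * ln t"

definition neg_ent :: "nat \<Rightarrow> complex mat \<Rightarrow> real" where
  "neg_ent n A = (\<Sum>i<n. tlog (spec_vals n A i))"

definition rtrace :: "nat \<Rightarrow> complex mat \<Rightarrow> real" where
  "rtrace n A = Re (\<Sum>i<n. A $$ (i, i))"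

definition ent :: "nat \<Rightarrow> complex mat \<Rightarrow> real" where
  "ent n A = tlog (rtrace n A) - neg_ent n A"

lemma spectral_trace:
  assumes "spectral n A a v"
  shows "rtrace n A = (\<Sum>i<n. a i)"
proof -
  have "(\<Sum>i<n. A $$ (i, i)) = (\<Sum>i<n. \<Sum>s<n. of_real (a s) * (v s i * cnj (v s i)))"
    using assms unfolding spectral_def by simp
  also have "\<dots> = (\<Sum>s<n. of_real (a s) * (\<Sum>i<n. v s i * cnj (v s i)))"
    by (subst sum.swap) (simp add: sum_distrib_left)
  also have "\<dots> = (\<Sum>s<n. of_real (a s))"
    using assms unfolding spectral_def orthonormal_basis_def by simp
  finally show ?thesis by (simp add: rtrace_def)
qed

lemma rtrace_nonneg: "psd n A \<Longrightarrow> 0 \<le> rtrace n A"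
  using spectral_trace[OF spectral_spec] spectral_spec[of n A]
  by (auto simp: spectral_def intro!: sum_nonneg)

text \<open>Entropy of weights with total T lies between 0 and T log (number of weights). The lower
  bound uses that no weight exceeds T; the upper one is Gibbs' inequality against the uniform
  weights T / card I, from ln x \<le> x - 1.\<close>

lemma tlog_sum_bounds:
  assumes "finite I" "\<And>i. i \<in> I \<Longrightarrow> 0 \<le> a i"
  shows "(\<Sum>i\<in>I. tlog (a i)) \<le> tlog (\<Sum>i\<in>I. a i)"
    and "tlog (\<Sum>i\<in>I. a i) - (\<Sum>i\<in>I. tlog (a i)) \<le> (\<Sum>i\<in>I. a i) * ln (real (card I))"
proof -
  define T where "T = (\<Sum>i\<in>I. a i)"
  have aT: "a i \<le> T" if "i \<in> I" for i unfolding T_def using assms that by (intro member_le_sum) auto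
  have "(\<Sum>i\<in>I. tlog (a i)) \<le> (\<Sum>i\<in>I. a i * ln T)"
  proof (intro sum_mono)
    fix i assume i: "i \<in> I"
    show "tlog (a i) \<le> a i * ln T"
    proof (cases "a i = 0")
      case False
      then have "0 < a i" using assms(2)[OF i] by simp
      then have "ln (a i) \<le> ln T" using aT[OF i] by simp
      then show ?thesis unfolding tlog_def using assms(2)[OF i] by (intro mult_left_mono)
    qed (simp add: tlog_def)
  qed
  then show "(\<Sum>i\<in>I. tlog (a i)) \<le> tlog (\<Sum>i\<in>I. a i)"
    by (simp add: tlog_def T_def sum_distrib_right)
  show "tlog (\<Sum>i\<in>I. a i) - (\<Sum>i\<in>I. tlog (a i)) \<le> (\<Sum>i\<in>I. a i) * ln (real (card I))"
  proof (cases "T = 0")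
    case True
    then have "a i = 0" if "i \<in> I" for i using aT[OF that] assms(2)[OF that] by simp
    then show ?thesis by (simp add: tlog_def)
  next
    case False
    then have T: "0 < T" unfolding T_def using sum_nonneg[of I a] assms(2) by (simp add: less_le)
    then have cI: "0 < card I" using assms(1) by (auto simp: T_def card_gt_0_iff)
    have "a i * (ln T - ln (card I)) - tlog (a i) \<le> T / card I - a i" if i: "i \<in> I" for i
    proof (cases "a i = 0")
      case True
      then show ?thesis using T by (simp add: tlog_def)
    next
      case False
      then have ai: "0 < a i" using assms(2)[OF i] by simp
      have "a i * (ln T - ln (card I)) - tlog (a i) = a i * ln (T / card I / a i)"
        using T cI ai by (simp add: tlog_def ln_div ln_mult algebra_simps)
      also have "\<dots> \<le> a i * (T / card I / a i - 1)"
        using T cI ai by (intro mult_left_mono ln_le_minus_one) auto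
      also have "\<dots> = T / card I - a i" using ai by (simp add: field_simps)
      finally show ?thesis .
    qed
    then have "(\<Sum>i\<in>I. a i * (ln T - ln (card I)) - tlog (a i)) \<le> (\<Sum>i\<in>I. T / card I - a i)"
      by (rule sum_mono)
    also have "\<dots> = 0" using cI by (simp add: sum_subtractf T_def)
    finally have "T * (ln T - ln (card I)) - (\<Sum>i\<in>I. tlog (a i)) \<le> 0"
      by (simp only: sum_subtractf sum_distrib_right[symmetric] T_def)
    then show ?thesis by (simp add: T_def[symmetric] tlog_def right_diff_distrib)
  qed
qed

lemma ent_bounds:
  assumes "psd n A"
  shows "0 \<le> ent n A" "ent n A \<le> rtrace n A * ln (real n)"
proof -
  have nn: "0 \<le> spec_vals n A i" if "i \<in> {..<n}" for i
    using spectral_spec[OF assms] that by (auto simp: spectral_def)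
  show "0 \<le> ent n A" "ent n A \<le> rtrace n A * ln (real n)"
    using tlog_sum_bounds[of "{..<n}" "spec_vals n A", OF _ nn]
    by (auto simp: ent_def neg_ent_def spectral_trace[OF spectral_spec[OF assms]])
qed

lemma spectral_expectation:
  assumes "spectral n A a u"
  shows "Re (ip n x (app n A x)) = (\<Sum>i<n. a i * (cmod (ip n x (u i)))\<^sup>2)"
proof -
  have "ip n x (app n A x) = (\<Sum>i<n. \<Sum>j<n. \<Sum>s<n. of_real (a s) * (cnj (x i) * u s i * cnj (cnj (x j) * u s j)))"
    using assms unfolding ip_app spectral_def
    by (intro sum.cong refl) (simp add: sum_distrib_left sum_distrib_right mult_ac)
  also have "\<dots> = (\<Sum>i<n. \<Sum>s<n. \<Sum>j<n. of_real (a s) * (cnj (x i) * u s i * cnj (cnj (x j) * u s j)))"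
    by (intro sum.cong refl sum.swap)
  also have "\<dots> = (\<Sum>s<n. \<Sum>i<n. \<Sum>j<n. of_real (a s) * (cnj (x i) * u s i * cnj (cnj (x j) * u s j)))"
    by (rule sum.swap)
  also have "\<dots> = (\<Sum>s<n. of_real (a s) * (ip n x (u s) * cnj (ip n x (u s))))"
    unfolding ip_def cnj_sum sum_product by (simp add: sum_distrib_left mult_ac)
  also have "\<dots> = (\<Sum>s<n. of_real (a s * (cmod (ip n x (u s)))\<^sup>2))"
    by (simp only: complex_norm_square of_real_mult)
  finally show ?thesis by simp
qed

lemma sum_mat_ip:
  assumes S: "\<And>i j. i < n \<Longrightarrow> j < n \<Longrightarrow> S $$ (i, j) = (\<Sum>x\<in>X. R x $$ (i, j))"
  shows "ip n y (app n S z) = (\<Sum>x\<in>X. ip n y (app n (R x) z))"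
proof -
  have "ip n y (app n S z) = (\<Sum>i<n. \<Sum>j<n. \<Sum>x\<in>X. cnj (y i) * R x $$ (i, j) * z j)"
    unfolding ip_app by (intro sum.cong refl) (simp add: S sum_distrib_left sum_distrib_right)
  also have "\<dots> = (\<Sum>i<n. \<Sum>x\<in>X. \<Sum>j<n. cnj (y i) * R x $$ (i, j) * z j)"
    by (intro sum.cong refl sum.swap)
  also have "\<dots> = (\<Sum>x\<in>X. \<Sum>i<n. \<Sum>j<n. cnj (y i) * R x $$ (i, j) * z j)"
    by (rule sum.swap)
  finally show ?thesis by (simp add: ip_app)
qed

lemma trp_sum_right:
  assumes S: "\<And>i j. i < n \<Longrightarrow> j < n \<Longrightarrow> S $$ (i, j) = (\<Sum>x\<in>X. R x $$ (i, j))"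
  shows "trp n A S = (\<Sum>x\<in>X. trp n A (R x))"
proof -
  have "trp n A S = (\<Sum>i<n. \<Sum>j<n. \<Sum>x\<in>X. A $$ (i, j) * R x $$ (j, i))"
    unfolding trp_def by (intro sum.cong refl) (simp add: S sum_distrib_left)
  also have "\<dots> = (\<Sum>i<n. \<Sum>x\<in>X. \<Sum>j<n. A $$ (i, j) * R x $$ (j, i))"
    by (intro sum.cong refl sum.swap)
  also have "\<dots> = (\<Sum>x\<in>X. \<Sum>i<n. \<Sum>j<n. A $$ (i, j) * R x $$ (j, i))"
    by (rule sum.swap)
  finally show ?thesis by (simp add: trp_def)
qed

text \<open>Monotonicity is applied to each pair (R_x, S) and summed over x. The cross terms tr R_x
  log S add up to tr S log S because the R_x add up to S.\<close>

lemma holevo_bound: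
  assumes X: "finite X" and R: "\<And>x. x \<in> X \<Longrightarrow> psd n (R x)" and Sp: "psd n S"
    and S: "\<And>i j. i < n \<Longrightarrow> j < n \<Longrightarrow> S $$ (i, j) = (\<Sum>x\<in>X. R x $$ (i, j))"
    and M: "povm n Y M"
    and p: "\<And>x y. x \<in> X \<Longrightarrow> y \<in> Y \<Longrightarrow> p x y = Re (trp n (M y) (R x))"
  shows "(\<Sum>x\<in>X. \<Sum>y\<in>Y. p x y * ln (p x y / (\<Sum>x'\<in>X. p x' y))) \<le> (\<Sum>x\<in>X. neg_ent n (R x)) - neg_ent n S"
proof -
  define a where "a x = spec_vals n (R x)" for x
  define u where "u x = spec_vecs n (R x)" for x
  define b where "b = spec_vals n S"
  define w where "w = spec_vecs n S"
  have sR: "spectral n (R x) (a x) (u x)" if "x \<in> X" for x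
    unfolding a_def u_def by (rule spectral_spec[OF R[OF that]])
  have sS: "spectral n S b w" unfolding b_def w_def by (rule spectral_spec[OF Sp])
  have a: "0 \<le> a x i" if "x \<in> X" "i < n" for x i using sR[OF that(1)] that(2) unfolding spectral_def by auto
  have ou: "orthonormal_basis n (u x)" if "x \<in> X" for x using sR[OF that] unfolding spectral_def by auto
  have ow: "orthonormal_basis n w" using sS unfolding spectral_def by auto
  \<comment> \<open>The diagonal of S in its own eigenbasis, expanded in the eigenbases of the R_x.
    It serves twice: b_j = 0 annihilates all these nonnegative terms, which is the support
    condition, and it collects the cross terms into \<open>neg_ent n S\<close>.\<close>
  have bw: "b j = (\<Sum>x\<in>X. \<Sum>i<n. a x i * (cmod (ip n (w j) (u x i)))\<^sup>2)" if j: "j < n" for j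
  proof -
    have "(\<Sum>i<n. b i * (cmod (ip n (w j) (w i)))\<^sup>2) = (\<Sum>i<n. if i = j then b i else 0)"
      using ow j unfolding orthonormal_basis_def ip_def
      by (intro sum.cong refl) (auto simp: mult.commute)
    then have "b j = Re (ip n (w j) (app n S (w j)))"
      using j by (simp add: spectral_expectation[OF sS])
    also have "\<dots> = (\<Sum>x\<in>X. Re (ip n (w j) (app n (R x) (w j))))"
      by (subst sum_mat_ip[where R = R and X = X]) (auto simp: S)
    also have "\<dots> = (\<Sum>x\<in>X. \<Sum>i<n. a x i * (cmod (ip n (w j) (u x i)))\<^sup>2)"
      by (intro sum.cong refl spectral_expectation sR)
    finally show ?thesis .
  qed
  have q: "(\<Sum>x'\<in>X. p x' y) = Re (trp n (M y) S)" if "y \<in> Y" for y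
    using trp_sum_right[of n S R X "M y"] S p that by simp
  have pnn: "0 \<le> p x y" if "x \<in> X" "y \<in> Y" for x y
    using M that unfolding p[OF that] povm_def by (intro Re_trp_nonneg R) auto
  have D: "(\<Sum>y\<in>Y. p x y * ln (p x y / (\<Sum>x'\<in>X. p x' y))) \<le>
      neg_ent n (R x) - (\<Sum>j<n. ln (b j) * (\<Sum>i<n. a x i * (cmod (ip n (w j) (u x i)))\<^sup>2))" if x: "x \<in> X" for x
  proof -
    have "(\<Sum>y\<in>Y. p x y * ln (p x y / (\<Sum>x'\<in>X. p x' y))) \<le>
       (\<Sum>i<n. \<Sum>j<n. a x i * (cmod (ip n (w j) (u x i)))\<^sup>2 * (ln (a x i) - ln (b j)))"
    proof (rule measured_relative_entropy_le[OF sR[OF x] sS M p[OF x] q])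
      fix i j assume ij: "i < n" "j < n" "b j = 0"
      have "(\<Sum>i<n. a x i * (cmod (ip n (w j) (u x i)))\<^sup>2) = 0"
        by (rule sum_nonneg_0[OF X _ _ x, where f = "\<lambda>x. \<Sum>i<n. a x i * (cmod (ip n (w j) (u x i)))\<^sup>2"])
          (use bw[OF ij(2)] ij(3) a in \<open>auto intro!: sum_nonneg\<close>)
      then show "a x i * (cmod (ip n (w j) (u x i)))\<^sup>2 = 0"
        using ij a[OF x] by (subst (asm) sum_nonneg_eq_0_iff) auto
    next
      fix y assume "y \<in> Y" "(\<Sum>x'\<in>X. p x' y) = 0"
      then show "p x y = 0" using pnn x X by (subst (asm) sum_nonneg_eq_0_iff) auto
    qed
    also have "\<dots> = (\<Sum>i<n. tlog (a x i) * (\<Sum>j<n. (cmod (ip n (w j) (u x i)))\<^sup>2)) -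
        (\<Sum>i<n. \<Sum>j<n. ln (b j) * (a x i * (cmod (ip n (w j) (u x i)))\<^sup>2))"
      by (simp add: tlog_def ring_distribs sum_subtractf sum_distrib_left mult_ac)
    also have "(\<Sum>i<n. tlog (a x i) * (\<Sum>j<n. (cmod (ip n (w j) (u x i)))\<^sup>2)) = neg_ent n (R x)"
    proof -
      have "Re (ip n (u x i) (u x i)) = 1" if "i < n" for i
        using ou[OF x] that unfolding orthonormal_basis_def ip_def by (simp add: mult.commute del: Re_sum)
      then show ?thesis by (simp add: parseval[OF ow] neg_ent_def a_def)
    qed
    also have "(\<Sum>i<n. \<Sum>j<n. ln (b j) * (a x i * (cmod (ip n (w j) (u x i)))\<^sup>2)) =
        (\<Sum>j<n. ln (b j) * (\<Sum>i<n. a x i * (cmod (ip n (w j) (u x i)))\<^sup>2))"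
      by (subst sum.swap) (simp add: sum_distrib_left)
    finally show ?thesis .
  qed
  have "(\<Sum>x\<in>X. \<Sum>y\<in>Y. p x y * ln (p x y / (\<Sum>x'\<in>X. p x' y))) \<le>
    (\<Sum>x\<in>X. neg_ent n (R x) - (\<Sum>j<n. ln (b j) * (\<Sum>i<n. a x i * (cmod (ip n (w j) (u x i)))\<^sup>2)))"
    by (intro sum_mono D)
  also have "\<dots> = (\<Sum>x\<in>X. neg_ent n (R x)) - (\<Sum>j<n. ln (b j) * (\<Sum>x\<in>X. \<Sum>i<n. a x i * (cmod (ip n (w j) (u x i)))\<^sup>2))"
    unfolding sum_subtractf by (subst sum.swap) (simp add: sum_distrib_left)
  also have "(\<Sum>j<n. ln (b j) * (\<Sum>x\<in>X. \<Sum>i<n. a x i * (cmod (ip n (w j) (u x i)))\<^sup>2)) = neg_ent n S"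
    using bw by (simp add: neg_ent_def tlog_def b_def mult.commute)
  finally show ?thesis .
qed

text \<open>The left side is the mutual information of the label x and the outcome y for an ensemble
  of total mass tr S. Relative to \<open>holevo_bound\<close>, the additional logarithms of traces
  are exactly what completes \<open>neg_ent\<close> to \<open>ent\<close> on both levels.\<close>

lemma holevo_mutual_information:
  assumes X: "finite X" and R: "\<And>x. x \<in> X \<Longrightarrow> psd n (R x)" and Sp: "psd n S"
    and S: "\<And>i j. i < n \<Longrightarrow> j < n \<Longrightarrow> S $$ (i, j) = (\<Sum>x\<in>X. R x $$ (i, j))"
    and M: "povm n Y M"
    and p: "\<And>x y. x \<in> X \<Longrightarrow> y \<in> Y \<Longrightarrow> p x y = Re (trp n (M y) (R x))"
  shows "(\<Sum>x\<in>X. \<Sum>y\<in>Y. p x y * ln (p x y * rtrace n S / ((\<Sum>y'\<in>Y. p x y') * (\<Sum>x'\<in>X. p x' y))))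
      \<le> ent n S - (\<Sum>x\<in>X. ent n (R x))"
proof -
  have finY: "finite Y" using M unfolding povm_def by blast
  have pnn: "0 \<le> p x y" if "x \<in> X" "y \<in> Y" for x y
    using M that unfolding p[OF that] povm_def by (intro Re_trp_nonneg R) auto
  have px: "(\<Sum>y\<in>Y. p x y) = rtrace n (R x)" if "x \<in> X" for x
    using povm_sum_trp[OF M, of "R x"] p[OF that] by (simp add: rtrace_def flip: Re_sum)
  have tot: "(\<Sum>x\<in>X. rtrace n (R x)) = rtrace n S"
    unfolding rtrace_def Re_sum[symmetric] by (subst sum.swap) (simp add: S)
  have "p x y * ln (p x y * rtrace n S / ((\<Sum>y'\<in>Y. p x y') * (\<Sum>x'\<in>X. p x' y)))
     = p x y * ln (p x y / (\<Sum>x'\<in>X. p x' y)) + p x y * (ln (rtrace n S) - ln (rtrace n (R x)))"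
    if xy: "x \<in> X" "y \<in> Y" for x y
  proof (cases "p x y = 0")
    case False
    then have "0 < p x y" using pnn[OF xy] by simp
    moreover have "p x y \<le> (\<Sum>x'\<in>X. p x' y)" using X xy pnn by (intro member_le_sum) auto
    moreover have "p x y \<le> rtrace n (R x)" unfolding px[OF xy(1), symmetric]
      using finY xy pnn by (intro member_le_sum) auto
    moreover have "rtrace n (R x) \<le> rtrace n S" unfolding tot[symmetric]
      using X xy R by (intro member_le_sum) (auto intro: rtrace_nonneg)
    ultimately have "0 < p x y" "0 < (\<Sum>x'\<in>X. p x' y)" "0 < rtrace n (R x)" "0 < rtrace n S" by linarith+
    then show ?thesis by (simp add: px[OF xy(1)] ln_div ln_mult algebra_simps)
  qed simp
  then have "(\<Sum>x\<in>X. \<Sum>y\<in>Y. p x y * ln (p x y * rtrace n S / ((\<Sum>y'\<in>Y. p x y') * (\<Sum>x'\<in>X. p x' y))))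
    = (\<Sum>x\<in>X. \<Sum>y\<in>Y. p x y * ln (p x y / (\<Sum>x'\<in>X. p x' y))) +
      (\<Sum>x\<in>X. rtrace n (R x) * (ln (rtrace n S) - ln (rtrace n (R x))))"
    by (simp add: sum.distrib sum_distrib_right[symmetric] px)
  also have "(\<Sum>x\<in>X. rtrace n (R x) * (ln (rtrace n S) - ln (rtrace n (R x)))) =
     tlog (rtrace n S) - (\<Sum>x\<in>X. tlog (rtrace n (R x)))"
    by (simp add: tlog_def tot[symmetric] right_diff_distrib sum_subtractf sum_distrib_right)
  finally show ?thesis
    using holevo_bound[OF X R Sp S M p] by (simp add: ent_def sum_subtractf)
qed

section \<open>Tensor products, partial traces and permutation symmetry\<close>

lemma psd_gram:
  assumes "psd n A"
  obtains z where "\<And>i j. i < n \<Longrightarrow> j < n \<Longrightarrow> A $$ (i, j) = (\<Sum>s<n. z s i * cnj (z s j))"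
proof -
  obtain a v where sp: "spectral n A a v" using spectral_exists[OF assms] by blast
  have "complex_of_real (a s) * (v s i * cnj (v s j)) =
      of_real (sqrt (a s)) * v s i * cnj (of_real (sqrt (a s)) * v s j)" if "s < n" for s i j
  proof -
    have "0 \<le> a s" using sp that unfolding spectral_def by auto
    then have "complex_of_real (a s) = of_real (sqrt (a s)) * of_real (sqrt (a s))"
      by (metis of_real_mult real_sqrt_mult_self abs_of_nonneg)
    then show ?thesis by simp
  qed
  then have "(\<Sum>s<n. complex_of_real (a s) * (v s i * cnj (v s j))) =
      (\<Sum>s<n. of_real (sqrt (a s)) * v s i * cnj (of_real (sqrt (a s)) * v s j))" for i j
    by (intro sum.cong) auto
  then show thesis
    using sp unfolding spectral_def
    by (intro that[of "\<lambda>s i. of_real (sqrt (a s)) * v s i"]) simp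
qed

lemma sum_lessThan_mult:
  fixes f :: "nat \<Rightarrow> 'a::comm_monoid_add"
  shows "(\<Sum>i<n * m. f i) = (\<Sum>a<n. \<Sum>b<m. f (a * m + b))"
proof (induction n)
  case (Suc n)
  have "{..<Suc n * m} = {..<n * m} \<union> {n * m..<n * m + m}" by auto
  then have "(\<Sum>i<Suc n * m. f i) = (\<Sum>i<n * m. f i) + sum f {n * m..<n * m + m}"
    by (metis finite_lessThan finite_atLeastLessThan sum.union_disjoint ivl_disj_int_one(2))
  also have "sum f {n * m..<n * m + m} = (\<Sum>b<m. f (n * m + b))"
    using sum.atLeastLessThan_shift_0[of f "n * m" "n * m + m"] by (simp add: atLeast0LessThan add.commute)
  finally show ?case by (simp add: Suc)
qed simp

lemma mult_add_less: "a < n \<Longrightarrow> b < m \<Longrightarrow> a * m + b < n * (m::nat)"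
proof -
  assume "a < n" "b < m"
  then have "a * m + b < Suc a * m" "Suc a * m \<le> n * m" by (auto intro: mult_le_mono1 simp del: mult_Suc) simp
  then show ?thesis by linarith
qed

lemma ktensor_carrier:
  "A \<in> carrier_mat n n \<Longrightarrow> B \<in> carrier_mat m m \<Longrightarrow> ktensor A B \<in> carrier_mat (n * m) (n * m)"
  by (auto simp: ktensor_def)

lemma ktensor_index:
  assumes "A \<in> carrier_mat n n" "B \<in> carrier_mat m m" "i < n * m" "j < n * m"
  shows "ktensor A B $$ (i, j) = A $$ (i div m, j div m) * B $$ (i mod m, j mod m)"
  using assms by (auto simp: ktensor_def)

lemma ktensor_index':
  assumes "A \<in> carrier_mat n n" "B \<in> carrier_mat m m" "a < n" "b < m" "a' < n" "b' < m"
  shows "ktensor A B $$ (a * m + b, a' * m + b') = A $$ (a, a') * B $$ (b, b')"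
  using assms ktensor_index[OF assms(1,2) mult_add_less mult_add_less, of a b a' b'] by simp

lemma div_less_of_less_mult: "i < n * m \<Longrightarrow> i div m < (n::nat)"
  by (simp add: less_mult_imp_div_less)

lemma mod_less_of_less_mult: "i < n * m \<Longrightarrow> i mod m < (m::nat)"
  by (metis less_nat_zero_code mod_less_divisor mult_0_right neq0_conv)

lemma ktensor_assoc:
  assumes "A \<in> carrier_mat n n" "B \<in> carrier_mat m m" "C \<in> carrier_mat l l"
  shows "ktensor (ktensor A B) C = ktensor A (ktensor B C)"
proof (rule eq_matI)
  have c1: "ktensor (ktensor A B) C \<in> carrier_mat (n * m * l) (n * m * l)"
    by (intro ktensor_carrier assms)
  have c2: "ktensor A (ktensor B C) \<in> carrier_mat (n * (m * l)) (n * (m * l))"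
    by (intro ktensor_carrier assms)
  show "dim_row (ktensor (ktensor A B) C) = dim_row (ktensor A (ktensor B C))"
    "dim_col (ktensor (ktensor A B) C) = dim_col (ktensor A (ktensor B C))"
    using c1 c2 by (auto simp: mult.assoc)
  fix i j assume "i < dim_row (ktensor A (ktensor B C))" "j < dim_col (ktensor A (ktensor B C))"
  then have ij: "i < n * (m * l)" "j < n * (m * l)" using c2 by auto
  then have ij': "i < n * m * l" "j < n * m * l" by (auto simp: mult.assoc)
  have ijd: "i div l < n * m" "j div l < n * m" using ij' by (auto intro: div_less_of_less_mult)
  have ijm: "i mod (m * l) < m * l" "j mod (m * l) < m * l" using ij by (auto intro: mod_less_of_less_mult)
  have e1: "x div l div m = x div (m * l)" for x
    by (simp add: div_mult2_eq mult.commute[of m l])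
  have e2: "(x div l) mod m = (x mod (m * l)) div l" for x
    by (cases "l = 0") (simp_all add: mult.commute[of m l] mod_mult2_eq)
  have e3: "x mod l = (x mod (m * l)) mod l" for x
    by (simp add: mod_mod_cancel)
  show "ktensor (ktensor A B) C $$ (i, j) = ktensor A (ktensor B C) $$ (i, j)"
    unfolding ktensor_index[OF ktensor_carrier[OF assms(1,2)] assms(3) ij'] ktensor_index[OF assms(1,2) ijd]
      ktensor_index[OF assms(1) ktensor_carrier[OF assms(2,3)] ij] ktensor_index[OF assms(2,3) ijm]
    by (simp only: e1 e2 e3[of i] e3[of j] mult.assoc)
qed

lemma ktensor_one_one: "ktensor (1\<^sub>m n) (1\<^sub>m m) = 1\<^sub>m (n * m)"
proof (rule eq_matI)
  fix i j assume "i < dim_row (1\<^sub>m (n * m) :: complex mat)" "j < dim_col (1\<^sub>m (n * m) :: complex mat)"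
  then have ij: "i < n * m" "j < n * m" by auto
  have "i = j \<longleftrightarrow> i div m = j div m \<and> i mod m = j mod m" by (metis div_mult_mod_eq)
  then show "ktensor (1\<^sub>m n) (1\<^sub>m m) $$ (i, j) = 1\<^sub>m (n * m) $$ (i, j)"
    using ij div_less_of_less_mult[OF ij(1)] div_less_of_less_mult[OF ij(2)]
      mod_less_of_less_mult[OF ij(1)] mod_less_of_less_mult[OF ij(2)]
    by (subst ktensor_index[of _ n _ m]) auto
qed (auto simp: ktensor_def)

lemma ktensor_one_right: "A \<in> carrier_mat n n \<Longrightarrow> ktensor A (1\<^sub>m 1) = A"
  by (rule eq_matI) (auto simp: ktensor_def)

lemma ktensor_one_left: "A \<in> carrier_mat n n \<Longrightarrow> ktensor (1\<^sub>m 1) A = A"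
  by (rule eq_matI) (auto simp: ktensor_def)

lemma psd_ktensor:
  assumes A: "psd n A" and B: "psd m B"
  shows "psd (n * m) (ktensor A B)"
proof -
  obtain x where x: "\<And>i j. i < n \<Longrightarrow> j < n \<Longrightarrow> A $$ (i, j) = (\<Sum>s<n. x s i * cnj (x s j))"
    using psd_gram[OF A] by blast
  obtain y where y: "\<And>i j. i < m \<Longrightarrow> j < m \<Longrightarrow> B $$ (i, j) = (\<Sum>s<m. y s i * cnj (y s j))"
    using psd_gram[OF B] by blast
  note c = psdD(1)[OF A] psdD(1)[OF B]
  show ?thesis
  proof (rule psd_of_gram[where S = "{..<n} \<times> {..<m}" and z = "\<lambda>(s, t) i. x s (i div m) * y t (i mod m)"])
    show "ktensor A B \<in> carrier_mat (n * m) (n * m)" by (rule ktensor_carrier[OF c])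
    fix i j assume ij: "i < n * m" "j < n * m"
    show "ktensor A B $$ (i, j) = (\<Sum>s\<in>{..<n} \<times> {..<m}. (case s of (s, t) \<Rightarrow> \<lambda>i. x s (i div m) * y t (i mod m)) i *
         cnj ((case s of (s, t) \<Rightarrow> \<lambda>i. x s (i div m) * y t (i mod m)) j))"
      unfolding ktensor_index[OF c ij] x[OF div_less_of_less_mult[OF ij(1)] div_less_of_less_mult[OF ij(2)]]
        y[OF mod_less_of_less_mult[OF ij(1)] mod_less_of_less_mult[OF ij(2)]] sum_product sum.cartesian_product
      by (intro sum.cong refl) (auto simp: mult_ac)
  qed simp
qed

lemma psd_one: "psd n (1\<^sub>m n)"
proof (rule psd_of_gram[where S = "{..<n}" and z = "\<lambda>s i. if s = i then 1 else 0"])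
  fix i j assume "i < n" "j < n"
  have "(\<Sum>s<n. (if s = i then 1 else 0) * cnj (if s = j then 1 else 0)) = (\<Sum>s<n. if s = i then if i = j then 1 else 0 else 0 :: complex)"
    by (intro sum.cong refl) auto
  then show "1\<^sub>m n $$ (i, j) = (\<Sum>s<n. (if s = i then 1 else 0) * cnj (if s = j then 1 else 0 :: complex))"
    using \<open>i < n\<close> \<open>j < n\<close> by simp
qed auto

lemma psd_zero: "psd n (0\<^sub>m n n)"
  by (rule psd_of_gram[where S = "{}"]) auto

lemma trp_ktensor:
  assumes "A \<in> carrier_mat n n" "B \<in> carrier_mat m m" "C \<in> carrier_mat n n" "D \<in> carrier_mat m m"
  shows "trp (n * m) (ktensor A B) (ktensor C D) = trp n A C * trp m B D"
proof -
  have "trp (n * m) (ktensor A B) (ktensor C D) = 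
    (\<Sum>a<n. \<Sum>b<m. \<Sum>a'<n. \<Sum>b'<m. (A $$ (a, a') * C $$ (a', a)) * (B $$ (b, b') * D $$ (b', b)))"
    unfolding trp_def sum_lessThan_mult
    by (intro sum.cong refl) (simp add: ktensor_index'[OF assms(1,2)] ktensor_index'[OF assms(3,4)] mult_ac)
  also have "\<dots> = (\<Sum>a<n. \<Sum>a'<n. \<Sum>b<m. \<Sum>b'<m. (A $$ (a, a') * C $$ (a', a)) * (B $$ (b, b') * D $$ (b', b)))"
    by (intro sum.cong refl sum.swap)
  also have "\<dots> = trp n A C * trp m B D"
    unfolding trp_def by (simp only: sum_distrib_right, simp only: sum_distrib_left)
  finally show ?thesis .
qed

section \<open>Product operators, base-d digits and separation of operators by traces\<close>

fun tprod :: "(nat \<Rightarrow> complex mat) \<Rightarrow> nat \<Rightarrow> complex mat" where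
  "tprod X 0 = 1\<^sub>m 1"
| "tprod X (Suc N) = ktensor (tprod X N) (X N)"

lemma tprod_carrier:
  "(\<And>m. m < N \<Longrightarrow> X m \<in> carrier_mat d d) \<Longrightarrow> tprod X N \<in> carrier_mat (d ^ N) (d ^ N)"
proof (induction N)
  case (Suc N)
  then have "ktensor (tprod X N) (X N) \<in> carrier_mat (d ^ N * d) (d ^ N * d)"
    by (intro ktensor_carrier) auto
  then show ?case by (simp add: mult.commute)
qed simp

lemma tprod_cong: "(\<And>m. m < N \<Longrightarrow> X m = Y m) \<Longrightarrow> tprod X N = tprod Y N"
  by (induction N) auto

lemma tensor_pow_eq_tprod: "tensor_pow A N = tprod (\<lambda>_. A) N"
  by (induction N) auto

lemma tprod_append:
  assumes "\<And>m. m < a \<Longrightarrow> X m \<in> carrier_mat d d" "\<And>m. m < b \<Longrightarrow> Y m \<in> carrier_mat d d"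
  shows "ktensor (tprod X a) (tprod Y b) = tprod (\<lambda>m. if m < a then X m else Y (m - a)) (a + b)"
  using assms(2)
proof (induction b)
  case 0
  have "ktensor (tprod X a) (1\<^sub>m 1) = tprod X a"
    by (rule ktensor_one_right[OF tprod_carrier[OF assms(1)]])
  also have "\<dots> = tprod (\<lambda>m. if m < a then X m else Y (m - a)) a" by (rule tprod_cong) simp
  finally show ?case by simp
next
  case (Suc b)
  have "ktensor (tprod X a) (tprod Y (Suc b)) = ktensor (ktensor (tprod X a) (tprod Y b)) (Y b)"
    using ktensor_assoc[OF tprod_carrier[OF assms(1)] tprod_carrier[of b Y d] Suc.prems[of b]] Suc.prems by simp
  then show ?case using Suc by simp
qed

lemma tprod_one: "tprod (\<lambda>_. 1\<^sub>m d) N = 1\<^sub>m (d ^ N)"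
  by (induction N) (simp_all add: ktensor_one_one mult.commute)

lemma digit_Suc: "m < N \<Longrightarrow> digit d (Suc N) i m = digit d N (i div d) m"
proof -
  assume "m < N"
  then have "N - m = Suc (N - 1 - m)" by simp
  then have "d ^ (N - m) = d * d ^ (N - 1 - m)" by (simp only: power_Suc)
  then show ?thesis unfolding digit_def by (simp add: div_mult2_eq)
qed

lemma digit_last: "digit d (Suc N) i N = i mod d"
  by (simp add: digit_def)

lemma digit_less: "0 < d \<Longrightarrow> digit d N i m < d"
  by (simp add: digit_def)

lemma tprod_index:
  assumes "\<And>m. m < N \<Longrightarrow> X m \<in> carrier_mat d d" "i < d ^ N" "j < d ^ N"
  shows "tprod X N $$ (i, j) = (\<Prod>m<N. X m $$ (digit d N i m, digit d N j m))"
  using assms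
proof (induction N arbitrary: i j)
  case (Suc N)
  have ij: "i < d ^ N * d" "j < d ^ N * d" using Suc.prems by (auto simp: mult.commute)
  have "tprod X (Suc N) $$ (i, j) = tprod X N $$ (i div d, j div d) * X N $$ (i mod d, j mod d)"
    unfolding tprod.simps by (rule ktensor_index[OF tprod_carrier _ ij]) (use Suc.prems in auto)
  also have "tprod X N $$ (i div d, j div d) = (\<Prod>m<N. X m $$ (digit d N (i div d) m, digit d N (j div d) m))"
    using Suc.prems ij by (intro Suc.IH) (auto intro: div_less_of_less_mult)
  finally show ?case by (simp add: digit_Suc digit_last)
qed simp

lemma digit_inj:
  assumes "i < d ^ N" "j < d ^ N" "\<And>m. m < N \<Longrightarrow> digit d N i m = digit d N j m"
  shows "i = j"
  using assms
proof (induction N arbitrary: i j)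
  case (Suc N)
  have ij: "i < d ^ N * d" "j < d ^ N * d" using Suc.prems by (auto simp: mult.commute)
  have "i div d = j div d"
  proof (rule Suc.IH)
    fix m assume "m < N"
    then show "digit d N (i div d) m = digit d N (j div d) m"
      using Suc.prems(3)[of m] by (simp add: digit_Suc)
  qed (use ij in \<open>auto intro: div_less_of_less_mult\<close>)
  moreover have "i mod d = j mod d" using Suc.prems(3)[of N] by (simp add: digit_last)
  ultimately show ?case by (metis div_mult_mod_eq)
qed simp

fun undigits :: "nat \<Rightarrow> (nat \<Rightarrow> nat) \<Rightarrow> nat \<Rightarrow> nat" where
  "undigits d f 0 = 0"
| "undigits d f (Suc N) = undigits d f N * d + f N"

lemma undigits_less: "(\<And>m. m < N \<Longrightarrow> f m < d) \<Longrightarrow> undigits d f N < d ^ N"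
proof (induction N)
  case (Suc N)
  then have "undigits d f N * d + f N < d ^ N * d" by (intro mult_add_less) auto
  then show ?case by (simp add: mult.commute)
qed simp

lemma digit_undigits: "(\<And>m. m < N \<Longrightarrow> f m < d) \<Longrightarrow> m < N \<Longrightarrow> digit d N (undigits d f N) m = f m"
proof (induction N)
  case (Suc N)
  show ?case
  proof (cases "m = N")
    case False
    have "f N < d" using Suc.prems(1) by simp
    then have "(undigits d f N * d + f N) div d = undigits d f N" by simp
    then show ?thesis using Suc False by (simp add: digit_Suc)
  qed (use Suc.prems in \<open>simp add: digit_last\<close>)
qed simp

definition unit_mat :: "nat \<Rightarrow> nat \<Rightarrow> nat \<Rightarrow> complex mat" where
  "unit_mat n a b = mat n n (\<lambda>(i, j). if i = a \<and> j = b then 1 else 0)"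

lemma trp_delta:
  assumes "\<And>i j. i < n \<Longrightarrow> j < n \<Longrightarrow> X $$ (i, j) = (if i = a \<and> j = b then 1 else 0)" "a < n" "b < n"
  shows "trp n X A = A $$ (b, a)"
proof -
  have "trp n X A = (\<Sum>i<n. \<Sum>j<n. if j = b then if i = a then A $$ (b, a) else 0 else 0)"
    unfolding trp_def by (intro sum.cong refl) (use assms in auto)
  also have "\<dots> = A $$ (b, a)" using assms by simp
  finally show ?thesis .
qed

lemma mat_eq_of_trp:
  assumes c: "A \<in> carrier_mat n n" "B \<in> carrier_mat n n"
    and eq: "\<And>X. X \<in> carrier_mat n n \<Longrightarrow> trp n X A = trp n X B"
  shows "A = B"
proof (rule eq_matI)
  fix i j assume "i < dim_row B" "j < dim_col B"
  then have ij: "i < n" "j < n" using c by auto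
  have "A $$ (i, j) = trp n (unit_mat n j i) A" "B $$ (i, j) = trp n (unit_mat n j i) B"
    using ij by (auto simp: trp_delta[of n _ j i] unit_mat_def)
  then show "A $$ (i, j) = B $$ (i, j)" using eq[of "unit_mat n j i"] by (simp add: unit_mat_def)
qed (use c in auto)

text \<open>Matrix units of the tensor power are products of one-particle matrix units, selected by
  the digits of the two indices. Hence product operators separate operators.\<close>

lemma mat_eq_of_trp_tprod:
  assumes c: "A \<in> carrier_mat (d ^ N) (d ^ N)" "B \<in> carrier_mat (d ^ N) (d ^ N)" and d: "0 < d"
    and eq: "\<And>X. (\<And>m. X m \<in> carrier_mat d d) \<Longrightarrow> trp (d ^ N) (tprod X N) A = trp (d ^ N) (tprod X N) B"
  shows "A = B"
proof (rule eq_matI)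
  fix i j assume "i < dim_row B" "j < dim_col B"
  then have ij: "i < d ^ N" "j < d ^ N" using c by auto
  define X where "X m = unit_mat d (digit d N j m) (digit d N i m)" for m
  have Xc: "X m \<in> carrier_mat d d" for m by (simp add: X_def unit_mat_def)
  have "tprod X N $$ (a, b) = (if a = j \<and> b = i then 1 else 0)" if ab: "a < d ^ N" "b < d ^ N" for a b
  proof -
    have "tprod X N $$ (a, b) = (\<Prod>m<N. if digit d N a m = digit d N j m \<and> digit d N b m = digit d N i m then 1 else 0)"
      unfolding tprod_index[OF Xc ab] by (intro prod.cong refl) (simp add: X_def unit_mat_def digit_less[OF d])
    also have "\<dots> = (if \<forall>m<N. digit d N a m = digit d N j m \<and> digit d N b m = digit d N i m then 1 else 0)"
      by (auto intro!: prod.neutral)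
    also have "(\<forall>m<N. digit d N a m = digit d N j m \<and> digit d N b m = digit d N i m) \<longleftrightarrow> a = j \<and> b = i"
      using digit_inj[OF ab(1) ij(2)] digit_inj[OF ab(2) ij(1)] by auto
    finally show ?thesis .
  qed
  then show "A $$ (i, j) = B $$ (i, j)" using eq[of X, OF Xc] ij by (simp add: trp_delta[of _ _ j i])
qed (use c in auto)

text \<open>\<open>tr\<^sub>2 [(1 \<otimes> M) G]\<close>, the unnormalised state of the first factor after outcome \<open>M\<close> on the second.\<close>
definition red :: "nat \<Rightarrow> nat \<Rightarrow> complex mat \<Rightarrow> complex mat \<Rightarrow> complex mat" where
  "red n1 n2 M G = mat n1 n1 (\<lambda>(i, j). \<Sum>l<n2. \<Sum>l'<n2. M $$ (l, l') * G $$ (i * n2 + l', j * n2 + l))"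

lemma red_carrier: "red n1 n2 M G \<in> carrier_mat n1 n1"
  by (simp add: red_def)

lemma ptrace2_eq_red:
  assumes M: "M \<in> carrier_mat n2 n2" and G: "G \<in> carrier_mat (n1 * n2) (n1 * n2)"
  shows "ptrace2 n1 n2 (ktensor (1\<^sub>m n1) M * G) = red n1 n2 M G"
proof (rule eq_matI)
  fix i j assume "i < dim_row (red n1 n2 M G)" "j < dim_col (red n1 n2 M G)"
  then have ij: "i < n1" "j < n1" by (auto simp: red_def)
  have K: "ktensor (1\<^sub>m n1) M \<in> carrier_mat (n1 * n2) (n1 * n2)"
    by (rule ktensor_carrier[OF one_carrier_mat M])
  have "(ktensor (1\<^sub>m n1) M * G) $$ (i * n2 + l, j * n2 + l) = (\<Sum>l'<n2. M $$ (l, l') * G $$ (i * n2 + l', j * n2 + l))"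
    if l: "l < n2" for l
  proof -
    have b: "i * n2 + l < n1 * n2" "j * n2 + l < n1 * n2" using ij l by (auto intro: mult_add_less)
    have "(ktensor (1\<^sub>m n1) M * G) $$ (i * n2 + l, j * n2 + l) =
      (\<Sum>r<n1 * n2. ktensor (1\<^sub>m n1) M $$ (i * n2 + l, r) * G $$ (r, j * n2 + l))"
      using K G b by (simp add: scalar_prod_def atLeast0LessThan)
    also have "\<dots> = (\<Sum>a<n1. \<Sum>l'<n2. 1\<^sub>m n1 $$ (i, a) * M $$ (l, l') * G $$ (a * n2 + l', j * n2 + l))"
      unfolding sum_lessThan_mult
      by (intro sum.cong refl) (use ij l in \<open>simp add: ktensor_index'[OF one_carrier_mat M] del: index_one_mat\<close>)
    also have "\<dots> = (\<Sum>a<n1. if a = i then \<Sum>l'<n2. M $$ (l, l') * G $$ (i * n2 + l', j * n2 + l) else 0)"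
      using ij by (intro sum.cong refl) auto
    finally show ?thesis using ij by simp
  qed
  then show "ptrace2 n1 n2 (ktensor (1\<^sub>m n1) M * G) $$ (i, j) = red n1 n2 M G $$ (i, j)"
    using ij by (simp add: ptrace2_def red_def)
qed (auto simp: ptrace2_def red_def)

text \<open>The duality between partial trace and tensoring. It reduces composition and symmetry
  properties of \<open>red\<close> to identities between tensor products.\<close>

lemma trp_red:
  assumes "A \<in> carrier_mat n1 n1" "M \<in> carrier_mat n2 n2"
  shows "trp n1 A (red n1 n2 M G) = trp (n1 * n2) (ktensor A M) G"
proof -
  have "trp (n1 * n2) (ktensor A M) G = 
     (\<Sum>i<n1. \<Sum>l<n2. \<Sum>j<n1. \<Sum>l'<n2. A $$ (i, j) * M $$ (l, l') * G $$ (j * n2 + l', i * n2 + l))"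
    unfolding trp_def sum_lessThan_mult
    by (intro sum.cong refl) (simp add: ktensor_index'[OF assms])
  also have "\<dots> = (\<Sum>i<n1. \<Sum>j<n1. \<Sum>l<n2. \<Sum>l'<n2. A $$ (i, j) * M $$ (l, l') * G $$ (j * n2 + l', i * n2 + l))"
    by (intro sum.cong refl sum.swap)
  also have "\<dots> = trp n1 A (red n1 n2 M G)"
    unfolding trp_def by (intro sum.cong refl) (simp add: red_def sum_distrib_left mult.assoc)
  finally show ?thesis by simp
qed

lemma red_red:
  assumes M: "M \<in> carrier_mat n2 n2" and M': "M' \<in> carrier_mat n3 n3"
  shows "red n1 n2 M (red (n1 * n2) n3 M' G) = red n1 (n2 * n3) (ktensor M M') G"
proof (rule mat_eq_of_trp)
  fix X :: "complex mat" assume X: "X \<in> carrier_mat n1 n1"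
  show "trp n1 X (red n1 n2 M (red (n1 * n2) n3 M' G)) = trp n1 X (red n1 (n2 * n3) (ktensor M M') G)"
    unfolding trp_red[OF X M] trp_red[OF ktensor_carrier[OF X M] M'] trp_red[OF X ktensor_carrier[OF M M']]
      ktensor_assoc[OF X M M'] by (simp only: mult.assoc)
qed (auto simp: red_carrier)

text \<open>If M is the sum of the |x_s><x_s| and G the sum of the |y_t><y_t|, then the reduced
  operator is the Gram operator of the partial contractions <x_s|y_t>, which are the vectors
  z.\<close>

lemma psd_red:
  assumes M: "psd n2 M" and G: "psd (n1 * n2) G"
  shows "psd n1 (red n1 n2 M G)"
proof -
  obtain x where x: "\<And>i j. i < n2 \<Longrightarrow> j < n2 \<Longrightarrow> M $$ (i, j) = (\<Sum>s<n2. x s i * cnj (x s j))"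
    using psd_gram[OF M] by blast
  obtain y where y: "\<And>i j. i < n1 * n2 \<Longrightarrow> j < n1 * n2 \<Longrightarrow> G $$ (i, j) = (\<Sum>s<n1 * n2. y s i * cnj (y s j))"
    using psd_gram[OF G] by blast
  define z where "z = (\<lambda>(s, t) i. \<Sum>l<n2. cnj (x s l) * y t (i * n2 + l))"
  show ?thesis
  proof (rule psd_of_gram[where S = "{..<n2} \<times> {..<n1 * n2}" and z = z])
    fix i j assume ij: "i < n1" "j < n1"
    define f where "f l l' s t = (cnj (x s l') * y t (i * n2 + l')) * cnj (cnj (x s l) * y t (j * n2 + l))" for l l' s t
    have "red n1 n2 M G $$ (i, j) = (\<Sum>l<n2. \<Sum>l'<n2. \<Sum>k\<in>{..<n2} \<times> {..<n1 * n2}. f l l' (fst k) (snd k))"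
    proof -
      have "red n1 n2 M G $$ (i, j) = (\<Sum>l<n2. \<Sum>l'<n2. M $$ (l, l') * G $$ (i * n2 + l', j * n2 + l))"
        using ij by (simp add: red_def)
      also have "\<dots> = (\<Sum>l<n2. \<Sum>l'<n2. \<Sum>k\<in>{..<n2} \<times> {..<n1 * n2}. f l l' (fst k) (snd k))"
      proof (intro sum.cong refl)
        fix l l' assume l: "l \<in> {..<n2}" "l' \<in> {..<n2}"
        then have b: "i * n2 + l' < n1 * n2" "j * n2 + l < n1 * n2" using ij by (auto intro: mult_add_less)
        show "M $$ (l, l') * G $$ (i * n2 + l', j * n2 + l) = (\<Sum>k\<in>{..<n2} \<times> {..<n1 * n2}. f l l' (fst k) (snd k))"
          unfolding y[OF b] using l
          by (simp add: x sum_product sum.cartesian_product case_prod_unfold f_def mult_ac)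
      qed
      finally show ?thesis .
    qed
    also have "\<dots> = (\<Sum>l<n2. \<Sum>k\<in>{..<n2} \<times> {..<n1 * n2}. \<Sum>l'<n2. f l l' (fst k) (snd k))"
      by (intro sum.cong refl sum.swap)
    also have "\<dots> = (\<Sum>k\<in>{..<n2} \<times> {..<n1 * n2}. \<Sum>l<n2. \<Sum>l'<n2. f l l' (fst k) (snd k))"
      by (rule sum.swap)
    also have "\<dots> = (\<Sum>k\<in>{..<n2} \<times> {..<n1 * n2}. \<Sum>l'<n2. \<Sum>l<n2. f l l' (fst k) (snd k))"
      by (intro sum.cong refl sum.swap)
    also have "\<dots> = (\<Sum>k\<in>{..<n2} \<times> {..<n1 * n2}. z k i * cnj (z k j))"
      unfolding z_def f_def by (intro sum.cong refl) (simp only: case_prod_unfold cnj_sum sum_product)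
    finally show "red n1 n2 M G $$ (i, j) = (\<Sum>k\<in>{..<n2} \<times> {..<n1 * n2}. z k i * cnj (z k j))" .
  qed (auto simp: red_carrier)
qed

lemma red_sum:
  assumes "povm n2 Y M" "i < n1" "j < n1"
  shows "red n1 n2 (1\<^sub>m n2) G $$ (i, j) = (\<Sum>y\<in>Y. red n1 n2 (M y) G $$ (i, j))"
proof -
  have "red n1 n2 (1\<^sub>m n2) G $$ (i, j) = (\<Sum>l<n2. \<Sum>l'<n2. (\<Sum>y\<in>Y. M y $$ (l, l')) * G $$ (i * n2 + l', j * n2 + l))"
    using assms by (simp add: red_def povm_def)
  also have "\<dots> = (\<Sum>l<n2. \<Sum>l'<n2. \<Sum>y\<in>Y. M y $$ (l, l') * G $$ (i * n2 + l', j * n2 + l))"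
    by (simp add: sum_distrib_right)
  also have "\<dots> = (\<Sum>l<n2. \<Sum>y\<in>Y. \<Sum>l'<n2. M y $$ (l, l') * G $$ (i * n2 + l', j * n2 + l))"
    by (intro sum.cong refl sum.swap)
  also have "\<dots> = (\<Sum>y\<in>Y. \<Sum>l<n2. \<Sum>l'<n2. M y $$ (l, l') * G $$ (i * n2 + l', j * n2 + l))"
    by (rule sum.swap)
  finally show ?thesis using assms by (simp add: red_def)
qed

section \<open>Permutation symmetry\<close>

text \<open>Permutation symmetry is expressed through expectations of product operators because
  conditional states then inherit it at once.\<close>
definition sym_op :: "nat \<Rightarrow> nat \<Rightarrow> complex mat \<Rightarrow> bool" where
  "sym_op d N G \<longleftrightarrow> (\<forall>X \<sigma>. (\<forall>m. X m \<in> carrier_mat d d) \<longrightarrow> \<sigma> permutes {..<N} \<longrightarrow>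
     trp (d ^ N) (tprod (\<lambda>m. X (\<sigma> m)) N) G = trp (d ^ N) (tprod X N) G)"

text \<open>U_\<sigma> permutes the standard basis by a map \<tau>, so commutation says that the
  entries of G are invariant under applying \<tau> to both indices. Relabelling both summation
  indices of the trace by \<tau> then moves \<sigma> off the product.\<close>

lemma sym_op_of_symmetric_state:
  assumes d: "0 < d" and G: "symmetric_state d N G"
  shows "sym_op d N G"
  unfolding sym_op_def
proof (intro allI impI)
  fix X :: "nat \<Rightarrow> complex mat" and \<sigma> assume X: "\<forall>m. X m \<in> carrier_mat d d" and \<sigma>: "\<sigma> permutes {..<N}"
  have Gc: "G \<in> carrier_mat (d ^ N) (d ^ N)"
    using G unfolding symmetric_state_def density_def psd_def by blast
  define U where "U = perm_op d N \<sigma>"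
  have Uc: "U \<in> carrier_mat (d ^ N) (d ^ N)" by (simp add: U_def perm_op_def)
  have comm: "U * G = G * U" using G \<sigma> unfolding symmetric_state_def U_def by blast
  have \<sigma>N: "\<sigma> m < N \<longleftrightarrow> m < N" for m using permutes_in_image[OF \<sigma>, of m] by simp
  \<comment> \<open>The image of the basis index j under U_\<sigma>: its digit m is digit \<sigma> m
    of j.\<close>
  define \<tau> where "\<tau> j = undigits d (\<lambda>m. digit d N j (\<sigma> m)) N" for j
  have \<tau>l: "\<tau> j < d ^ N" for j unfolding \<tau>_def by (rule undigits_less) (rule digit_less[OF d])
  have \<tau>d: "digit d N (\<tau> j) m = digit d N j (\<sigma> m)" if "m < N" for j m
    unfolding \<tau>_def by (rule digit_undigits) (use that digit_less[OF d] in auto)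
  have inj: "inj_on \<tau> {..<d ^ N}"
  proof (rule inj_onI)
    fix i j assume ij: "i \<in> {..<d ^ N}" "j \<in> {..<d ^ N}" "\<tau> i = \<tau> j"
    have "digit d N i m = digit d N j m" if m: "m < N" for m
    proof -
      obtain m' where m': "m = \<sigma> m'" using permutes_surj[OF \<sigma>] by (metis surjD)
      then show ?thesis using \<tau>d[of m' i] \<tau>d[of m' j] ij(3) m \<sigma>N by simp
    qed
    then show "i = j" using ij by (intro digit_inj[of i d N j]) auto
  qed
  have bij: "bij_betw \<tau> {..<d ^ N} {..<d ^ N}"
    using endo_inj_surj[OF finite_lessThan _ inj] inj \<tau>l by (auto simp: bij_betw_def)
  have Ui: "U $$ (i, j) = (if i = \<tau> j then 1 else 0)" if ij: "i < d ^ N" "j < d ^ N" for i j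
  proof -
    have "(\<forall>m<N. digit d N i m = digit d N j (\<sigma> m)) \<longleftrightarrow> i = \<tau> j"
      using \<tau>d[of _ j] digit_inj[OF ij(1) \<tau>l[of j]] by auto
    then show ?thesis using ij by (simp add: U_def perm_op_def)
  qed
  have inv: "G $$ (\<tau> i, \<tau> j) = G $$ (i, j)" if ij: "i < d ^ N" "j < d ^ N" for i j
  proof -
    have "(U * G) $$ (\<tau> i, j) = (\<Sum>r<d ^ N. U $$ (\<tau> i, r) * G $$ (r, j))"
      using Uc Gc ij \<tau>l by (simp add: scalar_prod_def atLeast0LessThan)
    also have "\<dots> = (\<Sum>r<d ^ N. if r = i then G $$ (i, j) else 0)"
      using inj ij \<tau>l by (intro sum.cong refl) (auto simp: Ui inj_on_def)
    also have "\<dots> = G $$ (i, j)" using ij by simp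
    finally have 1: "(U * G) $$ (\<tau> i, j) = G $$ (i, j)" .
    have "(G * U) $$ (\<tau> i, j) = (\<Sum>r<d ^ N. G $$ (\<tau> i, r) * U $$ (r, j))"
      using Uc Gc ij \<tau>l by (simp add: scalar_prod_def atLeast0LessThan)
    also have "\<dots> = (\<Sum>r<d ^ N. if r = \<tau> j then G $$ (\<tau> i, \<tau> j) else 0)"
      using ij by (intro sum.cong refl) (auto simp: Ui)
    also have "\<dots> = G $$ (\<tau> i, \<tau> j)" using \<tau>l by simp
    finally show ?thesis using 1 comm by simp
  qed
  have T: "tprod (\<lambda>m. X (\<sigma> m)) N $$ (\<tau> i, \<tau> j) = tprod X N $$ (i, j)" if ij: "i < d ^ N" "j < d ^ N" for i j
  proof -
    have "tprod (\<lambda>m. X (\<sigma> m)) N $$ (\<tau> i, \<tau> j) = (\<Prod>m<N. X (\<sigma> m) $$ (digit d N i (\<sigma> m), digit d N j (\<sigma> m)))"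
      using X \<tau>l by (subst tprod_index[of _ _ d]) (auto simp: \<tau>d)
    also have "\<dots> = (\<Prod>m<N. X m $$ (digit d N i m, digit d N j m))"
      using prod.permute[OF \<sigma>, of "\<lambda>m. X m $$ (digit d N i m, digit d N j m)"] by (simp add: o_def)
    finally show ?thesis using X ij by (simp add: tprod_index[of _ _ d])
  qed
  show "trp (d ^ N) (tprod (\<lambda>m. X (\<sigma> m)) N) G = trp (d ^ N) (tprod X N) G"
  proof -
    have r: "(\<Sum>i<d ^ N. F i) = (\<Sum>i<d ^ N. F (\<tau> i))" for F :: "nat \<Rightarrow> complex"
      by (rule sum.reindex_bij_betw[OF bij, symmetric])
    have "trp (d ^ N) (tprod (\<lambda>m. X (\<sigma> m)) N) G =
      (\<Sum>i<d ^ N. \<Sum>j<d ^ N. tprod (\<lambda>m. X (\<sigma> m)) N $$ (\<tau> i, j) * G $$ (j, \<tau> i))"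
      unfolding trp_def by (rule r)
    also have "\<dots> = (\<Sum>i<d ^ N. \<Sum>j<d ^ N. tprod (\<lambda>m. X (\<sigma> m)) N $$ (\<tau> i, \<tau> j) * G $$ (\<tau> j, \<tau> i))"
      by (intro sum.cong refl r)
    also have "\<dots> = trp (d ^ N) (tprod X N) G"
      unfolding trp_def by (intro sum.cong refl) (simp add: T inv)
    finally show ?thesis .
  qed
qed

text \<open>A permutation of the n remaining particles, extended by the identity, fixes the
  positions of the measured ones and hence their operators Y, whatever these are.\<close>

lemma sym_op_red:
  assumes G: "sym_op d (n + b) G" and Y: "\<And>m. Y m \<in> carrier_mat d d"
  shows "sym_op d n (red (d ^ n) (d ^ b) (tprod Y b) G)"
  unfolding sym_op_def
proof (intro allI impI)
  fix X :: "nat \<Rightarrow> complex mat" and \<sigma> assume X: "\<forall>m. X m \<in> carrier_mat d d" and \<sigma>: "\<sigma> permutes {..<n}"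
  define Z where "Z m = (if m < n then X m else Y (m - n))" for m
  have \<sigma>': "\<sigma> permutes {..<n + b}" by (rule permutes_subset[OF \<sigma>]) auto
  have \<sigma>n: "\<sigma> m < n \<longleftrightarrow> m < n" for m using permutes_in_image[OF \<sigma>, of m] by simp
  have \<sigma>out: "\<sigma> m = m" if "\<not> m < n" for m using permutes_not_in[OF \<sigma>] that by simp
  have e: "trp (d ^ n) (tprod X n) (red (d ^ n) (d ^ b) (tprod Y b) G) = trp (d ^ (n + b)) (tprod (\<lambda>m. if m < n then X m else Y (m - n)) (n + b)) G"
    if "\<forall>m. X m \<in> carrier_mat d d" for X
    using that Y by (subst trp_red[OF tprod_carrier tprod_carrier]) (auto simp: tprod_append[of n X d b Y] power_add)
  have "(\<lambda>m. if m < n then X (\<sigma> m) else Y (m - n)) = (\<lambda>m. Z (\<sigma> m))"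
    by (auto simp: Z_def \<sigma>n \<sigma>out fun_eq_iff)
  then have "trp (d ^ n) (tprod (\<lambda>m. X (\<sigma> m)) n) (red (d ^ n) (d ^ b) (tprod Y b) G) = trp (d ^ (n + b)) (tprod (\<lambda>m. Z (\<sigma> m)) (n + b)) G"
    using X by (simp add: e)
  also have "\<dots> = trp (d ^ (n + b)) (tprod Z (n + b)) G"
  proof (rule G[unfolded sym_op_def, rule_format, OF _ \<sigma>'])
    show "Z m \<in> carrier_mat d d" for m using X Y by (simp add: Z_def)
  qed
  also have "\<dots> = trp (d ^ n) (tprod X n) (red (d ^ n) (d ^ b) (tprod Y b) G)"
    using X by (simp add: e Z_def[abs_def])
  finally show "trp (d ^ n) (tprod (\<lambda>m. X (\<sigma> m)) n) (red (d ^ n) (d ^ b) (tprod Y b) G) =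
      trp (d ^ n) (tprod X n) (red (d ^ n) (d ^ b) (tprod Y b) G)" .
qed

section \<open>The conditioning measurement\<close>

text \<open>The Holevo quantity: the information about the first \<open>a\<close> particles gained by measuring the next one with \<open>L\<close>.\<close>
definition chi :: "nat \<Rightarrow> nat \<Rightarrow> complex mat \<Rightarrow> (nat \<Rightarrow> complex mat) \<Rightarrow> real" where
  "chi d a R L = ent (d ^ a) (red (d ^ a) d (1\<^sub>m d) R) - (\<Sum>x<d. ent (d ^ a) (red (d ^ a) d (L x) R))"

lemma red_zero_left: "red n1 n2 (0\<^sub>m n2 n2) G = 0\<^sub>m n1 n1"
  by (rule eq_matI) (auto simp: red_def)

lemma red_zero_right:
  assumes "G = 0\<^sub>m (n1 * n2) (n1 * n2)"
  shows "red n1 n2 M G = 0\<^sub>m n1 n1"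
  unfolding assms by (rule eq_matI) (auto simp: red_def mult_add_less intro!: sum.neutral)

lemma ent_zero: "ent n (0\<^sub>m n n) = 0"
proof -
  have "rtrace n (0\<^sub>m n n) = 0" by (simp add: rtrace_def)
  then show ?thesis using ent_bounds[OF psd_zero[of n]] by simp
qed

lemma chi_zero: "chi d a (0\<^sub>m (d ^ Suc a) (d ^ Suc a)) L = 0"
  unfolding chi_def by (simp add: red_zero_right ent_zero mult.commute)

lemma sym_op_zero: "sym_op d N (0\<^sub>m (d ^ N) (d ^ N))"
  unfolding sym_op_def trp_def by simp

lemma ktensor_tprod_single:
  assumes "\<And>m. X m \<in> carrier_mat d d" "L \<in> carrier_mat d d"
  shows "ktensor (tprod X a) L = tprod (X(a := L)) (Suc a)"
proof -
  have "tprod (X(a := L)) a = tprod X a" by (rule tprod_cong) simp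
  then show ?thesis by simp
qed

text \<open>Links \<open>chi\<close>, which measures the particle right after the first a, with the
  protocol, which measures the last one. After moving everything into one trace, the two sides carry
  L at position a and at the last position, and a transposition exchanges these.\<close>

lemma red_swap:
  assumes d: "0 < d" and G: "sym_op d (Suc (Suc a + m)) G" and L: "L \<in> carrier_mat d d"
  shows "red (d ^ a) d L (red (d ^ Suc a) (d ^ Suc m) (1\<^sub>m (d ^ Suc m)) G)
    = red (d ^ a) (d ^ Suc m) (1\<^sub>m (d ^ Suc m)) (red (d ^ (Suc a + m)) d L G)"
proof (rule mat_eq_of_trp_tprod[OF red_carrier red_carrier d])
  fix X :: "nat \<Rightarrow> complex mat" assume X: "\<And>m. X m \<in> carrier_mat d d"
  define N where "N = Suc a + m"
  define I where "I = (\<lambda>_::nat. 1\<^sub>m d :: complex mat)"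
  have I: "I i \<in> carrier_mat d d" for i by (simp add: I_def)
  have one: "1\<^sub>m (d ^ i) = tprod I i" for i by (simp add: I_def tprod_one)
  have XL: "(X(a := L)) i \<in> carrier_mat d d" for i using X L by simp
  define Z where "Z i = (if i < a then X i else if i = a then L else 1\<^sub>m d)" for i
  define Z' where "Z' i = (if i < a then X i else if i < N then 1\<^sub>m d else L)" for i
  have Z: "Z i \<in> carrier_mat d d" for i using X L by (simp add: Z_def)
  have p: "d ^ a * d = d ^ Suc a" "d ^ Suc a * d ^ Suc m = d ^ Suc N" "d ^ N * d = d ^ Suc N" "d ^ a * d ^ Suc m = d ^ N"
    by (simp_all add: N_def power_add)
  have 1: "trp (d ^ a) (tprod X a) (red (d ^ a) d L (red (d ^ Suc a) (d ^ Suc m) (1\<^sub>m (d ^ Suc m)) G))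
    = trp (d ^ Suc N) (tprod Z (Suc N)) G"
  proof -
    have "trp (d ^ a) (tprod X a) (red (d ^ a) d L (red (d ^ Suc a) (d ^ Suc m) (1\<^sub>m (d ^ Suc m)) G))
      = trp (d ^ Suc a) (tprod (X(a := L)) (Suc a)) (red (d ^ Suc a) (d ^ Suc m) (1\<^sub>m (d ^ Suc m)) G)"
      unfolding trp_red[OF tprod_carrier[OF X] L] p ktensor_tprod_single[OF X L] ..
    also have "\<dots> = trp (d ^ Suc N) (ktensor (tprod (X(a := L)) (Suc a)) (tprod I (Suc m))) G"
      unfolding trp_red[OF tprod_carrier[OF XL] one_carrier_mat] p unfolding one ..
    also have "ktensor (tprod (X(a := L)) (Suc a)) (tprod I (Suc m)) = 
       tprod (\<lambda>i. if i < Suc a then (X(a := L)) i else I (i - Suc a)) (Suc a + Suc m)"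
      by (rule tprod_append[OF XL I])
    also have "(\<lambda>i. if i < Suc a then (X(a := L)) i else I (i - Suc a)) = Z"
      by (auto simp: Z_def I_def fun_eq_iff)
    finally show ?thesis by (simp add: N_def)
  qed
  have 2: "trp (d ^ a) (tprod X a) (red (d ^ a) (d ^ Suc m) (1\<^sub>m (d ^ Suc m)) (red (d ^ N) d L G))
    = trp (d ^ Suc N) (tprod Z' (Suc N)) G"
  proof -
    have e: "ktensor (tprod X a) (tprod I (Suc m)) = tprod (\<lambda>i. if i < a then X i else I (i - a)) N"
      using tprod_append[of a X d "Suc m" I, OF X I] by (simp add: N_def)
    have c: "(if i < a then X i else I (i - a)) \<in> carrier_mat d d" for i using X I by simp
    have "trp (d ^ a) (tprod X a) (red (d ^ a) (d ^ Suc m) (1\<^sub>m (d ^ Suc m)) (red (d ^ N) d L G))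
      = trp (d ^ N) (tprod (\<lambda>i. if i < a then X i else I (i - a)) N) (red (d ^ N) d L G)"
      unfolding trp_red[OF tprod_carrier[OF X] one_carrier_mat] p unfolding one e ..
    also have "\<dots> = trp (d ^ Suc N) (tprod ((\<lambda>i. if i < a then X i else I (i - a))(N := L)) (Suc N)) G"
      unfolding trp_red[OF tprod_carrier[OF c] L] p ktensor_tprod_single[OF c L] ..
    also have "tprod ((\<lambda>i. if i < a then X i else I (i - a))(N := L)) (Suc N) = tprod Z' (Suc N)"
      by (rule tprod_cong) (auto simp: Z'_def I_def N_def)
    finally show ?thesis .
  qed
  have "trp (d ^ Suc N) (tprod (\<lambda>i. Z (Transposition.transpose a N i)) (Suc N)) G = trp (d ^ Suc N) (tprod Z (Suc N)) G"
    by (rule G[unfolded sym_op_def N_def[symmetric], rule_format, OF Z])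
      (auto simp: N_def intro!: permutes_swap_id)
  also have "tprod (\<lambda>i. Z (Transposition.transpose a N i)) (Suc N) = tprod Z' (Suc N)"
    by (rule tprod_cong) (auto simp: Z_def Z'_def N_def Transposition.transpose_def)
  finally show "trp (d ^ a) (tprod X a) (red (d ^ a) d L (red (d ^ Suc a) (d ^ Suc m) (1\<^sub>m (d ^ Suc m)) G)) =
    trp (d ^ a) (tprod X a) (red (d ^ a) (d ^ Suc m) (1\<^sub>m (d ^ Suc m)) (red (d ^ (Suc a + m)) d L G))"
    using 1 2 by (simp add: N_def)
qed

text \<open>The invariant of the induction. \<open>g j\<close> bounds the unnormalised
  \<open>chi\<close> for all one-particle measurements at once, which keeps M independent of them,
  and the last clause is the budget for all outcomes together. Nonnegativity of g later allows a sum
  over the outcomes of positive probability to be extended to all.\<close>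

definition good_measurement ::
  "nat \<Rightarrow> nat \<Rightarrow> nat \<Rightarrow> complex mat \<Rightarrow> (nat \<Rightarrow> complex mat) \<Rightarrow> (nat \<Rightarrow> real) \<Rightarrow> bool" where
  "good_measurement d a m G M g \<longleftrightarrow> povm (d ^ m) {..<d ^ m} M \<and>
     (\<forall>j<d ^ m. 0 \<le> g j \<and> sym_op d (Suc a) (red (d ^ Suc a) (d ^ m) (M j) G) \<and>
        (\<forall>L. povm d {..<d} L \<longrightarrow> chi d a (red (d ^ Suc a) (d ^ m) (M j) G) L \<le> g j)) \<and>
     real (Suc m) * (\<Sum>j<d ^ m. g j) \<le> ent (d ^ a) (red (d ^ a) (d ^ Suc m) (1\<^sub>m (d ^ Suc m)) G)"

text \<open>Stopping: outcome 0 is certain and carries the whole budget, and the other d^m - 1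
  outcomes are zero operators, whose conditional operators vanish and have \<open>chi\<close> equal
  to 0.\<close>

lemma good_measurement_trivial:
  assumes d: "0 < d" and Gp: "psd (d ^ (Suc a + m)) G" and Gs: "sym_op d (Suc a + m) G"
    and le: "\<And>L. povm d {..<d} L \<Longrightarrow> chi d a (red (d ^ Suc a) (d ^ m) (1\<^sub>m (d ^ m)) G) L \<le>
       ent (d ^ a) (red (d ^ a) (d ^ Suc m) (1\<^sub>m (d ^ Suc m)) G) / real (Suc m)"
  shows "\<exists>M g. good_measurement d a m G M g"
proof -
  define M where "M j = (if j = (0::nat) then 1\<^sub>m (d ^ m) else 0\<^sub>m (d ^ m) (d ^ m) :: complex mat)" for j
  define s where "s = ent (d ^ a) (red (d ^ a) (d ^ Suc m) (1\<^sub>m (d ^ Suc m)) G) / real (Suc m)"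
  define g where "g j = (if j = (0::nat) then s else 0)" for j
  have "psd (d ^ a * d ^ Suc m) G" using Gp by (simp add: power_add mult_ac)
  then have s0: "0 \<le> s" unfolding s_def by (intro divide_nonneg_nonneg ent_bounds(1) psd_red psd_one) auto
  have Msum: "(\<Sum>j<d ^ m. M j $$ (i, l)) = (if i = l then 1 else 0)" if "i < d ^ m" "l < d ^ m" for i l
  proof -
    have "(\<Sum>j<d ^ m. M j $$ (i, l)) = (\<Sum>j<d ^ m. if j = 0 then if i = l then 1 else 0 else 0)"
      using that by (intro sum.cong refl) (auto simp: M_def)
    then show ?thesis using d by simp
  qed
  have "povm (d ^ m) {..<d ^ m} M"
    unfolding povm_def using Msum by (auto simp: M_def psd_one psd_zero)
  moreover have "0 \<le> g j \<and> sym_op d (Suc a) (red (d ^ Suc a) (d ^ m) (M j) G) \<and>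
        (\<forall>L. povm d {..<d} L \<longrightarrow> chi d a (red (d ^ Suc a) (d ^ m) (M j) G) L \<le> g j)" for j
  proof (cases "j = 0")
    case True
    have "sym_op d (Suc a) (red (d ^ Suc a) (d ^ m) (tprod (\<lambda>_. 1\<^sub>m d) m) G)"
      by (rule sym_op_red[OF Gs]) simp
    then show ?thesis using True s0 le by (simp add: M_def g_def s_def tprod_one)
  next
    case False
    then show ?thesis using chi_zero[of d a] sym_op_zero[of d "Suc a"]
      by (simp add: M_def g_def red_zero_left)
  qed
  moreover have "real (Suc m) * (\<Sum>j<d ^ m. g j) \<le> ent (d ^ a) (red (d ^ a) (d ^ Suc m) (1\<^sub>m (d ^ Suc m)) G)"
    using d by (simp add: g_def s_def)
  ultimately show ?thesis unfolding good_measurement_def by blast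
qed

lemma red_marginal:
  "red (d ^ a) d (1\<^sub>m d) (red (d ^ Suc a) (d ^ m) (1\<^sub>m (d ^ m)) G) = red (d ^ a) (d ^ Suc m) (1\<^sub>m (d ^ Suc m)) G"
  using red_red[of "1\<^sub>m d" d "1\<^sub>m (d ^ m)" "d ^ m" "d ^ a" G]
  by (simp add: ktensor_one_one mult.commute[of _ d])

text \<open>Either no measurement of one more particle extracts more than the average information
  \<open>ent / (m + 1)\<close> about the first \<open>a\<close> particles, and nothing needs to be measured; or measuring the last
  particle lowers the expected entropy by more than this average, and one continues with each
  of the post-measurement states.\<close>
lemma good_measurement_exists:
  assumes d: "0 < d" and "psd (d ^ (Suc a + m)) G" and "sym_op d (Suc a + m) G"
  shows "\<exists>M g. good_measurement d a m G M g"
  using assms(2,3)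
proof (induction m arbitrary: G)
  case 0
  show ?case
  proof (rule good_measurement_trivial[OF d 0])
    \<comment> \<open>For m = 0 the average is the full entropy, which \<open>chi\<close> cannot
      exceed because the entropies after the measurement are nonnegative.\<close>
    fix L assume L: "povm d {..<d} L"
    let ?R = "red (d ^ Suc a) (d ^ 0) (1\<^sub>m (d ^ 0)) G"
    have "psd (d ^ Suc a) ?R" using 0(1) by (intro psd_red psd_one) simp
    then have "0 \<le> ent (d ^ a) (red (d ^ a) d (L x) ?R)" if "x < d" for x
      using L that unfolding povm_def by (intro ent_bounds(1) psd_red) (auto simp: mult.commute)
    then have "0 \<le> (\<Sum>x<d. ent (d ^ a) (red (d ^ a) d (L x) ?R))" by (intro sum_nonneg) auto
    then show "chi d a ?R L \<le> ent (d ^ a) (red (d ^ a) (d ^ Suc 0) (1\<^sub>m (d ^ Suc 0)) G) / real (Suc 0)"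
      unfolding chi_def red_marginal by simp
  qed
next
  case (Suc m)
  define N where "N = Suc a + m"
  define s where "s = ent (d ^ a) (red (d ^ a) (d ^ Suc (Suc m)) (1\<^sub>m (d ^ Suc (Suc m))) G)"
  let ?R = "red (d ^ Suc a) (d ^ Suc m) (1\<^sub>m (d ^ Suc m)) G"
  have Gp: "psd (d ^ N * d) G" and Gs: "sym_op d (Suc (Suc a + m)) G"
    using Suc.prems by (simp_all add: N_def mult.commute)
  show ?case
  proof (cases "\<forall>L. povm d {..<d} L \<longrightarrow> chi d a ?R L \<le> s / real (Suc (Suc m))")
    case True
    then show ?thesis using Suc.prems by (intro good_measurement_trivial[OF d]) (auto simp: s_def)
  next
    case False
    then obtain L where L: "povm d {..<d} L" and big: "s / real (Suc (Suc m)) < chi d a ?R L" by auto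
    have Lp: "psd d (L x)" if "x < d" for x using L that unfolding povm_def by auto
    have Lc: "L x \<in> carrier_mat d d" if "x < d" for x using psdD(1)[OF Lp[OF that]] .
    define \<Gamma> where "\<Gamma> x = red (d ^ N) d (L x) G" for x
    define t where "t x = ent (d ^ a) (red (d ^ a) (d ^ Suc m) (1\<^sub>m (d ^ Suc m)) (\<Gamma> x))" for x
    have "\<exists>M g. good_measurement d a m (\<Gamma> x) M g" if x: "x < d" for x
    proof (rule Suc.IH)
      show "psd (d ^ (Suc a + m)) (\<Gamma> x)" unfolding \<Gamma>_def N_def[symmetric] by (rule psd_red[OF Lp[OF x] Gp])
      have "sym_op d N (red (d ^ N) (d ^ 1) (tprod (\<lambda>_. L x) 1) G)"
        using Gs Lc[OF x] by (intro sym_op_red) (simp_all add: N_def)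
      then show "sym_op d (Suc a + m) (\<Gamma> x)"
        using Lc[OF x] by (simp add: \<Gamma>_def N_def ktensor_one_left[unfolded One_nat_def])
    qed
    then obtain M g where Mg: "\<And>x. x < d \<Longrightarrow> good_measurement d a m (\<Gamma> x) (M x) (g x)" by metis
    have Mp: "povm (d ^ m) {..<d ^ m} (M x)" if "x < d" for x using Mg[OF that] unfolding good_measurement_def by blast
    \<comment> \<open>The digit J mod d is the outcome of the last particle, which is measured
      first; J div d is the outcome of the measurement that the induction hypothesis provides for
      that result.\<close>
    define M' where "M' J = ktensor (M (J mod d) (J div d)) (L (J mod d))" for J
    define g' where "g' J = g (J mod d) (J div d)" for J
    have J: "J mod d < d" "J div d < d ^ m" if "J < d ^ Suc m" for J
      using that d by (simp_all add: less_mult_imp_div_less mult.commute)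
    have Mpsd: "psd (d ^ m) (M x j)" if "x < d" "j < d ^ m" for x j using Mp[OF that(1)] that(2) unfolding povm_def by auto
    have M'p: "povm (d ^ Suc m) {..<d ^ Suc m} M'"
      unfolding povm_def
    proof (intro conjI ballI allI impI)
      fix J assume "J \<in> {..<d ^ Suc m}"
      then have "psd (d ^ m * d) (M' J)" unfolding M'_def using J by (intro psd_ktensor Mpsd Lp) auto
      then show "psd (d ^ Suc m) (M' J)" by (simp add: mult.commute)
    next
      fix i j assume ij: "i < d ^ Suc m" "j < d ^ Suc m"
      then have ij': "i < d ^ m * d" "j < d ^ m * d" by (simp_all add: mult.commute)
      have "(\<Sum>J<d ^ Suc m. M' J $$ (i, j)) = (\<Sum>J<d ^ m * d. M' J $$ (i, j))" by (simp add: mult.commute)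
      also have "\<dots> = (\<Sum>y<d ^ m. \<Sum>x<d. M x y $$ (i div d, j div d) * L x $$ (i mod d, j mod d))"
        unfolding sum_lessThan_mult
      proof (intro sum.cong refl)
        fix y x assume "y \<in> {..<d ^ m}" "x \<in> {..<d}"
        then show "M' (y * d + x) $$ (i, j) = M x y $$ (i div d, j div d) * L x $$ (i mod d, j mod d)"
          using ktensor_index[OF psdD(1)[OF Mpsd] Lc ij'] by (simp add: M'_def)
      qed
      also have "\<dots> = (\<Sum>x<d. (\<Sum>y<d ^ m. M x y $$ (i div d, j div d)) * L x $$ (i mod d, j mod d))"
        by (subst sum.swap) (simp add: sum_distrib_right)
      also have "\<dots> = (\<Sum>x<d. (if i div d = j div d then 1 else 0) * L x $$ (i mod d, j mod d))"
        using Mp J(2)[OF ij(1)] J(2)[OF ij(2)] unfolding povm_def by (intro sum.cong refl) auto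
      also have "\<dots> = (if i div d = j div d then 1 else 0) * (if i mod d = j mod d then 1 else 0)"
        using L J(1)[OF ij(1)] J(1)[OF ij(2)] unfolding povm_def by (simp add: sum_distrib_left[symmetric])
      also have "\<dots> = (if i = j then 1 else 0)"
      proof -
        have "i = j \<longleftrightarrow> i div d = j div d \<and> i mod d = j mod d" by (metis div_mult_mod_eq)
        then show ?thesis by auto
      qed
      finally show "(\<Sum>J<d ^ Suc m. M' J $$ (i, j)) = (if i = j then 1 else 0)" .
    qed simp
    have redM': "red (d ^ Suc a) (d ^ Suc m) (M' J) G = red (d ^ Suc a) (d ^ m) (M (J mod d) (J div d)) (\<Gamma> (J mod d))"
      if "J < d ^ Suc m" for J
    proof -
      have "red (d ^ Suc a) (d ^ m) (M (J mod d) (J div d)) (red (d ^ Suc a * d ^ m) d (L (J mod d)) G)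
        = red (d ^ Suc a) (d ^ m * d) (M' J) G"
        unfolding M'_def using J[OF that] by (intro red_red psdD(1)[OF Mpsd] Lc)
      then show ?thesis by (simp add: \<Gamma>_def N_def power_add mult_ac)
    qed
    have conds: "0 \<le> g' J \<and> sym_op d (Suc a) (red (d ^ Suc a) (d ^ Suc m) (M' J) G) \<and>
        (\<forall>L. povm d {..<d} L \<longrightarrow> chi d a (red (d ^ Suc a) (d ^ Suc m) (M' J) G) L \<le> g' J)" if "J < d ^ Suc m" for J
      unfolding redM'[OF that] g'_def
      using Mg[OF J(1)[OF that]] J(2)[OF that] unfolding good_measurement_def by blast
    \<comment> \<open>The information extracted equals the drop of the expected entropy of the first
      a particles; \<open>red_swap\<close> identifies measuring particle a with measuring the last
      one.\<close>
    have chiL: "chi d a ?R L = s - (\<Sum>x<d. t x)"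
    proof -
      have "red (d ^ a) d (L x) ?R = red (d ^ a) (d ^ Suc m) (1\<^sub>m (d ^ Suc m)) (\<Gamma> x)" if "x < d" for x
        unfolding \<Gamma>_def N_def by (rule red_swap[OF d Gs Lc[OF that]])
      then show ?thesis
        unfolding chi_def red_marginal s_def[symmetric] t_def by simp
    qed
    have "real (Suc m) * (\<Sum>J<d ^ Suc m. g' J) = real (Suc m) * (\<Sum>J<d ^ m * d. g' J)" by (simp add: mult.commute)
    also have "\<dots> = real (Suc m) * (\<Sum>y<d ^ m. \<Sum>x<d. g x y)"
      unfolding sum_lessThan_mult by (simp add: g'_def)
    also have "\<dots> = (\<Sum>x<d. real (Suc m) * (\<Sum>y<d ^ m. g x y))"
      by (subst sum.swap) (simp add: sum_distrib_left)
    also have "\<dots> \<le> (\<Sum>x<d. t x)"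
      using Mg unfolding good_measurement_def t_def by (intro sum_mono) auto
    \<comment> \<open>What is left is at most s (m+1)/(m+2). The factor m+1 is the one in the
      budgets of the induction hypothesis and cancels, which leaves the budget for m+2.\<close>
    also have "\<dots> \<le> s - s / real (Suc (Suc m))" using big unfolding chiL by simp
    also have "\<dots> = s * (real (Suc m) / real (Suc (Suc m)))" by (simp add: field_simps)
    finally have "real (Suc m) * (\<Sum>J<d ^ Suc m. g' J) \<le> real (Suc m) * (s / real (Suc (Suc m)))" by (simp add: mult.commute)
    then have "(\<Sum>J<d ^ Suc m. g' J) \<le> s / real (Suc (Suc m))" by (subst (asm) mult_le_cancel_left_pos) auto
    then have "real (Suc (Suc m)) * (\<Sum>J<d ^ Suc m. g' J) \<le> s"
      by (subst (asm) pos_le_divide_eq) (auto simp: mult.commute)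
    then show ?thesis
      unfolding good_measurement_def using M'p conds unfolding s_def by blast
  qed
qed

section \<open>Relative entropy of product measurements\<close>

lemma spectral_ip_app:
  assumes "\<And>i j. i < n \<Longrightarrow> j < n \<Longrightarrow> A $$ (i, j) = (\<Sum>s<n. c s * (e s i * cnj (e s j)))"
  shows "ip n x (app n A y) = (\<Sum>s<n. c s * (ip n x (e s) * ip n (e s) y))"
proof -
  have "ip n x (app n A y) = (\<Sum>i<n. \<Sum>j<n. \<Sum>s<n. c s * ((cnj (x i) * e s i) * (cnj (e s j) * y j)))"
    unfolding ip_app by (intro sum.cong refl) (simp add: assms sum_distrib_left sum_distrib_right mult_ac)
  also have "\<dots> = (\<Sum>i<n. \<Sum>s<n. \<Sum>j<n. c s * ((cnj (x i) * e s i) * (cnj (e s j) * y j)))"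
    by (intro sum.cong refl sum.swap)
  also have "\<dots> = (\<Sum>s<n. \<Sum>i<n. \<Sum>j<n. c s * ((cnj (x i) * e s i) * (cnj (e s j) * y j)))"
    by (rule sum.swap)
  finally show ?thesis unfolding ip_def sum_product by (simp add: sum_distrib_left)
qed

lemma orthonormal_basis_ip:
  "orthonormal_basis n e \<Longrightarrow> s < n \<Longrightarrow> t < n \<Longrightarrow> ip n (e s) (e t) = (if s = t then 1 else 0)"
  unfolding orthonormal_basis_def ip_def by (auto simp: mult.commute)

lemma orthonormal_expansion:
  assumes "orthonormal_basis n e" "i < n"
  shows "x i = (\<Sum>s<n. e s i * ip n (e s) x)"
proof -
  have "ip n (\<lambda>j. if j = i then 1 else 0) y = y i" for y
  proof -
    have "ip n (\<lambda>j. if j = i then 1 else 0) y = (\<Sum>j<n. if j = i then y i else 0)"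
      unfolding ip_def by (intro sum.cong refl) auto
    then show ?thesis using assms(2) by simp
  qed
  then show ?thesis using ip_resolution[OF assms(1), of "\<lambda>j. if j = i then 1 else 0" x] by simp
qed

text \<open>This makes \<open>mat_log\<close> independent of the decomposition picked by its \<open>SOME\<close>.\<close>
lemma spectral_function_unique:
  assumes u: "orthonormal_basis n u" and e: "orthonormal_basis n e"
    and A1: "\<And>i j. i < n \<Longrightarrow> j < n \<Longrightarrow> A $$ (i, j) = (\<Sum>s<n. complex_of_real (a s) * (u s i * cnj (u s j)))"
    and A2: "\<And>i j. i < n \<Longrightarrow> j < n \<Longrightarrow> A $$ (i, j) = (\<Sum>s<n. complex_of_real (p s) * (e s i * cnj (e s j)))"
    and ij: "i < n" "j < n"
  shows "(\<Sum>s<n. complex_of_real (f (a s)) * (u s i * cnj (u s j))) = (\<Sum>s<n. complex_of_real (f (p s)) * (e s i * cnj (e s j)))"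
proof -
  define W where "W s t = ip n (u s) (e t)" for s t
  have ip_A1: "ip n x (app n A y) = (\<Sum>s<n. of_real (a s) * (ip n x (u s) * ip n (u s) y))" for x y
    by (rule spectral_ip_app) (rule A1)
  have ip_A2: "ip n x (app n A y) = (\<Sum>s<n. of_real (p s) * (ip n x (e s) * ip n (e s) y))" for x y
    by (rule spectral_ip_app) (rule A2)
  \<comment> \<open>Computing <u_s, A e_t> in both decompositions shows that the overlap vanishes
    unless the eigenvalues agree, so \<open>f (a s)\<close> may be exchanged for
    \<open>f (p t)\<close> in front of it.\<close>
  have "complex_of_real (a s) * W s t = of_real (p t) * W s t" if st: "s < n" "t < n" for s t
  proof -
    have "ip n (u s) (app n A (e t)) = (\<Sum>r<n. if r = s then of_real (a s) * W s t else 0)"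
      unfolding ip_A1 by (intro sum.cong refl) (use st in \<open>auto simp: orthonormal_basis_ip[OF u] W_def\<close>)
    moreover have "ip n (u s) (app n A (e t)) = (\<Sum>r<n. if r = t then of_real (p t) * W s t else 0)"
      unfolding ip_A2 by (intro sum.cong refl) (use st in \<open>auto simp: orthonormal_basis_ip[OF e] W_def\<close>)
    ultimately show ?thesis using st by auto
  qed
  then have W: "complex_of_real (f (a s)) * W s t = of_real (f (p t)) * W s t" if "s < n" "t < n" for s t
    using that by (metis mult_cancel_right of_real_eq_iff)
  have uj: "cnj (u s j) = (\<Sum>t<n. cnj (e t j) * W s t)" if "s < n" for s
    using orthonormal_expansion[OF e ij(2), of "u s"] unfolding W_def
    by (simp add: ip_commute[of n "u s" "e _"])
  have ei: "e t i = (\<Sum>s<n. u s i * W s t)" for t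
    unfolding W_def by (rule orthonormal_expansion[OF u ij(1)])
  have "(\<Sum>s<n. complex_of_real (f (a s)) * (u s i * cnj (u s j))) =
     (\<Sum>s<n. \<Sum>t<n. cnj (e t j) * u s i * (complex_of_real (f (a s)) * W s t))"
    by (intro sum.cong refl) (simp add: uj sum_distrib_left mult_ac)
  also have "\<dots> = (\<Sum>s<n. \<Sum>t<n. cnj (e t j) * u s i * (complex_of_real (f (p t)) * W s t))"
    by (intro sum.cong refl) (simp only: W lessThan_iff)
  also have "\<dots> = (\<Sum>t<n. \<Sum>s<n. cnj (e t j) * u s i * (complex_of_real (f (p t)) * W s t))"
    by (rule sum.swap)
  also have "\<dots> = (\<Sum>t<n. complex_of_real (f (p t)) * ((\<Sum>s<n. u s i * W s t) * cnj (e t j)))"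
    by (simp add: sum_distrib_left sum_distrib_right mult_ac)
  finally show ?thesis by (simp only: ei[symmetric])
qed

lemma unitary_diag_index:
  assumes U: "U \<in> carrier_mat n n" and ij: "i < n" "j < n"
  shows "(U * mat_diag n c * mat_adjoint U) $$ (i, j) = (\<Sum>s<n. c s * (U $$ (i, s) * cnj (U $$ (j, s))))"
proof -
  have "(U * mat_diag n c * mat_adjoint U) $$ (i, j) = (\<Sum>s<n. (U * mat_diag n c) $$ (i, s) * mat_adjoint U $$ (s, j))"
    using U ij mat_adjoint_carrier[OF U] by (simp add: scalar_prod_def atLeast0LessThan mat_diag_def)
  also have "\<dots> = (\<Sum>s<n. c s * (U $$ (i, s) * cnj (U $$ (j, s))))"
    using U ij by (intro sum.cong refl) (simp add: mat_diag_mult_right[OF U] mat_adjoint_index[OF U])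
  finally show ?thesis .
qed

text \<open>Existence of a decomposition makes the \<open>SOME\<close> meaningful, and uniqueness of
  spectral functions evaluates it in the given eigenbasis. Logarithms of two measured states can
  thus be computed in the one basis of the measurement.\<close>

lemma mat_log_spectral:
  assumes A: "A \<in> carrier_mat n n" and sp: "spectral n A p e"
  shows "mat_log A \<in> carrier_mat n n \<and>
    (\<forall>i<n. \<forall>j<n. mat_log A $$ (i, j) = (\<Sum>s<n. complex_of_real (ln (p s)) * (e s i * cnj (e s j))))"
proof -
  have e: "orthonormal_basis n e" using sp unfolding spectral_def by blast
  let ?P = "\<lambda>L. \<exists>U (ev :: nat \<Rightarrow> real).
      U \<in> carrier_mat (dim_row A) (dim_row A) \<and> U * mat_adjoint U = 1\<^sub>m (dim_row A) \<and>
      A = U * mat_diag (dim_row A) (\<lambda>i. complex_of_real (ev i)) * mat_adjoint U \<and>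
      L = U * mat_diag (dim_row A) (\<lambda>i. complex_of_real (ln (ev i))) * mat_adjoint U"
  have dA: "dim_row A = n" using A by simp
  have "\<exists>L. ?P L"
  proof -
    define U where "U = mat n n (\<lambda>(i, s). e s i)"
    have U: "U \<in> carrier_mat n n" by (simp add: U_def)
    have "U * mat_adjoint U = 1\<^sub>m n"
    proof (rule eq_matI)
      fix i j assume "i < dim_row (1\<^sub>m n :: complex mat)" "j < dim_col (1\<^sub>m n :: complex mat)"
      then have ij: "i < n" "j < n" by auto
      have "(U * mat_adjoint U) $$ (i, j) = (\<Sum>s<n. U $$ (i, s) * mat_adjoint U $$ (s, j))"
        using U ij mat_adjoint_carrier[OF U] by (simp add: scalar_prod_def atLeast0LessThan)
      also have "\<dots> = (\<Sum>s<n. e s i * cnj (e s j))"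
        using ij by (intro sum.cong refl) (simp add: mat_adjoint_index[OF U], simp add: U_def)
      finally show "(U * mat_adjoint U) $$ (i, j) = 1\<^sub>m n $$ (i, j)"
        using e ij unfolding orthonormal_basis_def by simp
    qed (use U mat_adjoint_carrier[OF U] in auto)
    moreover have "A = U * mat_diag n (\<lambda>i. complex_of_real (p i)) * mat_adjoint U"
    proof (rule eq_matI)
      fix i j assume "i < dim_row (U * mat_diag n (\<lambda>i. complex_of_real (p i)) * mat_adjoint U)"
        "j < dim_col (U * mat_diag n (\<lambda>i. complex_of_real (p i)) * mat_adjoint U)"
      then have ij: "i < n" "j < n" using U mat_adjoint_carrier[OF U] by auto
      show "A $$ (i, j) = (U * mat_diag n (\<lambda>i. complex_of_real (p i)) * mat_adjoint U) $$ (i, j)"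
        unfolding unitary_diag_index[OF U ij] using sp ij unfolding spectral_def by (simp add: U_def)
    qed (use A U mat_adjoint_carrier[OF U] in auto)
    ultimately show ?thesis unfolding dA using U by blast
  qed
  then have "?P (mat_log A)" unfolding mat_log_def by (rule someI_ex)
  then obtain U and ev :: "nat \<Rightarrow> real" where U: "U \<in> carrier_mat n n" "U * mat_adjoint U = 1\<^sub>m n"
    and AU: "A = U * mat_diag n (\<lambda>i. complex_of_real (ev i)) * mat_adjoint U"
    and LU: "mat_log A = U * mat_diag n (\<lambda>i. complex_of_real (ln (ev i))) * mat_adjoint U"
    unfolding dA by blast
  note Uc = mat_adjoint_carrier[OF U(1)]
  define u where "u s i = U $$ (i, s)" for s i
  have u: "orthonormal_basis n u"
  proof (rule orthonormal_basisI)
    fix s t assume st: "s < n" "t < n"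
    have "mat_adjoint U * U = 1\<^sub>m n" using mat_mult_left_right_inverse[OF U(1) Uc U(2)] .
    then have "(mat_adjoint U * U) $$ (t, s) = (if s = t then 1 else 0)" using st by simp
    moreover have "(mat_adjoint U * U) $$ (t, s) = (\<Sum>i<n. mat_adjoint U $$ (t, i) * U $$ (i, s))"
      using U Uc st by (simp add: scalar_prod_def atLeast0LessThan)
    ultimately show "(\<Sum>i<n. u s i * cnj (u t i)) = (if s = t then 1 else 0)"
      using st by (simp add: mat_adjoint_index[OF U(1)] u_def mult.commute)
  qed
  have A1: "A $$ (i, j) = (\<Sum>s<n. complex_of_real (ev s) * (u s i * cnj (u s j)))" if "i < n" "j < n" for i j
    using unitary_diag_index[OF U(1) that, of "\<lambda>i. complex_of_real (ev i)"] AU by (simp add: u_def)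
  have A2: "A $$ (i, j) = (\<Sum>s<n. complex_of_real (p s) * (e s i * cnj (e s j)))" if "i < n" "j < n" for i j
    using sp that unfolding spectral_def by blast
  have "mat_log A $$ (i, j) = (\<Sum>s<n. complex_of_real (ln (p s)) * (e s i * cnj (e s j)))" if ij: "i < n" "j < n" for i j
  proof -
    have "mat_log A $$ (i, j) = (\<Sum>s<n. complex_of_real (ln (ev s)) * (u s i * cnj (u s j)))"
      using unitary_diag_index[OF U(1) ij, of "\<lambda>i. complex_of_real (ln (ev i))"] LU by (simp add: u_def)
    then show ?thesis using spectral_function_unique[OF u e A1 A2 ij, where f = ln] by simp
  qed
  moreover have "mat_log A \<in> carrier_mat n n" unfolding LU using U Uc mat_diag_dim by (intro mult_carrier_mat) auto
  ultimately show ?thesis by blast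
qed

text \<open>For states diagonal in one basis everything reduces to eigenvalues and gives the
  Kullback-Leibler divergence. \<open>dom\<close> is what selects the finite branch of the
  definition.\<close>

lemma qrel_entropy_same_basis:
  assumes c: "\<rho> \<in> carrier_mat n n" "\<sigma> \<in> carrier_mat n n"
    and sp: "spectral n \<rho> p e" "spectral n \<sigma> q e"
    and dom: "\<And>s. s < n \<Longrightarrow> q s = 0 \<Longrightarrow> p s = 0"
  shows "qrel_entropy \<rho> \<sigma> = ereal (\<Sum>s<n. p s * (ln (p s) - ln (q s)))"
proof -
  have e: "orthonormal_basis n e" using sp(1) unfolding spectral_def by blast
  have rI: "\<rho> $$ (i, j) = (\<Sum>s<n. of_real (p s) * (e s i * cnj (e s j)))"
    and sI: "\<sigma> $$ (i, j) = (\<Sum>s<n. of_real (q s) * (e s i * cnj (e s j)))" if "i < n" "j < n" for i j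
    using sp that unfolding spectral_def by blast+
  have ip_rI: "ip n x (app n \<rho> y) = (\<Sum>s<n. of_real (p s) * (ip n x (e s) * ip n (e s) y))" for x y
    by (rule spectral_ip_app) (rule rI)
  have ip_sI: "ip n x (app n \<sigma> y) = (\<Sum>s<n. of_real (q s) * (ip n x (e s) * ip n (e s) y))" for x y
    by (rule spectral_ip_app) (rule sI)
  have ker: "\<rho> *\<^sub>v v = 0\<^sub>v n" if v: "v \<in> carrier_vec n" and 0: "\<sigma> *\<^sub>v v = 0\<^sub>v n" for v
  proof -
    define x where "x i = v $ i" for i
    have app: "(A *\<^sub>v v) $ i = app n A x i" if "A \<in> carrier_mat n n" "i < n" for A i
      using that v by (simp add: app_def x_def scalar_prod_def atLeast0LessThan)
    \<comment> \<open>\<sigma> v = 0 means q_s <e_s, v> = 0 for every s; where q_s vanishes, p_s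
      does too, and elsewhere the coefficient of v is 0.\<close>
    have pz: "p s * ip n (e s) x = 0" if s: "s < n" for s
    proof -
      have "ip n (e s) (app n \<sigma> x) = 0" unfolding ip_def using app[OF c(2)] 0 by (simp flip: app[OF c(2)])
      moreover have "ip n (e s) (app n \<sigma> x) = (\<Sum>t<n. if t = s then of_real (q s) * ip n (e s) x else 0)"
        unfolding ip_sI by (intro sum.cong refl) (use s in \<open>auto simp: orthonormal_basis_ip[OF e]\<close>)
      ultimately show ?thesis using s dom[OF s] by auto
    qed
    show ?thesis
    proof (rule eq_vecI)
      fix i assume "i < dim_vec (0\<^sub>v n :: complex vec)"
      then have i: "i < n" by simp
      have "app n \<rho> x i = (\<Sum>s<n. e s i * ip n (e s) (app n \<rho> x))" by (rule orthonormal_expansion[OF e i])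
      also have "\<dots> = 0"
      proof (intro sum.neutral ballI)
        fix s assume "s \<in> {..<n}"
        then have "ip n (e s) (app n \<rho> x) = (\<Sum>t<n. if t = s then of_real (p s) * ip n (e s) x else 0)"
          unfolding ip_rI by (intro sum.cong refl) (auto simp: orthonormal_basis_ip[OF e])
        then show "e s i * ip n (e s) (app n \<rho> x) = 0" using pz \<open>s \<in> {..<n}\<close> by simp
      qed
      finally show "(\<rho> *\<^sub>v v) $ i = 0\<^sub>v n $ i" using app[OF c(1) i] i by simp
    qed (use c in auto)
  qed
  define D where "D = mat_log \<rho> - mat_log \<sigma>"
  have Lr: "mat_log \<rho> \<in> carrier_mat n n" "mat_log \<sigma> \<in> carrier_mat n n"
    using mat_log_spectral[OF c(1) sp(1)] mat_log_spectral[OF c(2) sp(2)] by auto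
  have Dc: "D \<in> carrier_mat n n" unfolding D_def using Lr(2) by (rule minus_carrier_mat)
  have DI: "D $$ (i, j) = (\<Sum>s<n. of_real (ln (p s) - ln (q s)) * (e s i * cnj (e s j)))" if "i < n" "j < n" for i j
    using that carrier_matD[OF Lr(1)] carrier_matD[OF Lr(2)] mat_log_spectral[OF c(1) sp(1)] mat_log_spectral[OF c(2) sp(2)]
    by (simp add: D_def left_diff_distrib sum_subtractf)
  have ip_DI: "ip n x (app n D y) = (\<Sum>s<n. of_real (ln (p s) - ln (q s)) * (ip n x (e s) * ip n (e s) y))" for x y
    by (rule spectral_ip_app) (rule DI)
  have "mtrace (\<rho> * D) = (\<Sum>s<n. of_real (p s) * ip n (e s) (app n D (e s)))"
    unfolding mtrace_mult[OF c(1) Dc] trp_commute[of n \<rho>] by (rule trp_spectral[OF sp(1)])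
  also have "\<dots> = (\<Sum>s<n. of_real (p s * (ln (p s) - ln (q s))))"
  proof (intro sum.cong refl)
    fix s assume s: "s \<in> {..<n}"
    have "ip n (e s) (app n D (e s)) = (\<Sum>t<n. if t = s then of_real (ln (p s) - ln (q s)) else 0)"
      unfolding ip_DI by (intro sum.cong refl) (use s in \<open>auto simp: orthonormal_basis_ip[OF e]\<close>)
    then show "of_real (p s) * ip n (e s) (app n D (e s)) = complex_of_real (p s * (ln (p s) - ln (q s)))" using s by simp
  qed
  finally show ?thesis unfolding qrel_entropy_def D_def[symmetric] using ker c by auto
qed

section \<open>Tensor products of measurements and strings of outcomes\<close>

lemma meas_tensor_list_fst:
  "fst (meas_tensor_list d \<Lambda> k) J = tprod (\<lambda>m. fst (\<Lambda> m) (digit d k J m)) k"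
proof (induction k arbitrary: J)
  case (Suc k)
  have "tprod (\<lambda>m. fst (\<Lambda> m) (digit d (Suc k) J m)) k = tprod (\<lambda>m. fst (\<Lambda> m) (digit d k (J div d) m)) k"
    by (rule tprod_cong) (simp add: digit_Suc)
  then show ?case by (simp add: meas_tensor_def Suc digit_last)
qed simp

lemma vtensor_inner:
  assumes "v \<in> carrier_vec n" "v' \<in> carrier_vec n" "w \<in> carrier_vec m" "w' \<in> carrier_vec m"
  shows "vtensor v w \<bullet>c vtensor v' w' = (v \<bullet>c v') * (w \<bullet>c w')"
proof -
  have ix: "vtensor x y $ (a * m + b) = x $ a * y $ b"
    if "x \<in> carrier_vec n" "y \<in> carrier_vec m" "a < n" "b < m" for x y a b
    using that mult_add_less[OF that(3,4)] by (simp add: vtensor_def)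
  have "vtensor v w \<bullet>c vtensor v' w' = (\<Sum>i<n * m. vtensor v w $ i * cnj (vtensor v' w' $ i))"
    using assms by (simp add: scalar_prod_def vtensor_def atLeast0LessThan)
  also have "\<dots> = (\<Sum>a<n. \<Sum>b<m. (v $ a * cnj (v' $ a)) * (w $ b * cnj (w' $ b)))"
    unfolding sum_lessThan_mult using assms
    by (intro sum.cong refl) (simp add: ix mult_ac)
  also have "\<dots> = (v \<bullet>c v') * (w \<bullet>c w')"
    using assms by (simp add: scalar_prod_def sum_product atLeast0LessThan)
  finally show ?thesis .
qed

lemma meas_tensor_list_snd:
  assumes "\<And>i. i < k \<Longrightarrow> is_measurement d (\<Lambda> i)"
  shows "(\<forall>J<d ^ k. snd (meas_tensor_list d \<Lambda> k) J \<in> carrier_vec (d ^ k)) \<and>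
    (\<forall>J<d ^ k. \<forall>K<d ^ k. snd (meas_tensor_list d \<Lambda> k) J \<bullet>c snd (meas_tensor_list d \<Lambda> k) K = (if J = K then 1 else 0))"
  using assms
proof (induction k)
  case (Suc k)
  let ?e = "snd (meas_tensor_list d \<Lambda> k)"
  have IHc: "?e J \<in> carrier_vec (d ^ k)" if "J < d ^ k" for J using Suc that by simp
  have IHo: "?e J \<bullet>c ?e K = (if J = K then 1 else 0)" if "J < d ^ k" "K < d ^ k" for J K using Suc that by simp
  have Lc: "snd (\<Lambda> k) J \<in> carrier_vec d" if "J < d" for J
    using Suc.prems[of k] that unfolding is_measurement_def by simp
  have Lo: "snd (\<Lambda> k) J \<bullet>c snd (\<Lambda> k) K = (if J = K then 1 else 0)" if "J < d" "K < d" for J K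
    using Suc.prems[of k] that unfolding is_measurement_def by simp
  have J: "J mod d < d" "J div d < d ^ k" if "J < d ^ Suc k" for J
    using that mod_less_of_less_mult[of J "d ^ k" d] by (simp_all add: less_mult_imp_div_less mult.commute)
  have s: "snd (meas_tensor_list d \<Lambda> (Suc k)) J = vtensor (?e (J div d)) (snd (\<Lambda> k) (J mod d))" for J
    by (simp add: meas_tensor_def)
  show ?case unfolding s
  proof (intro conjI allI impI)
    fix J assume "J < d ^ Suc k"
    then show "vtensor (?e (J div d)) (snd (\<Lambda> k) (J mod d)) \<in> carrier_vec (d ^ Suc k)"
      using carrier_vecD[OF IHc[OF J(2)]] carrier_vecD[OF Lc[OF J(1)]]
      by (intro carrier_vecI) (simp add: vtensor_def mult.commute)
    fix K assume "K < d ^ Suc k"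
    show "vtensor (?e (J div d)) (snd (\<Lambda> k) (J mod d)) \<bullet>c vtensor (?e (K div d)) (snd (\<Lambda> k) (K mod d)) = (if J = K then 1 else 0)"
      using J[OF \<open>J < d ^ Suc k\<close>] J[OF \<open>K < d ^ Suc k\<close>]
      by (simp add: vtensor_inner[of _ "d ^ k" _ _ d] IHc Lc IHo Lo) (metis div_mult_mod_eq)
  qed
qed (auto simp: scalar_prod_def)

text \<open>The measured state comes with its spectral decomposition: outcome probabilities as
  eigenvalues, the measurement basis as eigenvectors, the latter independent of \<rho>.\<close>

lemma apply_meas_spectral:
  assumes e: "\<And>J. J < n \<Longrightarrow> snd E J \<in> carrier_vec n"
    and o: "\<And>J K. J < n \<Longrightarrow> K < n \<Longrightarrow> snd E J \<bullet>c snd E K = (if J = K then 1 else 0)"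
    and M: "\<And>J. J < n \<Longrightarrow> fst E J \<in> carrier_mat n n" and \<rho>: "\<rho> \<in> carrier_mat n n"
    and p: "\<And>J. J < n \<Longrightarrow> trp n (fst E J) \<rho> = complex_of_real (p J)" "\<And>J. J < n \<Longrightarrow> 0 \<le> p J"
  shows "spectral n (apply_meas n E \<rho>) p (\<lambda>s i. snd E s $ i)"
proof -
  have "orthonormal_basis n (\<lambda>s i. snd E s $ i)"
  proof (rule orthonormal_basisI)
    fix s t assume st: "s < n" "t < n"
    show "(\<Sum>i<n. snd E s $ i * cnj (snd E t $ i)) = (if s = t then 1 else 0)"
      using o[OF st] e[OF st(1)] e[OF st(2)] by (simp add: scalar_prod_def atLeast0LessThan)
  qed
  then show ?thesis unfolding spectral_def using M \<rho> p by (simp add: apply_meas_def mtrace_mult[of _ n])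
qed

lemma is_measurement_povm: "is_measurement d \<Lambda> \<Longrightarrow> povm d {..<d} (fst \<Lambda>)"
  unfolding is_measurement_def povm_def by auto

lemma psd_tprod: "(\<And>m. m < N \<Longrightarrow> psd d (X m)) \<Longrightarrow> psd (d ^ N) (tprod X N)"
proof (induction N)
  case (Suc N)
  then have "psd (d ^ N * d) (ktensor (tprod X N) (X N))" by (intro psd_ktensor) auto
  then show ?case by (simp add: mult.commute)
qed (use psd_one[of 1] in simp)

text \<open>Exhibits the linear dependence of a product on its factor i. Summing a POVM in that slot
  therefore replaces it by the identity.\<close>

lemma tprod_upd_index:
  assumes X: "\<And>m. X m \<in> carrier_mat d d" and A: "A \<in> carrier_mat d d" and i: "i < N" and rc: "r < d ^ N" "c < d ^ N"
  shows "tprod (X(i := A)) N $$ (r, c) = A $$ (digit d N r i, digit d N c i) *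
      (\<Prod>m\<in>{..<N} - {i}. X m $$ (digit d N r m, digit d N c m))"
proof -
  have "tprod (X(i := A)) N $$ (r, c) = (\<Prod>m<N. (X(i := A)) m $$ (digit d N r m, digit d N c m))"
    using X A rc by (intro tprod_index) auto
  also have "\<dots> = A $$ (digit d N r i, digit d N c i) *
      (\<Prod>m\<in>{..<N} - {i}. (X(i := A)) m $$ (digit d N r m, digit d N c m))"
    using i by (subst prod.remove[of _ i]) auto
  also have "(\<Prod>m\<in>{..<N} - {i}. (X(i := A)) m $$ (digit d N r m, digit d N c m)) =
      (\<Prod>m\<in>{..<N} - {i}. X m $$ (digit d N r m, digit d N c m))"
    by (intro prod.cong) auto
  finally show ?thesis .
qed

lemma tprod_povm_sum:
  assumes d: "0 < d" and X: "\<And>m. X m \<in> carrier_mat d d" and L: "povm d {..<d} L" and i: "i < N" and rc: "r < d ^ N" "c < d ^ N"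
  shows "(\<Sum>x<d. tprod (X(i := L x)) N $$ (r, c)) = tprod (X(i := 1\<^sub>m d)) N $$ (r, c)"
proof -
  have Lc: "L x \<in> carrier_mat d d" if "x < d" for x using L that psdD(1) unfolding povm_def by blast
  have "(\<Sum>x<d. tprod (X(i := L x)) N $$ (r, c)) = (\<Sum>x<d. L x $$ (digit d N r i, digit d N c i)) *
      (\<Prod>m\<in>{..<N} - {i}. X m $$ (digit d N r m, digit d N c m))"
    unfolding sum_distrib_right by (intro sum.cong refl) (use tprod_upd_index[OF X Lc i rc] in simp)
  also have "\<dots> = tprod (X(i := 1\<^sub>m d)) N $$ (r, c)"
    using L digit_less[OF d] unfolding povm_def tprod_upd_index[OF X one_carrier_mat i rc] by simp
  finally show ?thesis .
qed

lemma trp_tprod_povm_sum: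
  assumes d: "0 < d" and X: "\<And>m. X m \<in> carrier_mat d d" and L: "povm d {..<d} L" and i: "i < N"
  shows "(\<Sum>x<d. trp (d ^ N) (tprod (X(i := L x)) N) R) = trp (d ^ N) (tprod (X(i := 1\<^sub>m d)) N) R"
proof -
  have "(\<Sum>x<d. trp (d ^ N) (tprod (X(i := L x)) N) R) = (\<Sum>x<d. \<Sum>r<d ^ N. \<Sum>c<d ^ N. tprod (X(i := L x)) N $$ (r, c) * R $$ (c, r))"
    by (simp add: trp_def)
  also have "\<dots> = (\<Sum>r<d ^ N. \<Sum>x<d. \<Sum>c<d ^ N. tprod (X(i := L x)) N $$ (r, c) * R $$ (c, r))"
    by (rule sum.swap)
  also have "\<dots> = (\<Sum>r<d ^ N. \<Sum>c<d ^ N. \<Sum>x<d. tprod (X(i := L x)) N $$ (r, c) * R $$ (c, r))"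
    by (intro sum.cong refl sum.swap)
  also have "\<dots> = trp (d ^ N) (tprod (X(i := 1\<^sub>m d)) N) R"
    unfolding trp_def by (intro sum.cong refl) (use tprod_povm_sum[OF d X L i] in \<open>simp flip: sum_distrib_right\<close>)
  finally show ?thesis .
qed

text \<open>The operators measured when \<open>L 0, \<dots>, L (i - 1)\<close> are applied to the first \<open>i\<close> particles
  and give the outcome string \<open>J\<close>.\<close>
definition string_ops :: "nat \<Rightarrow> (nat \<Rightarrow> nat \<Rightarrow> complex mat) \<Rightarrow> nat \<Rightarrow> nat \<Rightarrow> nat \<Rightarrow> complex mat" where
  "string_ops d L i J m = (if m < i then L m (digit d i J m) else 1\<^sub>m d)"

lemma string_ops_Suc:
  assumes "x < d"
  shows "string_ops d L (Suc i) (J * d + x) = (string_ops d L i J)(i := L i x)"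
  using assms by (auto simp: string_ops_def fun_eq_iff digit_Suc digit_last less_Suc_eq)

lemma string_ops_upd: "(string_ops d L i J)(i := 1\<^sub>m d) = string_ops d L i J"
  by (auto simp: string_ops_def fun_eq_iff)

lemma string_ops_psd:
  assumes "0 < d" "\<And>m. m < i \<Longrightarrow> povm d {..<d} (L m)"
  shows "psd d (string_ops d L i J m)"
  using assms digit_less[OF assms(1)] unfolding povm_def by (auto simp: string_ops_def psd_one)

text \<open>Any F that turns the sum over a POVM in one slot into the identity there does so for all
  measured slots, the last digit being summed first. It is used for matrix entries, to obtain a
  POVM, and for expectations, to obtain marginals.\<close>

lemma sum_string_ops:
  assumes d: "0 < d" and L: "\<And>m. m < i \<Longrightarrow> povm d {..<d} (L m)"
    and add: "\<And>j X. j < i \<Longrightarrow> (\<And>m. X m \<in> carrier_mat d d) \<Longrightarrow>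
      (\<Sum>x<d. F (X(j := L j x))) = (F (X(j := 1\<^sub>m d)) :: 'a::comm_monoid_add)"
  shows "(\<Sum>J<d ^ i. F (string_ops d L i J)) = F (\<lambda>_. 1\<^sub>m d)"
  using L add
proof (induction i)
  case 0
  then show ?case by (simp add: string_ops_def[abs_def])
next
  case (Suc i)
  have c: "string_ops d L i J m \<in> carrier_mat d d" for J m
    using Suc.prems(1) by (intro psdD(1)[OF string_ops_psd[OF d]]) auto
  have "(\<Sum>J<d ^ Suc i. F (string_ops d L (Suc i) J)) = (\<Sum>J<d ^ i * d. F (string_ops d L (Suc i) J))"
    by (simp add: mult.commute)
  also have "\<dots> = (\<Sum>J<d ^ i. \<Sum>x<d. F ((string_ops d L i J)(i := L i x)))"
    unfolding sum_lessThan_mult by (intro sum.cong refl) (simp add: string_ops_Suc)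
  also have "\<dots> = (\<Sum>J<d ^ i. F (string_ops d L i J))"
  proof (intro sum.cong refl)
    fix J
    have "(\<Sum>x<d. F ((string_ops d L i J)(i := L i x))) = F ((string_ops d L i J)(i := 1\<^sub>m d))"
      by (rule Suc.prems(2)) (use c in auto)
    then show "(\<Sum>x<d. F ((string_ops d L i J)(i := L i x))) = F (string_ops d L i J)"
      by (simp only: string_ops_upd)
  qed
  also have "\<dots> = F (\<lambda>_. 1\<^sub>m d)" using Suc.prems by (intro Suc.IH) auto
  finally show ?case .
qed

lemma rtrace_trp: "rtrace n A = Re (trp n (1\<^sub>m n) A)"
proof -
  have "trp n (1\<^sub>m n) A = (\<Sum>i<n. \<Sum>j<n. if j = i then A $$ (i, i) else 0)"
    unfolding trp_def by (intro sum.cong refl) auto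
  then show ?thesis by (simp add: rtrace_def)
qed

text \<open>Reading only the first i of a particles is a measurement on all a of them. This lets a
  bound for the full block of a particles control every shorter string of outcomes.\<close>

lemma string_ops_povm:
  assumes d: "0 < d" and L: "\<And>m. m < i \<Longrightarrow> povm d {..<d} (L m)" and ia: "i \<le> a"
  shows "povm (d ^ a) {..<d ^ i} (\<lambda>J. tprod (string_ops d L i J) a)"
  unfolding povm_def
proof (intro conjI ballI allI impI)
  fix r c assume rc: "r < d ^ a" "c < d ^ a"
  have "(\<Sum>J<d ^ i. tprod (string_ops d L i J) a $$ (r, c)) = tprod (\<lambda>_. 1\<^sub>m d) a $$ (r, c)"
    by (rule sum_string_ops[OF d L, where F = "\<lambda>X. tprod X a $$ (r, c)"])
      (use ia L rc in \<open>auto intro!: tprod_povm_sum[OF d]\<close>)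
  then show "(\<Sum>J<d ^ i. tprod (string_ops d L i J) a $$ (r, c)) = (if r = c then 1 else 0)"
    using rc by (simp add: tprod_one)
qed (use string_ops_psd[OF d L] in \<open>auto intro: psd_tprod\<close>)

text \<open>The chain rule of total correlation: a is the weight of a string, b that of the string
  without its last outcome, c the marginal weight of that outcome, p the total mass, and q the
  product of the earlier normalised marginals.\<close>

lemma ln_split:
  fixes a b c p q :: real
  assumes "0 < a" "0 < b" "0 < c" "0 < p" "0 < q"
  shows "ln (a / p / (q * (c / p))) = ln (b / p / q) + ln (a * p / (c * b))"
proof -
  have "a / p / (q * (c / p)) = (b / p / q) * (a * p / (c * b))"
    using assms by (simp add: field_simps)
  moreover have "ln ((b / p / q) * (a * p / (c * b))) = ln (b / p / q) + ln (a * p / (c * b))"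
    by (intro ln_mult_pos) (use assms in auto)
  ultimately show ?thesis by simp
qed

text \<open>The total correlation of the outcomes is the sum of the mutual informations between each outcome and
  the string of the preceding ones; moving the particle measured last to position \<open>a\<close>, Holevo's bound
  estimates each of them by \<open>chi\<close>.\<close>
lemma total_correlation_le:
  assumes d: "0 < d" and Rp: "psd (d ^ Suc a) R" and Rs: "sym_op d (Suc a) R"
    and L: "\<And>m. m \<le> a \<Longrightarrow> povm d {..<d} (L m)"
    and g: "\<And>m. m \<le> a \<Longrightarrow> chi d a R (L m) \<le> g"
    and p: "p = rtrace (d ^ Suc a) R" and p0: "0 < p"
    and Q: "\<And>i J. Q i J = Re (trp (d ^ Suc a) (tprod (string_ops d L i J) (Suc a)) R)"
    and W: "\<And>m x. W m x = Re (trp (d ^ Suc a) (tprod ((\<lambda>_. 1\<^sub>m d)(m := L m x)) (Suc a)) R)"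
    and i: "i \<le> a"
  shows "(\<Sum>J<d ^ Suc i. Q (Suc i) J * ln (Q (Suc i) J / p / (\<Prod>m<Suc i. W m (digit d (Suc i) J m) / p))) \<le> real i * g
    \<and> (\<forall>J<d ^ Suc i. 0 < Q (Suc i) J \<longrightarrow> (\<forall>m<Suc i. 0 < W m (digit d (Suc i) J m)))"
proof -
  define \<phi> where "\<phi> X = Re (trp (d ^ Suc a) (tprod X (Suc a)) R)" for X
  have Q\<phi>: "Q i J = \<phi> (string_ops d L i J)" for i J by (simp only: Q \<phi>_def)
  have W\<phi>: "W m x = \<phi> ((\<lambda>_. 1\<^sub>m d)(m := L m x))" for m x by (simp only: W \<phi>_def)
  have Lp: "psd d (L m x)" if "m \<le> a" "x < d" for m x using L[OF that(1)] that(2) unfolding povm_def by auto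
  have so_psd: "psd d (string_ops d L i J m)" if "i \<le> Suc a" for i J m
    using that L by (intro string_ops_psd[OF d]) auto
  have so_c: "string_ops d L i J m \<in> carrier_mat d d" if "i \<le> Suc a" for i J m
    using psdD(1)[OF so_psd[OF that]] .
  have \<phi>0: "0 \<le> \<phi> X" if "\<And>m. psd d (X m)" for X
    unfolding \<phi>_def by (intro Re_trp_nonneg psd_tprod that Rp)
  have Q0: "0 \<le> Q i J" if "i \<le> Suc a" for i J unfolding Q\<phi> by (intro \<phi>0 so_psd that)
  have W0: "0 \<le> W m x" if "m \<le> a" "x < d" for m x
    unfolding W\<phi> using that by (intro \<phi>0) (auto simp: psd_one Lp)
  have \<phi>add: "(\<Sum>x<d. \<phi> (X(j := L j x))) = \<phi> (X(j := 1\<^sub>m d))" if "j \<le> a" "\<And>m. X m \<in> carrier_mat d d" for j X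
    unfolding \<phi>_def Re_sum[symmetric] using that by (subst trp_tprod_povm_sum[OF d]) (auto intro: L)
  have Qsum: "(\<Sum>x<d. Q (Suc i) (J * d + x)) = Q i J" if "i \<le> a" for i J
    using \<phi>add[of i "string_ops d L i J"] that so_c by (simp add: Q\<phi> string_ops_Suc string_ops_upd)
  have Wsum: "(\<Sum>J<d ^ i. Q (Suc i) (J * d + x)) = W i x" if ix: "i \<le> a" "x < d" for i x
  proof -
    have "(\<Sum>J<d ^ i. \<phi> ((string_ops d L i J)(i := L i x))) = \<phi> ((\<lambda>_. 1\<^sub>m d)(i := L i x))"
    proof (rule sum_string_ops[OF d, where F = "\<lambda>X. \<phi> (X(i := L i x))"])
      fix j and X :: "nat \<Rightarrow> complex mat" assume j: "j < i" "\<And>m. X m \<in> carrier_mat d d"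
      have "(\<Sum>y<d. \<phi> ((X(i := L i x))(j := L j y))) = \<phi> ((X(i := L i x))(j := 1\<^sub>m d))"
        using j ix psdD(1)[OF Lp[OF ix]] by (intro \<phi>add) auto
      then show "(\<Sum>y<d. \<phi> ((X(j := L j y))(i := L i x))) = \<phi> ((X(j := 1\<^sub>m d))(i := L i x))"
        using j by (simp add: fun_upd_twist)
    qed (use L ix in auto)
    then show ?thesis using ix by (simp add: Q\<phi> W\<phi> string_ops_Suc)
  qed
  have Qle: "Q (Suc i) (J * d + x) \<le> Q i J" if "i \<le> a" "x < d" for i J x
    unfolding Qsum[OF that(1), symmetric]
    by (rule member_le_sum[where f = "\<lambda>x. Q (Suc i) (J * d + x)"]) (use that Q0 in auto)
  have Wle: "Q (Suc i) (J * d + x) \<le> W i x" if "i \<le> a" "x < d" "J < d ^ i" for i J x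
    unfolding Wsum[OF that(1,2), symmetric]
    by (rule member_le_sum[where f = "\<lambda>J. Q (Suc i) (J * d + x)"]) (use that Q0 in auto)
  have mutual: "(\<Sum>x<d. \<Sum>J<d ^ i. Q (Suc i) (J * d + x) * ln (Q (Suc i) (J * d + x) * p / (W i x * Q i J))) \<le> g"
    if i: "i \<le> a" for i
  proof -
    define S where "S = red (d ^ a) d (1\<^sub>m d) R"
    define Rx where "Rx x = red (d ^ a) d (L i x) R" for x
    define M where "M J = tprod (string_ops d L i J) a" for J
    have Rp': "psd (d ^ a * d) R" using Rp by (simp add: mult.commute)
    have M: "povm (d ^ a) {..<d ^ i} M"
      unfolding M_def using L i by (intro string_ops_povm[OF d]) auto
    have joint: "Q (Suc i) (J * d + x) = Re (trp (d ^ a) (M J) (Rx x))" if x: "x < d" and J: "J < d ^ i" for x J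
    proof -
      let ?X = "string_ops d L i J"
      have c: "?X m \<in> carrier_mat d d" for m using i by (intro so_c) auto
      have Lc: "L i x \<in> carrier_mat d d" using psdD(1)[OF Lp[OF i x]] .
      have c': "(?X(i := L i x)) m \<in> carrier_mat d d" for m using c Lc by simp
      have "trp (d ^ a) (M J) (Rx x) = trp (d ^ a * d) (ktensor (tprod ?X a) (L i x)) R"
        unfolding M_def Rx_def by (rule trp_red[OF tprod_carrier[OF c] Lc])
      also have "\<dots> = trp (d ^ Suc a) (tprod (?X(a := L i x)) (Suc a)) R"
        unfolding ktensor_tprod_single[OF c Lc] by (simp add: mult.commute)
      \<comment> \<open>The string operators are identities at the positions from i to a, so
        transposing i and a moves only the factor \<open>L i x\<close>, from the last position to
        position i.\<close>
      also have "tprod (?X(a := L i x)) (Suc a) = tprod (\<lambda>m. (?X(i := L i x)) (Transposition.transpose i a m)) (Suc a)"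
        using i by (intro tprod_cong) (auto simp: string_ops_def Transposition.transpose_def)
      also have "trp (d ^ Suc a) \<dots> R = trp (d ^ Suc a) (tprod (?X(i := L i x)) (Suc a)) R"
        by (rule Rs[unfolded sym_op_def, rule_format, OF c']) (use i in \<open>auto intro!: permutes_swap_id\<close>)
      finally show ?thesis unfolding Q\<phi> \<phi>_def string_ops_Suc[OF x] by simp
    qed
    have "rtrace (d ^ a) S = p"
    proof -
      have "trp (d ^ a) (1\<^sub>m (d ^ a)) S = trp (d ^ a * d) (1\<^sub>m (d ^ a * d)) R"
        unfolding S_def trp_red[OF one_carrier_mat one_carrier_mat] ktensor_one_one ..
      then show ?thesis unfolding p rtrace_trp by (simp add: mult.commute)
    qed
    \<comment> \<open>The masses p, W and Q are rewritten as the total and the two marginals of the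
      joint weights, the form in which Holevo's bound is stated.\<close>
    then have "(\<Sum>x<d. \<Sum>J<d ^ i. Q (Suc i) (J * d + x) * ln (Q (Suc i) (J * d + x) * p / (W i x * Q i J)))
      = (\<Sum>x<d. \<Sum>J<d ^ i. Q (Suc i) (J * d + x) * ln (Q (Suc i) (J * d + x) * rtrace (d ^ a) S /
          ((\<Sum>J'<d ^ i. Q (Suc i) (J' * d + x)) * (\<Sum>x'<d. Q (Suc i) (J * d + x')))))"
      using i by (simp add: Wsum Qsum)
    also have "\<dots> \<le> ent (d ^ a) S - (\<Sum>x<d. ent (d ^ a) (Rx x))"
    proof (rule holevo_mutual_information[OF finite_lessThan _ _ _ M])
      show "psd (d ^ a) (Rx x)" if "x \<in> {..<d}" for x
        unfolding Rx_def using that i by (intro psd_red Lp Rp') auto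
      show "psd (d ^ a) S" unfolding S_def by (intro psd_red psd_one Rp')
      show "S $$ (r, c) = (\<Sum>x<d. Rx x $$ (r, c))" if "r < d ^ a" "c < d ^ a" for r c
        unfolding S_def Rx_def by (rule red_sum[OF L[OF i] that])
      show "Q (Suc i) (J * d + x) = Re (trp (d ^ a) (M J) (Rx x))" if "x \<in> {..<d}" "J \<in> {..<d ^ i}" for x J
        using that by (intro joint) auto
    qed
    also have "\<dots> = chi d a R (L i)" by (simp add: chi_def S_def Rx_def)
    finally show ?thesis using g[OF i] by linarith
  qed
  \<comment> \<open>i + 1 outcomes yield i mutual informations. Positivity of the single marginals
    is carried along because splitting the logarithm needs it for all earlier outcomes; it also
    supplies the support condition of the relative entropy later.\<close>
  show ?thesis using i
  proof (induction i)
    case 0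
    have "string_ops d L (Suc 0) J = (\<lambda>_. 1\<^sub>m d)(0 := L 0 J)" if "J < d" for J
      using that by (auto simp: string_ops_def fun_eq_iff digit_def)
    then have QW: "Q (Suc 0) J = W 0 J" if "J < d" for J using that by (simp add: Q\<phi> W\<phi>)
    have "Q (Suc 0) J * ln (Q (Suc 0) J / p / (\<Prod>m<Suc 0. W m (digit d (Suc 0) J m) / p)) = 0" if "J < d" for J
      using that p0 QW[OF that] by (cases "W 0 J = 0") (auto simp: digit_def)
    then show ?case using QW by (auto simp: digit_def)
  next
    case (Suc i)
    then have i: "Suc i \<le> a" "i \<le> a" by auto
    let ?q = "\<lambda>J. \<Prod>m<Suc i. W m (digit d (Suc i) J m) / p"
    let ?Q' = "\<lambda>J x. Q (Suc (Suc i)) (J * d + x)"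
    have IH1: "(\<Sum>J<d ^ Suc i. Q (Suc i) J * ln (Q (Suc i) J / p / ?q J)) \<le> real i * g"
      and IH2: "\<And>J m. J < d ^ Suc i \<Longrightarrow> 0 < Q (Suc i) J \<Longrightarrow> m < Suc i \<Longrightarrow> 0 < W m (digit d (Suc i) J m)"
      using Suc.IH i by auto
    have prod: "(\<Prod>m<Suc (Suc i). W m (digit d (Suc (Suc i)) (J * d + x) m) / p) = ?q J * (W (Suc i) x / p)"
      if "x < d" for J x
    proof -
      have "(\<Prod>m<Suc i. W m (digit d (Suc (Suc i)) (J * d + x) m) / p) = ?q J"
        using that by (intro prod.cong refl) (simp add: digit_Suc)
      then show ?thesis using that by (simp only: prod.lessThan_Suc[of _ "Suc i"]) (simp add: digit_last)
    qed
    have pos: "0 < Q (Suc i) J" "0 < W (Suc i) x" if "0 < ?Q' J x" "x < d" "J < d ^ Suc i" for J x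
      using Qle[OF i(1) that(2), of J] Wle[OF i(1) that(2,3)] that(1) by linarith+
    have split: "?Q' J x * ln (?Q' J x / p / (?q J * (W (Suc i) x / p))) =
        ?Q' J x * ln (Q (Suc i) J / p / ?q J) + ?Q' J x * ln (?Q' J x * p / (W (Suc i) x * Q (Suc i) J))"
      if xJ: "x < d" "J < d ^ Suc i" for J x
    proof (cases "?Q' J x = 0")
      case False
      then have Qp: "0 < ?Q' J x" using Q0[of "Suc (Suc i)" "J * d + x"] i(1) by simp
      note pos' = pos[OF Qp xJ]
      have "0 < ?q J" using IH2[OF xJ(2) pos'(1)] p0 by (intro prod_pos) auto
      have "ln (?Q' J x / p / (?q J * (W (Suc i) x / p))) =
          ln (Q (Suc i) J / p / ?q J) + ln (?Q' J x * p / (W (Suc i) x * Q (Suc i) J))"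
        by (rule ln_split) (use Qp pos' p0 \<open>0 < ?q J\<close> in auto)
      then show ?thesis by (simp only: distrib_left)
    qed simp
    have sum_split: "(\<Sum>J<d ^ Suc (Suc i). F J) = (\<Sum>J<d ^ Suc i. \<Sum>x<d. F (J * d + x))" for F :: "nat \<Rightarrow> real"
      using sum_lessThan_mult[of F "d ^ Suc i" d] by (simp add: mult.commute)
    have "(\<Sum>J<d ^ Suc (Suc i). Q (Suc (Suc i)) J * ln (Q (Suc (Suc i)) J / p / (\<Prod>m<Suc (Suc i). W m (digit d (Suc (Suc i)) J m) / p)))
      = (\<Sum>J<d ^ Suc i. \<Sum>x<d. ?Q' J x * ln (Q (Suc i) J / p / ?q J) + ?Q' J x * ln (?Q' J x * p / (W (Suc i) x * Q (Suc i) J)))"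
      unfolding sum_split by (intro sum.cong refl) (simp only: prod split lessThan_iff)
    also have "\<dots> = (\<Sum>J<d ^ Suc i. Q (Suc i) J * ln (Q (Suc i) J / p / ?q J)) +
        (\<Sum>x<d. \<Sum>J<d ^ Suc i. ?Q' J x * ln (?Q' J x * p / (W (Suc i) x * Q (Suc i) J)))"
      unfolding sum.distrib sum_distrib_right[symmetric] Qsum[OF i(1)]
      by (intro arg_cong2[of _ _ _ _ "(+)"] refl sum.swap)
    also have "\<dots> \<le> real i * g + g" by (intro add_mono IH1 mutual i)
    finally have 1: "(\<Sum>J<d ^ Suc (Suc i). Q (Suc (Suc i)) J * ln (Q (Suc (Suc i)) J / p / (\<Prod>m<Suc (Suc i). W m (digit d (Suc (Suc i)) J m) / p)))
      \<le> real (Suc i) * g" by (simp add: algebra_simps)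
    have 2: "0 < W m (digit d (Suc (Suc i)) J m)" if J: "J < d ^ Suc (Suc i)" "0 < Q (Suc (Suc i)) J" and m: "m < Suc (Suc i)" for J m
    proof -
      define J' x where "J' = J div d" and "x = J mod d"
      have Jx: "J = J' * d + x" "x < d" "J' < d ^ Suc i"
        using d J(1) by (simp_all add: J'_def x_def less_mult_imp_div_less mult.commute)
      note pos' = pos[OF J(2)[unfolded Jx(1)] Jx(2,3)]
      show ?thesis
      proof (cases "m = Suc i")
        case True
        then show ?thesis using pos'(2) by (simp add: digit_last x_def)
      next
        case False
        then have "m < Suc i" using m by simp
        then show ?thesis using IH2[OF Jx(3) pos'(1)] by (simp add: digit_Suc[of m "Suc i"] J'_def)
      qed
    qed
    from 1 2 show ?case by blast
  qed
qed

section \<open>Main result\<close>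

lemma trp_smult:
  assumes "B \<in> carrier_mat n n"
  shows "trp n A (c \<cdot>\<^sub>m B) = c * trp n A B"
  using assms unfolding trp_def sum_distrib_left by (intro sum.cong refl) (simp add: mult_ac)

lemma ptrace2_eq_red_one: "ptrace2 n1 n2 A = red n1 n2 (1\<^sub>m n2) A"
proof (rule eq_matI)
  fix i j assume "i < dim_row (red n1 n2 (1\<^sub>m n2) A)" "j < dim_col (red n1 n2 (1\<^sub>m n2) A)"
  then have ij: "i < n1" "j < n1" by (auto simp: red_def)
  have "(\<Sum>l<n2. \<Sum>l'<n2. 1\<^sub>m n2 $$ (l, l') * A $$ (i * n2 + l', j * n2 + l))
     = (\<Sum>l<n2. \<Sum>l'<n2. if l' = l then A $$ (i * n2 + l, j * n2 + l) else 0)"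
    by (intro sum.cong refl) auto
  then show "ptrace2 n1 n2 A $$ (i, j) = red n1 n2 (1\<^sub>m n2) A $$ (i, j)"
    using ij by (simp add: ptrace2_def red_def)
qed (auto simp: ptrace2_def red_def)

lemma trp_tprod:
  assumes "\<And>m. m < N \<Longrightarrow> X m \<in> carrier_mat d d" "\<And>m. m < N \<Longrightarrow> Y m \<in> carrier_mat d d"
  shows "trp (d ^ N) (tprod X N) (tprod Y N) = (\<Prod>m<N. trp d (X m) (Y m))"
  using assms
proof (induction N)
  case 0
  then show ?case by (simp add: trp_def)
next
  case (Suc N)
  have "trp (d ^ N * d) (ktensor (tprod X N) (X N)) (ktensor (tprod Y N) (Y N)) =
      trp (d ^ N) (tprod X N) (tprod Y N) * trp d (X N) (Y N)"
    using Suc.prems by (intro trp_ktensor tprod_carrier) auto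
  then show ?case using Suc by (simp add: mult.commute)
qed

text \<open>\<open>one_particle\<close> keeps the first particle. Transposing positions 0 and m
  shows that its state also gives the marginal of particle m.\<close>

lemma sym_op_marginal:
  assumes R: "sym_op d (Suc a) R" and L: "L \<in> carrier_mat d d" and m: "m \<le> a"
  shows "trp d L (red d (d ^ a) (1\<^sub>m (d ^ a)) R) = trp (d ^ Suc a) (tprod ((\<lambda>_. 1\<^sub>m d)(m := L)) (Suc a)) R"
proof -
  define Z where "Z = (\<lambda>_. 1\<^sub>m d)(m := L)"
  have Z: "Z i \<in> carrier_mat d d" for i using L by (simp add: Z_def)
  have "ktensor L (1\<^sub>m (d ^ a)) = ktensor (tprod (\<lambda>_. L) 1) (tprod (\<lambda>_. 1\<^sub>m d) a)"
    using ktensor_one_left[OF L] by (simp add: tprod_one)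
  also have "\<dots> = tprod (\<lambda>i. if i < 1 then L else 1\<^sub>m d) (1 + a)"
    by (rule tprod_append) (use L in auto)
  also have "\<dots> = tprod (\<lambda>i. Z (Transposition.transpose 0 m i)) (Suc a)"
    unfolding plus_1_eq_Suc by (intro tprod_cong) (auto simp: Z_def Transposition.transpose_def)
  finally have "trp d L (red d (d ^ a) (1\<^sub>m (d ^ a)) R) = trp (d ^ Suc a) (tprod (\<lambda>i. Z (Transposition.transpose 0 m i)) (Suc a)) R"
    unfolding trp_red[OF L one_carrier_mat] by simp
  also have "\<dots> = trp (d ^ Suc a) (tprod Z (Suc a)) R"
    by (rule R[unfolded sym_op_def, rule_format, OF Z]) (use m in \<open>auto intro!: permutes_swap_id\<close>)
  finally show ?thesis by (simp add: Z_def)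
qed

text \<open>Every particle has the one-particle state as its marginal, so the product state yields
  the product of the outcome marginals and the relative entropy is the total correlation of the
  outcomes. The factor p undoes the normalisation of \<gamma> and matches the homogeneous
  \<open>chi\<close> and g.\<close>

lemma measured_relative_entropy_to_product_le:
  assumes d: "0 < d" and Rp: "psd (d ^ Suc a) R" and Rs: "sym_op d (Suc a) R"
    and p: "p = rtrace (d ^ Suc a) R" and p0: "0 < p"
    and \<gamma>: "\<gamma> = complex_of_real (1 / p) \<cdot>\<^sub>m R"
    and \<Lambda>: "\<And>i. i < Suc a \<Longrightarrow> is_measurement d (\<Lambda> i)"
    and g: "\<And>L. povm d {..<d} L \<Longrightarrow> chi d a R L \<le> g"
  shows "ereal p * qrel_entropy (apply_meas (d ^ Suc a) (meas_tensor_list d \<Lambda> (Suc a)) \<gamma>)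
      (apply_meas (d ^ Suc a) (meas_tensor_list d \<Lambda> (Suc a)) (tensor_pow (one_particle d (Suc a) \<gamma>) (Suc a)))
    \<le> ereal (real a * g)"
proof -
  let ?k = "Suc a" and ?E = "meas_tensor_list d \<Lambda> (Suc a)"
  define L where "L m = fst (\<Lambda> m)" for m
  have L: "povm d {..<d} (L m)" if "m \<le> a" for m
    unfolding L_def using that by (intro is_measurement_povm \<Lambda>) simp
  have Lp: "psd d (L m x)" if "m \<le> a" "x < d" for m x using L[OF that(1)] that(2) unfolding povm_def by auto
  define Q where "Q i J = Re (trp (d ^ ?k) (tprod (string_ops d L i J) ?k) R)" for i J
  define W where "W m x = Re (trp (d ^ ?k) (tprod ((\<lambda>_. 1\<^sub>m d)(m := L m x)) ?k) R)" for m x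
  define P where "P J = Q ?k J / p" for J
  define q where "q J = (\<Prod>m<?k. W m (digit d ?k J m) / p)" for J
  define \<gamma>1 where "\<gamma>1 = one_particle d ?k \<gamma>"
  note Rc = psdD(1)[OF Rp]
  have \<gamma>c: "\<gamma> \<in> carrier_mat (d ^ ?k) (d ^ ?k)" using Rc by (simp add: \<gamma>)
  have \<gamma>1c: "\<gamma>1 \<in> carrier_mat d d" by (simp add: \<gamma>1_def one_particle_def ptrace2_def)
  have real_of_psd: "trp n A B = of_real (Re (trp n A B))" if "psd n A" "psd n B" for n A B
    using Im_trp[OF that] by (simp add: complex_eq_iff)
  have E: "fst ?E J = tprod (string_ops d L ?k J) ?k" for J
    unfolding meas_tensor_list_fst by (rule tprod_cong) (simp add: string_ops_def L_def)
  have Ep: "psd (d ^ ?k) (fst ?E J)" for J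
    unfolding E using L by (intro psd_tprod string_ops_psd[OF d]) auto
  have P: "trp (d ^ ?k) (fst ?E J) \<gamma> = of_real (P J)" for J
  proof -
    have "trp (d ^ ?k) (fst ?E J) \<gamma> = of_real (1 / p) * trp (d ^ ?k) (fst ?E J) R"
      unfolding \<gamma> by (rule trp_smult[OF Rc])
    also have "trp (d ^ ?k) (fst ?E J) R = of_real (Q ?k J)"
      unfolding Q_def E[symmetric] by (rule real_of_psd[OF Ep Rp])
    finally show ?thesis by (simp add: P_def)
  qed
  have w: "trp d (L m x) \<gamma>1 = of_real (W m x / p)" if mx: "m \<le> a" "x < d" for m x
  proof -
    have Lc: "L m x \<in> carrier_mat d d" using psdD(1)[OF Lp[OF mx]] .
    have "\<gamma>1 = red d (d ^ a) (1\<^sub>m (d ^ a)) \<gamma>"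
      by (simp add: \<gamma>1_def one_particle_def ptrace2_eq_red_one)
    then have "trp d (L m x) \<gamma>1 = of_real (1 / p) * trp (d * d ^ a) (ktensor (L m x) (1\<^sub>m (d ^ a))) R"
      using trp_smult[of R "d * d ^ a"] Rc by (simp add: trp_red[OF Lc one_carrier_mat] \<gamma>)
    also have "trp (d * d ^ a) (ktensor (L m x) (1\<^sub>m (d ^ a))) R = trp (d ^ ?k) (tprod ((\<lambda>_. 1\<^sub>m d)(m := L m x)) ?k) R"
      using sym_op_marginal[OF Rs Lc mx(1)] by (simp only: trp_red[OF Lc one_carrier_mat])
    also have "\<dots> = of_real (W m x)"
      unfolding W_def by (rule real_of_psd[OF psd_tprod Rp]) (auto simp: psd_one Lp mx)
    finally show ?thesis by simp
  qed
  have q: "trp (d ^ ?k) (fst ?E J) (tensor_pow \<gamma>1 ?k) = of_real (q J)" for J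
  proof -
    have "trp (d ^ ?k) (fst ?E J) (tensor_pow \<gamma>1 ?k) = (\<Prod>m<?k. trp d (L m (digit d ?k J m)) \<gamma>1)"
      unfolding meas_tensor_list_fst tensor_pow_eq_tprod L_def[symmetric]
      using digit_less[OF d] by (intro trp_tprod \<gamma>1c psdD(1)[OF Lp]) auto
    also have "\<dots> = (\<Prod>m<?k. of_real (W m (digit d ?k J m) / p))"
      using digit_less[OF d] by (intro prod.cong refl w) auto
    finally show ?thesis by (simp only: q_def of_real_prod)
  qed
  have W0: "0 \<le> W m x" if "m \<le> a" "x < d" for m x
    unfolding W_def using that by (intro Re_trp_nonneg psd_tprod Rp) (auto simp: psd_one Lp)
  have Q0: "0 \<le> Q ?k J" for J unfolding Q_def E[symmetric] by (rule Re_trp_nonneg[OF Ep Rp])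
  have P0: "0 \<le> P J" for J using Q0 p0 by (simp add: P_def)
  have q0: "0 \<le> q J" for J
    unfolding q_def using p0 digit_less[OF d] by (intro prod_nonneg divide_nonneg_pos) (auto intro!: W0)
  have tc: "(\<Sum>J<d ^ ?k. Q ?k J * ln (Q ?k J / p / (\<Prod>m<?k. W m (digit d ?k J m) / p))) \<le> real a * g"
    and pos: "\<And>J m. J < d ^ ?k \<Longrightarrow> 0 < Q ?k J \<Longrightarrow> m < ?k \<Longrightarrow> 0 < W m (digit d ?k J m)"
    using total_correlation_le[OF d Rp Rs L _ p p0 Q_def W_def order_refl, of g] g L by blast+
  \<comment> \<open>A string of positive weight has positive single marginals. This excludes the
    infinite value of the relative entropy and justifies splitting the logarithm of P / q.\<close>
  have Ppos: "0 < P J \<and> 0 < q J" if "J < d ^ ?k" "P J \<noteq> 0" for J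
  proof -
    have "0 < Q ?k J" using that Q0[of J] by (auto simp: P_def less_le)
    moreover from this have "0 < q J"
      unfolding q_def using pos[OF that(1)] p0 by (intro prod_pos divide_pos_pos) auto
    ultimately show ?thesis using p0 by (simp add: P_def)
  qed
  have Eb: "snd ?E J \<in> carrier_vec (d ^ ?k)" if "J < d ^ ?k" for J
    using meas_tensor_list_snd[of ?k d \<Lambda>, OF \<Lambda>] that by blast
  have Eo: "snd ?E J \<bullet>c snd ?E K = (if J = K then 1 else 0)" if "J < d ^ ?k" "K < d ^ ?k" for J K
    using meas_tensor_list_snd[of ?k d \<Lambda>, OF \<Lambda>] that by blast
  have tpc: "tensor_pow \<gamma>1 ?k \<in> carrier_mat (d ^ ?k) (d ^ ?k)"
    unfolding tensor_pow_eq_tprod by (rule tprod_carrier) (rule \<gamma>1c)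
  have "qrel_entropy (apply_meas (d ^ ?k) ?E \<gamma>) (apply_meas (d ^ ?k) ?E (tensor_pow \<gamma>1 ?k))
    = ereal (\<Sum>J<d ^ ?k. P J * (ln (P J) - ln (q J)))"
  proof (rule qrel_entropy_same_basis)
    show "spectral (d ^ ?k) (apply_meas (d ^ ?k) ?E \<gamma>) P (\<lambda>s i. snd ?E s $ i)"
      by (rule apply_meas_spectral[OF Eb Eo psdD(1)[OF Ep] \<gamma>c P P0])
    show "spectral (d ^ ?k) (apply_meas (d ^ ?k) ?E (tensor_pow \<gamma>1 ?k)) q (\<lambda>s i. snd ?E s $ i)"
      by (rule apply_meas_spectral[OF Eb Eo psdD(1)[OF Ep] tpc q q0])
    show "P J = 0" if "J < d ^ ?k" "q J = 0" for J using Ppos[OF that(1)] that(2) by auto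
  qed (simp_all add: apply_meas_def)
  moreover have "p * (\<Sum>J<d ^ ?k. P J * (ln (P J) - ln (q J))) =
      (\<Sum>J<d ^ ?k. Q ?k J * ln (Q ?k J / p / (\<Prod>m<?k. W m (digit d ?k J m) / p)))"
    unfolding sum_distrib_left
  proof (intro sum.cong refl)
    fix J assume "J \<in> {..<d ^ ?k}"
    then have "P J * (ln (P J) - ln (q J)) = P J * ln (P J / q J)"
      using Ppos[of J] by (cases "P J = 0") (auto simp: ln_div)
    then show "p * (P J * (ln (P J) - ln (q J))) = Q ?k J * ln (Q ?k J / p / (\<Prod>m<?k. W m (digit d ?k J m) / p))"
      using p0 by (simp add: P_def q_def)
  qed
  ultimately show ?thesis using tc by (simp add: \<gamma>1_def)
qed

theorem theoremA2:
  fixes d N k :: nat and \<Gamma> :: "complex mat"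
  assumes "1 \<le> d"
    and "symmetric_state d N \<Gamma>"
    and "1 \<le> k" and "k \<le> N"
  shows "(INF E \<in> {E. is_measurement (d ^ (N - k)) E}.
           SUP \<Lambda> \<in> {\<Lambda>. \<forall>i<k. is_measurement d (\<Lambda> i)}.
             (\<Sum>\<mu> \<in> {\<mu>. \<mu> < d ^ (N - k) \<and> outcome_prob d k \<Gamma> E \<mu> > 0}.
                ereal (outcome_prob d k \<Gamma> E \<mu>) *
                qrel_entropy
                  (apply_meas (d ^ k) (meas_tensor_list d \<Lambda> k) (cond_state d N k \<Gamma> E \<mu>))
                  (apply_meas (d ^ k) (meas_tensor_list d \<Lambda> k)
                     (tensor_pow (one_particle d k (cond_state d N k \<Gamma> E \<mu>)) k))))
         \<le> ereal ((real k - 1)\<^sup>2 * ln (real d) / (real N - real k + 1))"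
proof -
  define a m where "a = k - 1" and "m = N - k"
  have k: "k = Suc a" and N: "N = Suc a + m" and Nk: "N - k = m" using assms by (auto simp: a_def m_def)
  have d: "0 < d" using assms(1) by simp
  have dens: "density (d ^ N) \<Gamma>" using assms(2) unfolding symmetric_state_def by blast
  have Gp: "psd (d ^ (Suc a + m)) \<Gamma>" using dens unfolding density_def N by blast
  have Gs: "sym_op d (Suc a + m) \<Gamma>" using sym_op_of_symmetric_state[OF d assms(2)] unfolding N .
  have Gp': "psd (d ^ k * d ^ m) \<Gamma>" using Gp by (simp add: k power_add mult_ac)
  have dN: "d ^ k * d ^ m = d ^ N" "d ^ a * d ^ Suc m = d ^ N" by (simp_all add: k N power_add mult_ac)
  obtain M g where good: "good_measurement d a m \<Gamma> M g"
    using good_measurement_exists[OF d Gp Gs] by blast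
  then have M: "povm (d ^ m) {..<d ^ m} M" unfolding good_measurement_def by blast
  have Mp: "psd (d ^ m) (M j)" if "j < d ^ m" for j using M that unfolding povm_def by auto
  define E where "E = (M, \<lambda>j. unit_vec (d ^ m) j :: complex vec)"
  have E: "is_measurement (d ^ (N - k)) E"
    unfolding is_measurement_def Nk using M Mp
    by (auto simp: E_def povm_def)
  define R where "R \<mu> = red (d ^ k) (d ^ m) (M \<mu>) \<Gamma>" for \<mu>
  have R: "ptrace2 (d ^ k) (d ^ (N - k)) (ktensor (1\<^sub>m (d ^ k)) (fst E \<mu>) * \<Gamma>) = R \<mu>" if "\<mu> < d ^ m" for \<mu>
    unfolding Nk R_def E_def fst_conv by (rule ptrace2_eq_red[OF psdD(1)[OF Mp[OF that]] psdD(1)[OF Gp']])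
  have prob: "outcome_prob d k \<Gamma> E \<mu> = rtrace (d ^ k) (R \<mu>)" if "\<mu> < d ^ m" for \<mu>
  proof -
    note Mc = psdD(1)[OF Mp[OF that]]
    have "mtrace (ktensor (1\<^sub>m (d ^ k)) (M \<mu>) * \<Gamma>) = trp (d ^ k * d ^ m) (ktensor (1\<^sub>m (d ^ k)) (M \<mu>)) \<Gamma>"
      by (rule mtrace_mult[OF ktensor_carrier[OF one_carrier_mat Mc] psdD(1)[OF Gp']])
    then show ?thesis
      by (simp add: outcome_prob_def E_def R_def rtrace_trp trp_red[OF one_carrier_mat Mc])
  qed
  have Gtr: "rtrace (d ^ a) (red (d ^ a) (d ^ Suc m) (1\<^sub>m (d ^ Suc m)) \<Gamma>) = 1"
  proof -
    have "trp (d ^ a) (1\<^sub>m (d ^ a)) (red (d ^ a) (d ^ Suc m) (1\<^sub>m (d ^ Suc m)) \<Gamma>) = trp (d ^ N) (1\<^sub>m (d ^ N)) \<Gamma>"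
      unfolding trp_red[OF one_carrier_mat one_carrier_mat] ktensor_one_one dN ..
    then have "rtrace (d ^ a) (red (d ^ a) (d ^ Suc m) (1\<^sub>m (d ^ Suc m)) \<Gamma>) = rtrace (d ^ N) \<Gamma>"
      by (simp only: rtrace_trp)
    also have "\<dots> = Re (mtrace \<Gamma>)" using psdD(1)[OF Gp] by (simp add: rtrace_def mtrace_def N)
    finally show ?thesis using dens unfolding density_def by simp
  qed
  have bound: "(\<Sum>\<mu> \<in> {\<mu>. \<mu> < d ^ (N - k) \<and> outcome_prob d k \<Gamma> E \<mu> > 0}.
                ereal (outcome_prob d k \<Gamma> E \<mu>) *
                qrel_entropy
                  (apply_meas (d ^ k) (meas_tensor_list d \<Lambda> k) (cond_state d N k \<Gamma> E \<mu>))
                  (apply_meas (d ^ k) (meas_tensor_list d \<Lambda> k)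
                     (tensor_pow (one_particle d k (cond_state d N k \<Gamma> E \<mu>)) k)))
         \<le> ereal ((real k - 1)\<^sup>2 * ln (real d) / (real N - real k + 1))" (is "sum ?f ?S \<le> _")
    if \<Lambda>: "\<forall>i<k. is_measurement d (\<Lambda> i)" for \<Lambda>
  proof -
    have "?f \<mu> \<le> ereal (real a * g \<mu>)" if \<mu>: "\<mu> \<in> ?S" for \<mu>
    proof -
      have \<mu>m: "\<mu> < d ^ m" and pos: "0 < rtrace (d ^ k) (R \<mu>)" using \<mu> prob[of \<mu>] by (auto simp: Nk)
      have cs: "cond_state d N k \<Gamma> E \<mu> = complex_of_real (1 / rtrace (d ^ k) (R \<mu>)) \<cdot>\<^sub>m R \<mu>"
        unfolding cond_state_def R[OF \<mu>m] prob[OF \<mu>m] ..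
      have Rp: "psd (d ^ Suc a) (R \<mu>)" unfolding R_def k[symmetric] by (rule psd_red[OF Mp[OF \<mu>m] Gp'])
      have Rs: "sym_op d (Suc a) (R \<mu>)" and chi: "\<And>L. povm d {..<d} L \<Longrightarrow> chi d a (R \<mu>) L \<le> g \<mu>"
        using good \<mu>m unfolding good_measurement_def R_def k by blast+
      show ?thesis
        using measured_relative_entropy_to_product_le[OF d Rp Rs refl _ refl _ chi, of \<Lambda>] pos \<Lambda>
        unfolding cs prob[OF \<mu>m] unfolding k by simp
    qed
    then have "sum ?f ?S \<le> (\<Sum>\<mu>\<in>?S. ereal (real a * g \<mu>))" by (rule sum_mono)
    also have "\<dots> = ereal (\<Sum>\<mu>\<in>?S. real a * g \<mu>)" by simp
    \<comment> \<open>Outcomes of probability zero are added; their terms are nonnegative since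
      \<open>0 <= g j\<close>, and the budget speaks about all outcomes.\<close>
    also have "\<dots> \<le> ereal (\<Sum>\<mu><d ^ m. real a * g \<mu>)"
      unfolding ereal_less_eq using good unfolding good_measurement_def Nk
      by (intro sum_mono2) auto
    also have "\<dots> \<le> ereal ((real k - 1)\<^sup>2 * ln (real d) / (real N - real k + 1))"
      unfolding ereal_less_eq
    proof -
      \<comment> \<open>The budget, with m + 1 = N - k + 1 and the entropy of a = k - 1 particles,
        gives one factor k - 1; the other is the number a of mutual informations already in front of
        the sum.\<close>
      have "real (Suc m) * (\<Sum>j<d ^ m. g j) \<le> ent (d ^ a) (red (d ^ a) (d ^ Suc m) (1\<^sub>m (d ^ Suc m)) \<Gamma>)"
        using good unfolding good_measurement_def by blast
      also have "\<dots> \<le> 1 * ln (real (d ^ a))"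
        unfolding Gtr[symmetric] using Gp by (intro ent_bounds(2) psd_red psd_one) (simp only: dN N)
      also have "\<dots> = real a * ln (real d)" using d by (simp add: ln_realpow)
      finally have "(\<Sum>j<d ^ m. g j) \<le> real a * ln (real d) / real (Suc m)"
        by (simp add: pos_le_divide_eq mult.commute)
      then have "real a * (\<Sum>j<d ^ m. g j) \<le> real a * (real a * ln (real d) / real (Suc m))"
        by (intro mult_left_mono) auto
      then show "(\<Sum>\<mu><d ^ m. real a * g \<mu>) \<le> (real k - 1)\<^sup>2 * ln (real d) / (real N - real k + 1)"
        by (simp add: sum_distrib_left k N power2_eq_square add.commute)
    qed
    finally show ?thesis .
  qed
  \<comment> \<open>E was fixed before the local measurements appeared, so the bound for all
    \<Lambda> is a bound on the supremum at E, and the infimum is below it.\<close>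
  show ?thesis
    by (rule INF_lower2[of E]) (use E in simp, rule SUP_least, rule bound, simp)
qed

end
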